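(* Let $m \geq 2$ be an integer with $6\mid m$ and set $r:=\lfloor (m-1)/6\rfloor$. Let $(R_n)_{n\ge 0}$ be the composition vectors of the cyclic urn with $m$ types started with one ball of type $0$. Then there exist complex valued random variables $\Xi_1,\ldots,\Xi_r$ (on the probability space of the urn process) such that, as $n \to \infty$, $$\frac{1}{\sqrt{n\log n}}\left(R_n- \mathbb{E}[R_n] - \sum_{k=1}^r 2\,\Re\left(n^{\omega^k}\Xi_k v_k\right)\right) \stackrel{d}{\longrightarrow}\mathcal{N}\left(0,\Sigma^{(m)}\right),$$ where the covariance matrix $\Sigma^{(m)}$ has rank $2$ and is given by $$\Sigma^{(m)}= v_{m/6}v_{m/6}^*+ v_{5m/6}v_{5m/6}^*.$$
   Context: Cyclic urn: balls have types $0,\ldots,m-1$. At time $0$ there is one ball, of type $0$. In each step a ball is drawn uniformly at random from the balls in the urn, independently of the past; if its type is $j$, it is returned to the urn together with a new ball of type $j+1 \bmod m$. $R_n=(R_{n,0},\ldots,R_{n,m-1})^t\in\mathbb{R}^m$ is the column vector of the numbers of balls of each type after $n$ steps. Notation: $\omega:=\exp(2\pi \mathrm{i}/m)$ and $v_k:=\frac1m(1,\omega^{-k},\omega^{-2k},\ldots,\omega^{-(m-1)k})^t\in\mathbb{C}^m$ for $0\le k\le m-1$. $v^*$ denotes the conjugate transpose of $v$; $\Re$ of a vector is taken componentwise; $n^{z}=\exp(z\log n)$ for complex $z$. $\stackrel{d}{\longrightarrow}$ is convergence in distribution and $\mathcal{N}(0,M)$ is the centered (possibly degenerate) normal distribution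 with covariance matrix $M$. Empty sums are $0$. *)

theory Defs
  imports "HOL-Probability.Probability"
begin

(* The balls are numbered 0, 1, 2, ... in the order in which they enter the urn, so after n steps
   the urn contains the balls 0, ..., n. Step n + 1 draws the ball with number draw n and adds the
   ball with number n + 1; ty b is the type of ball b. The choice of count_space {..n} in indep
   forces draw n to take values in {..n} on all of space M. *)
locale cyclic_urn = prob_space M for M :: "'a measure" +
  fixes m :: nat
    and draw :: "nat \<Rightarrow> 'a \<Rightarrow> nat"
    and ty :: "nat \<Rightarrow> 'a \<Rightarrow> nat"
  assumes indep: "indep_vars (\<lambda>n. count_space {..n}) draw UNIV"
    and uniform: "\<And>n. distr M (count_space {..n}) (draw n) = uniform_count_measure {..n}"
    and ty_0: "\<And>x. x \<in> space M \<Longrightarrow> ty 0 x = 0"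
    and ty_Suc: "\<And>n x. x \<in> space M \<Longrightarrow> ty (Suc n) x = (ty (draw n x) x + 1) mod m"

(* Throughout, idx is a bijection from the index type of the vectors onto {..<m}: the coordinate
   i of a vector is the one that the mathematics labels idx i. *)

definition composition ::
    "('m::finite \<Rightarrow> nat) \<Rightarrow> (nat \<Rightarrow> 'a \<Rightarrow> nat) \<Rightarrow> nat \<Rightarrow> 'a \<Rightarrow> real ^ 'm" where
  "composition idx ty n x = (\<chi> i. real (card {b \<in> {..n}. ty b x = idx i}))"

definition omega :: "nat \<Rightarrow> complex" where
  "omega m = exp (2 * of_real pi * \<i> / of_nat m)"

definition eigvec :: "nat \<Rightarrow> ('m::finite \<Rightarrow> nat) \<Rightarrow> nat \<Rightarrow> complex ^ 'm" where
  "eigvec m idx k = (\<chi> i. 1 / of_nat m * omega m powi (- int (idx i * k)))"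

definition Re_vec :: "complex ^ 'm \<Rightarrow> real ^ 'm" where
  "Re_vec v = (\<chi> i. Re (v $ i))"

(* the matrix v w^*, where w^* is the conjugate transpose of w *)
definition outer_adj :: "complex ^ 'm \<Rightarrow> complex ^ 'm \<Rightarrow> complex ^ 'm ^ 'm" where
  "outer_adj v w = (\<chi> i j. v $ i * cnj (w $ j))"

definition complex_mat :: "real ^ 'm ^ 'n \<Rightarrow> complex ^ 'm ^ 'n" where
  "complex_mat A = (\<chi> i j. complex_of_real (A $ i $ j))"

(* the univariate normal law with mean mu and standard deviation s, a point mass for s = 0 *)
definition normal_law :: "real \<Rightarrow> real \<Rightarrow> real measure" where
  "normal_law mu s =
     (if s = 0 then return borel mu else density lborel (\<lambda>x. ennreal (normal_density mu s x)))"

(* nu is the law N(0, S): S is a covariance matrix and every linear functional t of nu is normal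
   with mean 0 and variance t^T S t *)
definition centered_normal :: "real ^ 'm ^ 'm \<Rightarrow> (real ^ 'm) measure \<Rightarrow> bool" where
  "centered_normal S nu \<longleftrightarrow>
     transpose S = S \<and> (\<forall>t. 0 \<le> t \<bullet> (S *v t)) \<and>
     prob_space nu \<and> sets nu = sets borel \<and>
     (\<forall>t. distr nu borel (\<lambda>x. t \<bullet> x) = normal_law 0 (sqrt (t \<bullet> (S *v t))))"

(* convergence in distribution of random vectors X n to the law nu; the library notion
   weak_conv_m is restricted to the real line *)
definition conv_in_distribution ::
    "'a measure \<Rightarrow> (nat \<Rightarrow> 'a \<Rightarrow> 'b::topological_space) \<Rightarrow> 'b measure \<Rightarrow> bool" where
  "conv_in_distribution M X nu \<longleftrightarrow>
     (\<forall>n. X n \<in> borel_measurable M) \<and>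
     (\<forall>f :: 'b \<Rightarrow> real. continuous_on UNIV f \<and> bounded (range f) \<longrightarrow>
        (\<lambda>n. \<integral>y. f y \<partial>distr M borel (X n)) \<longlonglongrightarrow> (\<integral>y. f y \<partial>nu))"

end

theory Submission
  imports Defs "HOL-Real_Asymp.Real_Asymp"
begin

text \<open>
The discrete Fourier transform diagonalises the mean of the urn. For an \<open>m\<close>-th root of unity \<open>\<xi>\<close>
let the mode of \<open>\<xi>\<close> be \<open>U n = (\<Sum>b\<le>n. \<xi> ^ ty b)\<close>; then \<open>R n = (\<Sum>k<m. U\<^sub>k n v\<^sub>k)\<close>, where \<open>U\<^sub>k\<close> is the
mode of \<open>\<omega> ^ k\<close> (\<open>composition_eq_sum_modes\<close>). A step adds \<open>\<xi>\<close> times the weight of a uniformly chosen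
ball, so
\<open>U (n + 1) = (1 + \<xi> / (n + 1)) U n + D\<close>, where \<open>D\<close> is bounded and has conditional mean \<open>0\<close>.
The mean of \<open>U n\<close> is therefore the growth factor \<open>G n = (\<Prod>l=1..n. 1 + \<xi> / l)\<close>, whose modulus is
at most of order \<open>n powr Re \<xi>\<close>, and the fluctuation of \<open>U n\<close> depends on the position of \<open>Re \<xi>\<close> relative to \<open>1 / 2\<close>.

\<^item> If \<open>Re \<xi> < 1 / 2\<close>, the noise dominates: \<open>E |U n|^2 = O(n)\<close>, which vanishes under the scaling by
  \<open>sqrt (n ln n)\<close> (\<open>mode_subcritical\<close>).

\<^item> If \<open>Re \<xi> > 1 / 2\<close>, the martingale \<open>U n / G n\<close> has a limit \<open>Z\<close>, and
  \<open>E |U n - G n Z| = O(sqrt n)\<close>. Since \<open>G n\<close> is \<open>\<gamma> n powr \<xi>\<close> up to a relative error \<open>O(1 / n)\<close>, the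
  variable \<open>\<Xi> = \<gamma> (Z - 1)\<close> removes the whole oscillation (\<open>mode_supercritical\<close>). For \<open>\<xi> = \<omega> ^ k\<close> these
  are the indices \<open>1 \<le> k < m / 6\<close> and their mirror images \<open>m - k\<close>; the index \<open>0\<close> is deterministic.

\<^item> If \<open>Re \<xi> = 1 / 2\<close>, that is \<open>k = m / 6\<close> or its mirror image, every scale contributes equally to the
  variance, which gives the factor \<open>ln n\<close>. Write a linear functional of \<open>U N\<close> as a weighted sum of the
  increments \<open>D\<close>. The squared weights are about \<open>1 / (l ln N)\<close>. The conditional covariance of \<open>D\<close> is almost
  isotropic, because the mode of \<open>\<xi>^2\<close>, which measures the anisotropy, is subcritical. Hence adding one
  increment multiplies the characteristic function by \<open>exp (- |c|^2 / 4)\<close>, \<open>c\<close> being its weight, up to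
  errors whose sum tends to \<open>0\<close> (\<open>char_mode_critical\<close>). So \<open>U N / sqrt (N ln N)\<close> is asymptotically a
  rotation invariant complex normal variable \<open>\<zeta>\<close> with \<open>E |\<zeta>|^2 = 1\<close>.

The limit of the composition vector is then \<open>2 Re (\<zeta> v)\<close> with \<open>v = v\<^sub>k\<close> for \<open>k = m / 6\<close>. Its covariance
\<open>2 Re (v v\<^sup>*)\<close> is the matrix in the theorem, and it has rank two because the real and imaginary
parts of \<open>v\<close> are orthogonal and nonzero.

To pass from characteristic functions to convergence in distribution of random vectors, a bounded
continuous function is approximated by trigonometric polynomials with an error growing at most
linearly at infinity (\<open>trig_poly_approximation\<close>); such an error is harmless because all first moments
stay bounded (\<open>conv_in_distribution_of_char\<close>).
\<close>

section \<open>Convergence in distribution from characteristic functions\<close>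

text \<open>Real trigonometric polynomials with arbitrary frequencies, written with phases: a sine is a shifted
cosine, and products of cosines are again sums of cosines, so one kind of generator suffices.\<close>

inductive trig_poly :: "('b::euclidean_space \<Rightarrow> real) \<Rightarrow> bool" where
  wave: "trig_poly (\<lambda>x. c * cos (t \<bullet> x + s))"
| add: "trig_poly f \<Longrightarrow> trig_poly g \<Longrightarrow> trig_poly (\<lambda>x. f x + g x)"

lemma trig_poly_const: "trig_poly (\<lambda>x. c)"
  using trig_poly.wave[of c 0 0] by simp

lemma trig_poly_sum:
  assumes "\<And>i. i \<in> I \<Longrightarrow> trig_poly (f i)"
  shows "trig_poly (\<lambda>x. \<Sum>i\<in>I. f i x)"
  using assms by (induction I rule: infinite_finite_induct)
    (auto intro: trig_poly_const trig_poly.add)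

lemma trig_poly_mult:
  assumes "trig_poly f" and "trig_poly g"
  shows "trig_poly (\<lambda>x. f x * g x)"
  using assms
proof (induction f rule: trig_poly.induct)
  case (wave c t s)
  from wave show ?case
  proof (induction g rule: trig_poly.induct)
    case (wave d u r)
    have "trig_poly (\<lambda>x. (c * d / 2) * cos ((t + u) \<bullet> x + (s + r))
        + (c * d / 2) * cos ((t - u) \<bullet> x + (s - r)))"
      by (intro trig_poly.intros)
    moreover have "(c * d / 2) * cos ((t + u) \<bullet> x + (s + r))
        + (c * d / 2) * cos ((t - u) \<bullet> x + (s - r))
        = c * cos (t \<bullet> x + s) * (d * cos (u \<bullet> x + r))" for x
    proof -
      have 1: "(t + u) \<bullet> x + (s + r) = (t \<bullet> x + s) + (u \<bullet> x + r)"
        and 2: "(t - u) \<bullet> x + (s - r) = (t \<bullet> x + s) - (u \<bullet> x + r)"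
        by (simp_all add: inner_add_left inner_diff_left)
      show ?thesis unfolding 1 2 cos_add cos_diff by (simp add: algebra_simps)
    qed
    ultimately show ?case by simp
  next
    case (add f g)
    then show ?case by (auto simp: distrib_left intro: trig_poly.add)
  qed
next
  case (add f g)
  then show ?case by (auto simp: distrib_right intro: trig_poly.add)
qed

text \<open>The covering of a torus by the space, with period \<open>2 L\<close> in each coordinate. The torus sits inside
\<open>'b \<times> 'b\<close>, cosines in the first component and sines in the second, so that polynomials on the
ambient space restrict to trigonometric polynomials.\<close>

definition wrap :: "real \<Rightarrow> 'b::euclidean_space \<Rightarrow> 'b \<times> 'b" where
  "wrap L x = ((\<Sum>b\<in>Basis. cos (pi * (x \<bullet> b) / L) *\<^sub>R b),
               (\<Sum>b\<in>Basis. sin (pi * (x \<bullet> b) / L) *\<^sub>R b))"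

lemma wrap_eqI:
  assumes "\<And>b. b \<in> Basis \<Longrightarrow> cos (pi * (x \<bullet> b) / L) = cos (pi * (y \<bullet> b) / L)"
    and "\<And>b. b \<in> Basis \<Longrightarrow> sin (pi * (x \<bullet> b) / L) = sin (pi * (y \<bullet> b) / L)"
  shows "wrap L x = wrap L y"
  unfolding wrap_def using assms by simp

lemma wrap_eqD:
  assumes "wrap L x = wrap L y" and "b \<in> Basis"
  shows "cos (pi * (x \<bullet> b) / L) = cos (pi * (y \<bullet> b) / L)"
    and "sin (pi * (x \<bullet> b) / L) = sin (pi * (y \<bullet> b) / L)"
proof -
  have "(\<Sum>b\<in>Basis. cos (pi * (x \<bullet> b) / L) *\<^sub>R b) \<bullet> b
      = (\<Sum>b\<in>Basis. cos (pi * (y \<bullet> b) / L) *\<^sub>R b) \<bullet> b"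
    and "(\<Sum>b\<in>Basis. sin (pi * (x \<bullet> b) / L) *\<^sub>R b) \<bullet> b
      = (\<Sum>b\<in>Basis. sin (pi * (y \<bullet> b) / L) *\<^sub>R b) \<bullet> b"
    using assms(1) unfolding wrap_def by auto
  then show "cos (pi * (x \<bullet> b) / L) = cos (pi * (y \<bullet> b) / L)"
    and "sin (pi * (x \<bullet> b) / L) = sin (pi * (y \<bullet> b) / L)"
    using assms(2) by simp_all
qed

lemma continuous_on_wrap: "continuous_on S (wrap L)"
  unfolding wrap_def[abs_def] divide_inverse by (intro continuous_intros)

lemma trig_poly_wrap:
  fixes P :: "'b::euclidean_space \<times> 'b \<Rightarrow> real"
  assumes "real_polynomial_function P"
  shows "trig_poly (\<lambda>x. P (wrap L x))"
  using assms
proof (induction P rule: real_polynomial_function.induct)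
  case (linear f)
  interpret bounded_linear f by fact
  have eq: "(\<lambda>x::'b. f (wrap L x)) = (\<lambda>x. (\<Sum>b\<in>Basis. f (b, 0) * cos ((pi / L) *\<^sub>R b \<bullet> x + 0))
      + (\<Sum>b\<in>Basis. f (0, b) * cos ((pi / L) *\<^sub>R b \<bullet> x + - (pi / 2))))"
  proof
    fix x :: 'b
    have "wrap L x = (\<Sum>b\<in>Basis. cos (pi * (x \<bullet> b) / L) *\<^sub>R (b, 0))
        + (\<Sum>b\<in>Basis. sin (pi * (x \<bullet> b) / L) *\<^sub>R (0, b))"
      by (simp add: wrap_def prod_eq_iff fst_sum snd_sum)
    then have "f (wrap L x) = (\<Sum>b\<in>Basis. cos (pi * (x \<bullet> b) / L) * f (b, 0))
        + (\<Sum>b\<in>Basis. sin (pi * (x \<bullet> b) / L) * f (0, b))"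
      by (simp add: add sum scaleR del: scaleR_Pair)
    then show "f (wrap L x) = (\<Sum>b\<in>Basis. f (b, 0) * cos ((pi / L) *\<^sub>R b \<bullet> x + 0))
      + (\<Sum>b\<in>Basis. f (0, b) * cos ((pi / L) *\<^sub>R b \<bullet> x + - (pi / 2)))"
      by (simp add: cos_diff inner_commute mult.commute)
  qed
  show ?case unfolding eq by (intro trig_poly.intros trig_poly_sum)
next
  case (const c)
  show ?case by (rule trig_poly_const)
next
  case (add f g)
  then show ?case by (auto intro: trig_poly.add)
next
  case (mult f g)
  then show ?case by (auto intro: trig_poly_mult)
qed

lemma wrap_onto_cube:
  fixes x :: "'b::euclidean_space"
  assumes "L > 0"
  obtains y where "y \<in> cbox (- (L *\<^sub>R One)) (L *\<^sub>R One)" and "wrap L y = wrap L x"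
proof -
  define k where "k b = round ((x \<bullet> b) / (2 * L))" for b
  define y where "y = (\<Sum>b\<in>Basis. (x \<bullet> b - 2 * L * of_int (k b)) *\<^sub>R b)"
  have y: "y \<bullet> b = x \<bullet> b - 2 * L * of_int (k b)" if "b \<in> Basis" for b
    using that by (simp add: y_def)
  have "y \<in> cbox (- (L *\<^sub>R One)) (L *\<^sub>R One)"
    unfolding mem_box
  proof
    fix b :: 'b assume b: "b \<in> Basis"
    have "\<bar>of_int (k b) - (x \<bullet> b) / (2 * L)\<bar> \<le> 1 / 2"
      unfolding k_def by (rule of_int_round_abs_le)
    then have "\<bar>2 * L * (of_int (k b) - (x \<bullet> b) / (2 * L))\<bar> \<le> 2 * L * (1 / 2)"
      using assms by (subst abs_mult) (intro mult_mono, auto)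
    then have "\<bar>y \<bullet> b\<bar> \<le> L"
      using assms y[OF b] by (simp add: algebra_simps)
    then show "- (L *\<^sub>R One) \<bullet> b \<le> y \<bullet> b \<and> y \<bullet> b \<le> L *\<^sub>R One \<bullet> b"
      using b by (auto simp: abs_le_iff)
  qed
  moreover have "wrap L y = wrap L x"
  proof (rule wrap_eqI)
    fix b :: 'b assume b: "b \<in> Basis"
    have e: "pi * (y \<bullet> b) / L = pi * (x \<bullet> b) / L - 2 * pi * of_int (k b)"
      using assms unfolding y[OF b] by (simp add: right_diff_distrib diff_divide_distrib)
    show "cos (pi * (y \<bullet> b) / L) = cos (pi * (x \<bullet> b) / L)"
      and "sin (pi * (y \<bullet> b) / L) = sin (pi * (x \<bullet> b) / L)"
      unfolding e by (simp_all add: cos_diff sin_diff)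
  qed
  ultimately show ?thesis using that by blast
qed

text \<open>The cube is a fundamental domain: only points on its boundary are identified, and those lie
outside the open ball of radius \<open>L\<close>.\<close>

lemma wrap_cube_inj:
  fixes x y :: "'b::euclidean_space"
  assumes "L > 0" and "x \<in> cbox (- (L *\<^sub>R One)) (L *\<^sub>R One)"
    and "y \<in> cbox (- (L *\<^sub>R One)) (L *\<^sub>R One)" and eq: "wrap L x = wrap L y"
  shows "x = y \<or> (norm x \<ge> L \<and> norm y \<ge> L)"
proof (cases "x = y")
  case False
  then obtain b where b: "b \<in> Basis" and ne: "x \<bullet> b \<noteq> y \<bullet> b"
    using euclidean_eqI by blast
  have bd: "\<bar>x \<bullet> b\<bar> \<le> L" "\<bar>y \<bullet> b\<bar> \<le> L"
    using assms(2,3) b by (auto simp: mem_box inner_minus_left abs_le_iff dest!: bspec[OF _ b])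
  obtain n where n: "pi * (x \<bullet> b) / L = pi * (y \<bullet> b) / L + 2 * pi * of_int n"
    using wrap_eqD[OF eq b] sin_cos_eq_iff by metis
  then have n': "x \<bullet> b = y \<bullet> b + 2 * L * of_int n"
  proof -
    have "pi * (x \<bullet> b) = pi * (y \<bullet> b + 2 * L * of_int n)"
      using n assms(1) by (simp add: field_simps)
    then show ?thesis by simp
  qed
  have "n \<noteq> 0" using ne n' by auto
  then have "\<bar>of_int n :: real\<bar> \<ge> 1" by linarith
  then have "\<bar>2 * L * of_int n\<bar> \<ge> 2 * L"
    using assms(1) by (simp add: abs_mult)
  then have "\<bar>x \<bullet> b\<bar> \<ge> L" "\<bar>y \<bullet> b\<bar> \<ge> L"
    using bd n' by linarith+
  then show ?thesis
    using Basis_le_norm[OF b, of x] Basis_le_norm[OF b, of y] by linarith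
qed simp

text \<open>The function \<open>f\<close> is first cut off to a function \<open>g\<close> supported in a ball inside the cube. Since \<open>g\<close>
vanishes on the boundary of the cube, it descends to a continuous function on the torus, where the
Stone--Weierstrass theorem yields a polynomial. Pulled back to the space, the polynomial is close
to \<open>f\<close> on the ball of radius \<open>K\<close>. Outside it is bounded by periodicity, and a bounded error is at most
a small multiple of the norm once \<open>K\<close> is large.\<close>

lemma trig_poly_approximation:
  fixes f :: "'b::euclidean_space \<Rightarrow> real"
  assumes cont: "continuous_on UNIV f" and bound: "\<And>x. \<bar>f x\<bar> \<le> B" and \<delta>: "\<delta> > 0"
  obtains Q where "trig_poly Q" and "\<And>x. \<bar>f x - Q x\<bar> \<le> \<delta> * (1 + norm x)"
proof -
  have B0: "0 \<le> B" using bound[of 0] by linarith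
  \<comment> \<open>chosen so that the bounded error \<open>2 B + \<delta>\<close> outside the ball is at most \<open>\<delta>\<close> times the norm\<close>
  define K where "K = (2 * B + \<delta>) / \<delta>"
  have K: "K > 0" "\<delta> * K = 2 * B + \<delta>" using B0 \<delta> by (simp_all add: K_def add_nonneg_pos)
  define L where "L = 2 * K"
  have L: "L > 0" using K by (simp add: L_def)
  define g where "g x = f x * max 0 (min 1 (2 - norm x / K))" for x
  have g_cont: "continuous_on S g" for S
    unfolding g_def using K by (intro continuous_intros continuous_on_subset[OF cont]) auto
  have g_in: "g x = f x" if "norm x \<le> K" for x
  proof -
    have "norm x / K \<le> 1" using that K by simp
    then show ?thesis by (simp add: g_def)
  qed
  have g_out: "g x = 0" if "norm x \<ge> L" for x
  proof -
    have "norm x / K \<ge> 2" using that K by (simp add: L_def field_simps)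
    then show ?thesis by (simp add: g_def)
  qed
  have g_bound: "\<bar>g x\<bar> \<le> B" for x
  proof -
    have "\<bar>g x\<bar> \<le> B * 1"
      unfolding g_def abs_mult using bound B0 by (intro mult_mono) auto
    then show ?thesis by simp
  qed
  define C :: "'b set" where "C = cbox (- (L *\<^sub>R One)) (L *\<^sub>R One)"
  have C_comp: "compact C" by (simp add: C_def)
  define F where "F z = g (inv_into C (wrap L) z)" for z
  have F: "F (wrap L x) = g x" if "x \<in> C" for x
  proof -
    define y where "y = inv_into C (wrap L) (wrap L x)"
    have "y \<in> C" "wrap L y = wrap L x"
      unfolding y_def using that by (auto intro: inv_into_into f_inv_into_f)
    then have "y = x \<or> norm y \<ge> L \<and> norm x \<ge> L"
      using wrap_cube_inj[OF L] that unfolding C_def by blast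
    then show ?thesis using g_out by (auto simp: F_def y_def[symmetric])
  qed
  have T_comp: "compact (wrap L ` C)"
    by (intro compact_continuous_image continuous_on_wrap C_comp)
  \<comment> \<open>wrapping the cube is a closed map, so a continuous function on the cube that is constant on its
    fibres descends to a continuous function on the torus\<close>
  have F_cont: "continuous_on (wrap L ` C) F"
    unfolding continuous_on_closed_vimage[OF compact_imp_closed[OF T_comp]]
  proof (intro allI impI)
    fix D :: "real set" assume D: "closed D"
    have "F -` D \<inter> wrap L ` C = wrap L ` (g -` D \<inter> C)" using F by auto
    moreover have "closed (g -` D \<inter> C)"
      using g_cont D C_comp compact_imp_closed continuous_on_closed_vimage by metis
    then have "compact (g -` D \<inter> C)"
      using compact_Int_closed[OF C_comp] by (metis inf.absorb2 inf_le2)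
    ultimately show "closed (F -` D \<inter> wrap L ` C)"
      by (metis compact_continuous_image compact_imp_closed continuous_on_wrap)
  qed
  obtain P where P: "real_polynomial_function P"
      and PF: "\<And>z. z \<in> wrap L ` C \<Longrightarrow> \<bar>F z - P z\<bar> < \<delta>"
    using Stone_Weierstrass_real_polynomial_function[OF T_comp F_cont \<delta>] by metis
  show ?thesis
  proof (rule that)
    show "trig_poly (\<lambda>x. P (wrap L x))" by (rule trig_poly_wrap[OF P])
    fix x
    obtain y where y: "y \<in> C" and yx: "wrap L y = wrap L x"
      using wrap_onto_cube[OF L] unfolding C_def by metis
    have gP: "\<bar>g y - P (wrap L x)\<bar> < \<delta>"
      using PF[of "wrap L x"] F[OF y] y yx by (metis imageI)
    show "\<bar>f x - P (wrap L x)\<bar> \<le> \<delta> * (1 + norm x)"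
    proof (cases "norm x \<le> K")
      case True
      have "\<bar>x \<bullet> b\<bar> \<le> L" if "b \<in> Basis" for b
        using Basis_le_norm[OF that, of x] True K by (simp add: L_def)
      then have "x \<in> C" by (auto simp: C_def mem_box inner_minus_left abs_le_iff minus_le_iff)
      then have "\<bar>f x - P (wrap L x)\<bar> < \<delta>"
        using PF[of "wrap L x"] F[of x] g_in[OF True] by force
      also have "\<delta> \<le> \<delta> * (1 + norm x)" using \<delta> by simp
      finally show ?thesis by simp
    next
      case False
      have "\<bar>f x - P (wrap L x)\<bar> \<le> 2 * B + \<delta>"
        using gP g_bound[of y] bound[of x] by linarith
      also have "\<dots> \<le> \<delta> * norm x"
        unfolding K(2)[symmetric] using False \<delta> by (intro mult_left_mono) auto
      finally show ?thesis using \<delta> by (simp add: distrib_left)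
    qed
  qed
qed

lemma trig_poly_regular:
  assumes "trig_poly Q"
  shows "Q \<in> borel_measurable borel" and "\<exists>B. \<forall>x. \<bar>Q x\<bar> \<le> B"
proof -
  show "Q \<in> borel_measurable borel"
    using assms by induction measurable
  show "\<exists>B. \<forall>x. \<bar>Q x\<bar> \<le> B"
    using assms
  proof induction
    case (wave c t s)
    have "\<bar>c * cos (t \<bullet> x + s)\<bar> \<le> \<bar>c\<bar>" for x
      using mult_left_mono[OF abs_cos_le_one, of "\<bar>c\<bar>"] by (simp add: abs_mult)
    then show ?case by blast
  next
    case (add f g)
    then obtain B C where "\<And>x. \<bar>f x\<bar> \<le> B" "\<And>x. \<bar>g x\<bar> \<le> C" by auto
    then have "\<bar>f x + g x\<bar> \<le> B + C" for x
      by (meson abs_triangle_ineq add_mono order_trans)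
    then show ?case by blast
  qed
qed

lemma (in prob_space) integrable_bounded_comp:
  fixes Q :: "'b::euclidean_space \<Rightarrow> real"
  assumes "X \<in> borel_measurable M" and "Q \<in> borel_measurable borel" and "\<And>x. \<bar>Q x\<bar> \<le> B"
  shows "integrable M (\<lambda>x. Q (X x))"
  using assms by (intro integrable_const_bound[where B = B]) auto

lemma (in prob_space) integrable_iexp_inner:
  fixes X :: "'a \<Rightarrow> 'b::euclidean_space"
  assumes [measurable]: "X \<in> borel_measurable M"
  shows "integrable M (\<lambda>x. iexp (t \<bullet> X x))"
  by (intro integrable_const_bound[where B = 1]) auto

lemma (in prob_space) expectation_cos_inner:
  fixes X :: "'a \<Rightarrow> 'b::euclidean_space"
  assumes "X \<in> borel_measurable M"
  shows "(\<integral>x. cos (t \<bullet> X x + s) \<partial>M) = Re (iexp s * (\<integral>x. iexp (t \<bullet> X x) \<partial>M))"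
proof -
  have "(\<integral>x. cos (t \<bullet> X x + s) \<partial>M) = (\<integral>x. Re (iexp s * iexp (t \<bullet> X x)) \<partial>M)"
    by (simp add: exp_add[symmetric] algebra_simps flip: of_real_add) (simp add: Re_exp)
  also have "\<dots> = Re (\<integral>x. iexp s * iexp (t \<bullet> X x) \<partial>M)"
    using integrable_iexp_inner[OF assms] by (intro integral_Re) auto
  finally show ?thesis by simp
qed

text \<open>A multidimensional version of the continuity theorem. The bound on the first moments replaces
tightness: integrating the estimate of \<open>trig_poly_approximation\<close> shows that expectations of \<open>f\<close> and of
the trigonometric polynomial differ by a small amount uniformly in \<open>n\<close>.\<close>

theorem conv_in_distribution_of_char:
  fixes X :: "nat \<Rightarrow> 'a \<Rightarrow> 'b::euclidean_space"
  assumes M: "prob_space M" and \<nu>: "prob_space \<nu>" "sets \<nu> = sets borel"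
    and X [measurable]: "\<And>n. X n \<in> borel_measurable M"
    and \<nu>_mean: "integrable \<nu> norm"
    and X_mean: "\<forall>\<^sub>F n in sequentially. integrable M (\<lambda>x. norm (X n x)) \<and> (\<integral>x. norm (X n x) \<partial>M) \<le> V"
    and char: "\<And>t. (\<lambda>n. \<integral>x. iexp (t \<bullet> X n x) \<partial>M) \<longlonglongrightarrow> (\<integral>y. iexp (t \<bullet> y) \<partial>\<nu>)"
  shows "conv_in_distribution M X \<nu>"
proof -
  interpret M: prob_space M by fact
  interpret N: prob_space \<nu> by fact
  have id: "(\<lambda>y. y) \<in> borel_measurable \<nu>"
    using \<nu>(2) by (simp add: measurable_def sets_eq_imp_space_eq[OF \<nu>(2)])
  have trig: "(\<lambda>n. \<integral>x. Q (X n x) \<partial>M) \<longlonglongrightarrow> (\<integral>y. Q y \<partial>\<nu>)" if "trig_poly Q" for Q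
    using that
  proof induction
    case (wave c t s)
    have "(\<lambda>n. c * Re (iexp s * (\<integral>x. iexp (t \<bullet> X n x) \<partial>M))) \<longlonglongrightarrow>
        c * Re (iexp s * (\<integral>y. iexp (t \<bullet> y) \<partial>\<nu>))"
      by (intro tendsto_intros char)
    then show ?case
      using N.expectation_cos_inner[OF id] by (simp add: M.expectation_cos_inner)
  next
    case (add f g)
    obtain B C where B: "\<And>x. \<bar>f x\<bar> \<le> B" and C: "\<And>x. \<bar>g x\<bar> \<le> C"
      using trig_poly_regular(2) add.hyps by metis
    note meas = trig_poly_regular(1)[OF add.hyps(1)] trig_poly_regular(1)[OF add.hyps(2)]
    show ?case
      using tendsto_add[OF add.IH]
      by (simp add: Bochner_Integration.integral_add M.integrable_bounded_comp[OF X meas(1) B]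
          M.integrable_bounded_comp[OF X meas(2) C] N.integrable_bounded_comp[OF id meas(1) B]
          N.integrable_bounded_comp[OF id meas(2) C])
  qed
  have "(\<lambda>n. \<integral>x. f (X n x) \<partial>M) \<longlonglongrightarrow> (\<integral>y. f y \<partial>\<nu>)"
    if cont: "continuous_on UNIV f" and bdd: "bounded (range f)" for f :: "'b \<Rightarrow> real"
  proof (rule LIMSEQ_I)
    fix e :: real assume e: "e > 0"
    obtain B where B: "\<And>x. \<bar>f x\<bar> \<le> B"
      using bdd by (auto simp: bounded_iff)
    have f_meas: "f \<in> borel_measurable borel"
      using cont by (rule borel_measurable_continuous_onI)
    define W where "W = 1 + \<bar>V\<bar> + \<bar>\<integral>y. norm y \<partial>\<nu>\<bar>"
    define \<delta> where "\<delta> = e / (4 * W)"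
    have \<nu>0: "0 \<le> (\<integral>y. norm y \<partial>\<nu>)" by simp
    have W: "W > 0" unfolding W_def by linarith
    have \<delta>: "\<delta> > 0" using e W by (simp add: \<delta>_def)
    obtain Q where Q: "trig_poly Q" and fQ: "\<And>x. \<bar>f x - Q x\<bar> \<le> \<delta> * (1 + norm x)"
      using trig_poly_approximation[OF cont B \<delta>] by metis
    obtain C where C: "\<And>x. \<bar>Q x\<bar> \<le> C" using trig_poly_regular(2)[OF Q] by metis
    note Q_meas = trig_poly_regular(1)[OF Q]
    have close: "\<bar>(\<integral>x. f (Z x) \<partial>L) - (\<integral>x. Q (Z x) \<partial>L)\<bar> \<le> e / 4"
      if L: "prob_space L" and Z: "Z \<in> borel_measurable L" "integrable L (\<lambda>x. norm (Z x))"
        and le: "1 + (\<integral>x. norm (Z x) \<partial>L) \<le> W" for L :: "'z measure" and Z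
    proof -
      interpret L: prob_space L by fact
      have i: "integrable L (\<lambda>x. f (Z x))" "integrable L (\<lambda>x. Q (Z x))"
        using L.integrable_bounded_comp[OF Z(1) f_meas B] L.integrable_bounded_comp[OF Z(1) Q_meas C]
        by auto
      have "\<bar>(\<integral>x. f (Z x) \<partial>L) - (\<integral>x. Q (Z x) \<partial>L)\<bar> = \<bar>\<integral>x. f (Z x) - Q (Z x) \<partial>L\<bar>"
        using i by simp
      also have "\<dots> \<le> (\<integral>x. \<delta> * (1 + norm (Z x)) \<partial>L)"
        using i Z(2) fQ by (intro order_trans[OF integral_abs_bound] integral_mono) auto
      also have "\<dots> = \<delta> * (1 + (\<integral>x. norm (Z x) \<partial>L))"
        using Z(2) by (simp add: L.prob_space)
      also have "\<dots> \<le> \<delta> * W" using le \<delta> by (intro mult_left_mono) auto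
      finally show ?thesis using W by (simp add: \<delta>_def)
    qed
    have 1: "\<bar>(\<integral>y. f y \<partial>\<nu>) - (\<integral>y. Q y \<partial>\<nu>)\<bar> \<le> e / 4"
      using close[OF \<nu>(1) id] \<nu>_mean by (simp add: W_def)
    have "\<forall>\<^sub>F n in sequentially. \<bar>(\<integral>x. Q (X n x) \<partial>M) - (\<integral>y. Q y \<partial>\<nu>)\<bar> < e / 4"
      using tendstoD[OF trig[OF Q], of "e / 4"] e by (simp add: dist_real_def)
    with X_mean have "\<forall>\<^sub>F n in sequentially. norm ((\<integral>x. f (X n x) \<partial>M) - (\<integral>y. f y \<partial>\<nu>)) < e"
    proof eventually_elim
      case (elim n)
      have "1 + (\<integral>x. norm (X n x) \<partial>M) \<le> W"
        using elim \<nu>0 unfolding W_def by linarith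
      then have "\<bar>(\<integral>x. f (X n x) \<partial>M) - (\<integral>x. Q (X n x) \<partial>M)\<bar> \<le> e / 4"
        using elim by (intro close M X) auto
      then show ?case using 1 elim e unfolding real_norm_def by linarith
    qed
    then show "\<exists>n0. \<forall>n\<ge>n0. norm ((\<integral>x. f (X n x) \<partial>M) - (\<integral>y. f y \<partial>\<nu>)) < e"
      by (simp add: eventually_sequentially)
  qed
  then show ?thesis
    unfolding conv_in_distribution_def
    using X by (simp add: integral_distr borel_measurable_continuous_onI)
qed

lemma norm_iexp_diff_le: "norm (iexp a - iexp b) \<le> \<bar>a - b\<bar>"
proof -
  have "iexp a - iexp b = iexp b * (iexp (a - b) - 1)"
    by (simp add: right_diff_distrib exp_add[symmetric] algebra_simps)
  then show ?thesis using iexp_approx1[of "a - b" 0] by (simp add: norm_mult)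
qed

text \<open>A perturbation \<open>W\<close> that tends to \<open>0\<close> in mean changes neither the limit of the characteristic functions
nor the bound on the first moments.\<close>

lemma conv_in_distribution_of_char_perturbed:
  fixes U W :: "nat \<Rightarrow> 'a \<Rightarrow> 'b::euclidean_space"
  assumes M: "prob_space M" and \<nu>: "prob_space \<nu>" "sets \<nu> = sets borel" "integrable \<nu> norm"
    and [measurable]: "\<And>n. U n \<in> borel_measurable M" "\<And>n. W n \<in> borel_measurable M"
    and U_int: "\<And>n. integrable M (\<lambda>x. norm (U n x))" and W_int: "\<And>n. integrable M (\<lambda>x. norm (W n x))"
    and U_mean: "\<forall>\<^sub>F n in sequentially. (\<integral>x. norm (U n x) \<partial>M) \<le> V"
    and W_mean: "(\<lambda>n. \<integral>x. norm (W n x) \<partial>M) \<longlonglongrightarrow> 0"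
    and char: "\<And>t. (\<lambda>n. \<integral>x. iexp (t \<bullet> U n x) \<partial>M) \<longlonglongrightarrow> (\<integral>y. iexp (t \<bullet> y) \<partial>\<nu>)"
  shows "conv_in_distribution M (\<lambda>n x. U n x + W n x) \<nu>"
proof (rule conv_in_distribution_of_char[OF M \<nu>(1,2) _ \<nu>(3)])
  interpret prob_space M by fact
  show "(\<lambda>x. U n x + W n x) \<in> borel_measurable M" for n by measurable
  have int: "integrable M (\<lambda>x. norm (U n x + W n x))" for n
    by (rule Bochner_Integration.integrable_bound[OF Bochner_Integration.integrable_add[OF U_int[of n] W_int[of n]]])
      (auto intro: norm_triangle_ineq)
  have "\<forall>\<^sub>F n in sequentially. (\<integral>x. norm (W n x) \<partial>M) < 1"
    using order_tendstoD(2)[OF W_mean] by simp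
  with U_mean show "\<forall>\<^sub>F n in sequentially. integrable M (\<lambda>x. norm (U n x + W n x)) \<and>
      (\<integral>x. norm (U n x + W n x) \<partial>M) \<le> V + 1"
  proof eventually_elim
    case (elim n)
    have "(\<integral>x. norm (U n x + W n x) \<partial>M) \<le> (\<integral>x. norm (U n x) + norm (W n x) \<partial>M)"
      using U_int W_int by (intro integral_mono int norm_triangle_ineq) auto
    then show ?case using elim int U_int W_int by simp
  qed
  fix t :: 'b
  have "(\<lambda>n. (\<integral>x. iexp (t \<bullet> (U n x + W n x)) \<partial>M) - (\<integral>x. iexp (t \<bullet> U n x) \<partial>M)) \<longlonglongrightarrow> 0"
  proof (rule Lim_null_comparison)
    show "\<forall>\<^sub>F n in sequentially. norm ((\<integral>x. iexp (t \<bullet> (U n x + W n x)) \<partial>M) - (\<integral>x. iexp (t \<bullet> U n x) \<partial>M))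
        \<le> norm t * (\<integral>x. norm (W n x) \<partial>M)"
    proof (intro always_eventually allI)
      fix n
      have i: "integrable M (\<lambda>x. iexp (t \<bullet> (U n x + W n x)))" "integrable M (\<lambda>x. iexp (t \<bullet> U n x))"
        by (intro integrable_iexp_inner; measurable)+
      have "norm ((\<integral>x. iexp (t \<bullet> (U n x + W n x)) \<partial>M) - (\<integral>x. iexp (t \<bullet> U n x) \<partial>M))
          = norm (\<integral>x. iexp (t \<bullet> (U n x + W n x)) - iexp (t \<bullet> U n x) \<partial>M)"
        by (subst Bochner_Integration.integral_diff[OF i]) simp
      also have "\<dots> \<le> (\<integral>x. norm (iexp (t \<bullet> (U n x + W n x)) - iexp (t \<bullet> U n x)) \<partial>M)"
        by (rule integral_norm_bound)
      also have "\<dots> \<le> (\<integral>x. norm t * norm (W n x) \<partial>M)"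
      proof (rule integral_mono)
        show "integrable M (\<lambda>x. norm (iexp (t \<bullet> (U n x + W n x)) - iexp (t \<bullet> U n x)))"
          by (rule integrable_norm[OF Bochner_Integration.integrable_diff[OF i]])
        show "integrable M (\<lambda>x. norm t * norm (W n x))" using W_int by simp
        fix x
        have "norm (iexp (t \<bullet> (U n x + W n x)) - iexp (t \<bullet> U n x)) \<le> \<bar>t \<bullet> (U n x + W n x) - t \<bullet> U n x\<bar>"
          by (rule norm_iexp_diff_le)
        also have "\<dots> = \<bar>t \<bullet> W n x\<bar>" by (simp add: inner_add_right)
        also have "\<dots> \<le> norm t * norm (W n x)" by (rule Cauchy_Schwarz_ineq2)
        finally show "norm (iexp (t \<bullet> (U n x + W n x)) - iexp (t \<bullet> U n x)) \<le> norm t * norm (W n x)" .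
      qed
      finally show "norm ((\<integral>x. iexp (t \<bullet> (U n x + W n x)) \<partial>M) - (\<integral>x. iexp (t \<bullet> U n x) \<partial>M))
          \<le> norm t * (\<integral>x. norm (W n x) \<partial>M)" by simp
    qed
    show "(\<lambda>n. norm t * (\<integral>x. norm (W n x) \<partial>M)) \<longlonglongrightarrow> 0"
      using tendsto_mult_left[OF W_mean, of "norm t"] by simp
  qed
  from tendsto_add[OF this char[of t]]
  show "(\<lambda>n. \<integral>x. iexp (t \<bullet> (U n x + W n x)) \<partial>M) \<longlonglongrightarrow> (\<integral>y. iexp (t \<bullet> y) \<partial>\<nu>)" by simp
qed

section \<open>Normal laws with two-dimensional support\<close>

lemma real_distribution_normal_law:
  assumes "0 \<le> s"
  shows "real_distribution (normal_law 0 s)"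
proof (cases "s = 0")
  case True
  then show ?thesis
    by (auto simp: normal_law_def real_distribution_def real_distribution_axioms_def intro!: prob_space_return)
next
  case False
  then show ?thesis
    using assms prob_space_normal_density[of s 0]
    by (auto simp: normal_law_def real_distribution_def real_distribution_axioms_def)
qed

lemma char_normal_law:
  assumes "0 \<le> s"
  shows "char (normal_law 0 s) t = of_real (exp (- (s * t)\<^sup>2 / 2))"
proof (cases "s = 0")
  case True
  then show ?thesis by (simp add: normal_law_def char_def integral_return)
next
  case False
  then have s: "0 < s" using assms by simp
  interpret N: real_distribution std_normal_distribution by (rule real_dist_normal_dist)
  have "distributed std_normal_distribution lborel (\<lambda>x. x) std_normal_density"
    unfolding distributed_def by (auto simp: distr_id2[of lborel])
  from N.normal_density_affine[OF this, of s 0] s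
  have "distributed std_normal_distribution lborel (\<lambda>x. s * x) (normal_density 0 s)" by simp
  then have "distr std_normal_distribution lborel (\<lambda>x. s * x) = normal_law 0 s"
    using s by (simp add: distributed_def normal_law_def)
  then have eq: "normal_law 0 s = distr std_normal_distribution borel (\<lambda>x. s * x)"
    by (simp cong: distr_cong)
  have "char (normal_law 0 s) t = (\<integral>x. iexp (t * (s * x)) \<partial>std_normal_distribution)"
    unfolding eq char_def by (subst integral_distr) auto
  also have "\<dots> = char std_normal_distribution (s * t)"
    unfolding char_def by (simp add: mult_ac)
  finally show ?thesis by (simp add: char_std_normal_distribution)
qed

text \<open>The law of \<open>g a + h b\<close> for independent standard normal \<open>g\<close> and \<open>h\<close>, a centered normal law with
covariance matrix \<open>a a\<^sup>T + b b\<^sup>T\<close>.\<close>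

definition plane_normal :: "'b::euclidean_space \<Rightarrow> 'b \<Rightarrow> 'b measure" where
  "plane_normal a b = distr (std_normal_distribution \<Otimes>\<^sub>M std_normal_distribution) borel
     (\<lambda>(g, h). g *\<^sub>R a + h *\<^sub>R b)"

lemma plane_normal:
  fixes a b :: "'b::euclidean_space"
  shows prob_space_plane_normal: "prob_space (plane_normal a b)"
    and sets_plane_normal: "sets (plane_normal a b) = sets borel"
    and integrable_norm_plane_normal: "integrable (plane_normal a b) norm"
    and char_plane_normal: "(\<integral>y. iexp (t \<bullet> y) \<partial>plane_normal a b)
      = of_real (exp (- ((t \<bullet> a)\<^sup>2 + (t \<bullet> b)\<^sup>2) / 2))"
proof -
  define N where "N = std_normal_distribution"
  interpret N: real_distribution N unfolding N_def by (rule real_dist_normal_dist)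
  interpret P: pair_prob_space N N ..
  define F where "F = (\<lambda>(g, h). g *\<^sub>R a + h *\<^sub>R b)"
  have F [measurable]: "F \<in> borel_measurable (N \<Otimes>\<^sub>M N)" unfolding F_def by measurable
  have eq: "plane_normal a b = distr (N \<Otimes>\<^sub>M N) borel F" by (simp add: plane_normal_def N_def F_def)
  show "prob_space (plane_normal a b)" unfolding eq by (rule P.prob_space_distr) simp
  show "sets (plane_normal a b) = sets borel" by (simp add: eq)
  have abs_int: "integrable N (\<lambda>g. \<bar>g\<bar>)"
    using integrable_abs[OF integrable_std_normal_distribution_moment[of 1]] by (simp add: N_def)
  have "integrable (N \<Otimes>\<^sub>M N) (\<lambda>p. norm (F p))"
  proof (rule Bochner_Integration.integrable_bound)
    have "integrable (N \<Otimes>\<^sub>M N) (\<lambda>p. \<bar>fst p\<bar>)"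
      using abs_int N.distr_pair_fst[of N] integrable_distr[of fst "N \<Otimes>\<^sub>M N" N "\<lambda>g. \<bar>g\<bar>"] by simp
    moreover from P.integrable_product_swap[OF this] have "integrable (N \<Otimes>\<^sub>M N) (\<lambda>p. \<bar>snd p\<bar>)"
      by (simp add: case_prod_unfold)
    ultimately show "integrable (N \<Otimes>\<^sub>M N) (\<lambda>p. \<bar>fst p\<bar> * norm a + \<bar>snd p\<bar> * norm b)" by auto
    show "AE p in N \<Otimes>\<^sub>M N. norm (norm (F p)) \<le> norm (\<bar>fst p\<bar> * norm a + \<bar>snd p\<bar> * norm b)"
      by (auto simp: F_def case_prod_unfold intro!: order_trans[OF norm_triangle_ineq])
  qed measurable
  then show "integrable (plane_normal a b) norm"
    unfolding eq by (subst integrable_distr_eq) auto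
  have int: "integrable (N \<Otimes>\<^sub>M N) (\<lambda>p. iexp (t \<bullet> F p))"
    by (intro P.P.integrable_const_bound[where B = 1]) auto
  have "(\<integral>y. iexp (t \<bullet> y) \<partial>plane_normal a b) = (\<integral>p. iexp (t \<bullet> F p) \<partial>(N \<Otimes>\<^sub>M N))"
    unfolding eq by (subst integral_distr) auto
  also have "\<dots> = (\<integral>g. (\<integral>h. iexp (t \<bullet> F (g, h)) \<partial>N) \<partial>N)"
    by (rule P.integral_fst'[OF int, symmetric])
  also have "\<dots> = (\<integral>g. (\<integral>h. iexp ((t \<bullet> a) * g) * iexp ((t \<bullet> b) * h) \<partial>N) \<partial>N)"
    by (simp add: F_def inner_add_right exp_add[symmetric] algebra_simps)
  also have "\<dots> = char N (t \<bullet> a) * char N (t \<bullet> b)"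
    by (simp add: char_def)
  also have "\<dots> = of_real (exp (- ((t \<bullet> a)\<^sup>2 + (t \<bullet> b)\<^sup>2) / 2))"
    by (simp add: N_def char_std_normal_distribution exp_add[symmetric] add_divide_distrib flip: of_real_mult)
  finally show "(\<integral>y. iexp (t \<bullet> y) \<partial>plane_normal a b) = of_real (exp (- ((t \<bullet> a)\<^sup>2 + (t \<bullet> b)\<^sup>2) / 2))" .
qed

text \<open>A one-dimensional law is determined by its characteristic function, so each linear functional can be
identified with the normal law through \<open>char_plane_normal\<close>, uniformly in the nondegenerate case and in
the degenerate one, in which the functional vanishes on the plane.\<close>

lemma centered_normal_plane_normal:
  fixes S :: "real ^ 'm ^ 'm"
  assumes S: "transpose S = S" "\<And>t. t \<bullet> (S *v t) = (t \<bullet> a)\<^sup>2 + (t \<bullet> b)\<^sup>2"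
  shows "centered_normal S (plane_normal a b)"
  unfolding centered_normal_def
proof (intro conjI allI)
  interpret prob_space "plane_normal a b" by (rule prob_space_plane_normal)
  fix t :: "real ^ 'm"
  have meas [measurable]: "(\<lambda>x. t \<bullet> x) \<in> borel_measurable (plane_normal a b)"
    by (simp cong: measurable_cong_sets add: sets_plane_normal)
  define s where "s = sqrt (t \<bullet> (S *v t))"
  have s: "0 \<le> s" "s\<^sup>2 = (t \<bullet> a)\<^sup>2 + (t \<bullet> b)\<^sup>2" by (simp_all add: s_def S(2))
  show "distr (plane_normal a b) borel (\<lambda>x. t \<bullet> x) = normal_law 0 (sqrt (t \<bullet> (S *v t)))"
    unfolding s_def[symmetric]
  proof (rule Levy_uniqueness)
    show "real_distribution (distr (plane_normal a b) borel (\<lambda>x. t \<bullet> x))"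
      by (rule real_distribution_distr) measurable
    show "real_distribution (normal_law 0 s)" by (rule real_distribution_normal_law[OF s(1)])
    show "char (distr (plane_normal a b) borel (\<lambda>x. t \<bullet> x)) = char (normal_law 0 s)"
    proof
      fix u
      have "char (distr (plane_normal a b) borel (\<lambda>x. t \<bullet> x)) u = (\<integral>y. iexp ((u *\<^sub>R t) \<bullet> y) \<partial>plane_normal a b)"
        unfolding char_def by (subst integral_distr) auto
      also have "\<dots> = of_real (exp (- (s * u)\<^sup>2 / 2))"
        unfolding char_plane_normal power_mult_distrib s(2) by (simp add: power_mult_distrib algebra_simps)
      finally show "char (distr (plane_normal a b) borel (\<lambda>x. t \<bullet> x)) u = char (normal_law 0 s) u"
        by (simp add: char_normal_law[OF s(1)])
    qed
  qed
qed (simp_all add: S prob_space_plane_normal sets_plane_normal)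

text \<open>The range of \<open>S\<close> is the span of \<open>a\<close> and \<open>b\<close>: orthogonality makes \<open>a\<close> and \<open>b\<close> eigenvectors of \<open>S\<close> with
nonzero eigenvalues.\<close>

lemma rank_two_of_orthogonal:
  fixes S :: "real ^ 'm ^ 'm"
  assumes S: "\<And>x. S *v x = (a \<bullet> x) *\<^sub>R a + (b \<bullet> x) *\<^sub>R b" and orth: "a \<bullet> b = 0" and nz: "a \<noteq> 0" "b \<noteq> 0"
  shows "rank S = 2"
proof -
  have "a \<noteq> b" using orth nz by auto
  have "span (range ((*v) S)) = span {a, b}"
  proof (rule subset_antisym; rule span_minimal)
    show "range ((*v) S) \<subseteq> span {a, b}"
      unfolding image_subset_iff S by (auto intro: span_add span_scale span_base)
    have "S *v ((1 / (a \<bullet> a)) *\<^sub>R a) = a" "S *v ((1 / (b \<bullet> b)) *\<^sub>R b) = b"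
      using S orth nz by (simp_all add: inner_commute)
    then show "{a, b} \<subseteq> span (range ((*v) S))"
      by (metis insert_subset empty_subsetI rangeI span_base)
  qed (rule subspace_span)+
  then have "dim (range ((*v) S)) = dim {a, b}" by (metis dim_span)
  also have "\<dots> = card {a, b}"
  proof (rule dim_eq_card_independent)
    show "independent {a, b}"
      using orth nz by (intro pairwise_orthogonal_independent) (auto simp: pairwise_def orthogonal_def inner_commute)
  qed
  finally show ?thesis using \<open>a \<noteq> b\<close> by (simp add: rank_dim_range)
qed

section \<open>Roots of unity and the eigenvectors\<close>

context
  fixes m :: nat
  assumes m: "0 < m"
begin

lemma omega_power: "omega m ^ k = exp (2 * of_real pi * \<i> * of_nat k / of_nat m)"
  unfolding omega_def exp_of_nat_mult[symmetric] by (simp add: mult_ac)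

lemma omega_power_m: "omega m ^ m = 1"
  using m unfolding omega_power by (simp add: exp_two_pi_i mult_ac)

lemma omega_power_eq_iff: "omega m ^ j = omega m ^ k \<longleftrightarrow> j mod m = k mod m"
  using complex_root_unity_eq[of m j k] m by (simp add: omega_power)

lemma norm_omega_power: "norm (omega m ^ k) = 1"
proof -
  have "omega m = iexp (2 * pi / real m)" by (simp add: omega_def mult_ac)
  then show ?thesis by (simp add: norm_power)
qed

lemma omega_nonzero: "omega m \<noteq> 0"
  by (simp add: omega_def)

lemma Re_omega_power: "Re (omega m ^ k) = cos (2 * pi * real k / real m)"
proof -
  have "omega m ^ k = iexp (2 * pi * real k / real m)" by (simp add: omega_power mult_ac)
  then show ?thesis by (simp add: Re_exp)
qed

lemma cnj_omega_power: "cnj (omega m ^ k) = inverse (omega m ^ k)"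
proof -
  have "omega m ^ k * cnj (omega m ^ k) = 1"
    using norm_omega_power[of k] by (simp add: complex_norm_square[symmetric] del: complex_cnj_power)
  then show ?thesis by (metis inverse_unique)
qed

lemma omega_power_complement:
  assumes "k \<le> m"
  shows "omega m ^ (m - k) = cnj (omega m ^ k)"
proof -
  have "omega m ^ (m - k) * omega m ^ k = 1"
    using assms by (simp add: power_add[symmetric] omega_power_m)
  then show ?thesis unfolding cnj_omega_power by (metis inverse_unique mult.commute)
qed

lemma eigvec_nth: "eigvec m idx k $ i = cnj (omega m ^ k) ^ idx i / of_nat m"
proof -
  have "omega m powi (- int (idx i * k)) = inverse (omega m ^ (idx i * k))"
    unfolding power_int_minus power_int_of_nat ..
  also have "\<dots> = cnj (omega m ^ k) ^ idx i"
    by (simp only: cnj_omega_power power_inverse[symmetric] power_mult[symmetric] mult.commute[of k])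
  finally show ?thesis by (simp add: eigvec_def)
qed

lemma norm_eigvec_nth: "norm (eigvec m idx k $ i) = 1 / real m"
  by (simp add: eigvec_nth norm_divide norm_power norm_omega_power[unfolded norm_power])

lemma eigvec_complement:
  assumes "k \<le> m"
  shows "eigvec m idx (m - k) $ i = cnj (eigvec m idx k $ i)"
  unfolding eigvec_nth omega_power_complement[OF assms] by simp

lemma sum_powers_root_of_unity:
  fixes z :: complex
  assumes "z ^ m = 1"
  shows "(\<Sum>k<m. z ^ k) = (if z = 1 then of_nat m else 0)"
proof (cases "z = 1")
  case False
  have "(z - 1) * (\<Sum>k<m. z ^ k) = 0" using assms power_diff_1_eq[of z m] by simp
  then show ?thesis using False by simp
qed simp

text \<open>Fourier inversion on the cyclic group: the modes of a single ball of type \<open>j\<close> recombine to the unit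
vector of the type \<open>j\<close>.\<close>

lemma sum_eigvec_indicator:
  assumes "j < m" and "idx i < m"
  shows "(\<Sum>k<m. (omega m ^ k) ^ j * eigvec m idx k $ i) = of_bool (j = idx i)"
proof -
  define z where "z = omega m ^ j * inverse (omega m ^ idx i)"
  have "(omega m ^ k) ^ j * eigvec m idx k $ i = z ^ k / of_nat m" for k
    unfolding eigvec_nth cnj_omega_power z_def
    by (simp add: power_mult_distrib power_inverse power_mult[symmetric] mult.commute)
  then have "(\<Sum>k<m. (omega m ^ k) ^ j * eigvec m idx k $ i) = (\<Sum>k<m. z ^ k) / of_nat m"
    by (simp add: sum_divide_distrib)
  moreover have "z ^ m = 1"
    unfolding z_def power_mult_distrib power_inverse power_mult[symmetric] mult.commute[of _ m]
    by (simp add: power_mult omega_power_m)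
  moreover have "z = 1 \<longleftrightarrow> j = idx i"
  proof -
    have "z = 1 \<longleftrightarrow> omega m ^ j = omega m ^ idx i"
      using omega_nonzero by (simp add: z_def field_simps)
    then show ?thesis using assms by (simp add: omega_power_eq_iff)
  qed
  ultimately show ?thesis using m by (simp add: sum_powers_root_of_unity)
qed

lemma sum_over_index:
  fixes f :: "nat \<Rightarrow> complex" and idx :: "'m::finite \<Rightarrow> nat"
  assumes "bij_betw idx UNIV {..<m}"
  shows "(\<Sum>i\<in>UNIV. f (idx i)) = (\<Sum>j<m. f j)"
  by (rule sum.reindex_bij_betw[OF assms])

text \<open>The square of the bilinear (not the Hermitian) norm. Its vanishing says that the real and
imaginary parts of the eigenvector are orthogonal and of equal length.\<close>

lemma sum_eigvec_square:
  fixes idx :: "'m::finite \<Rightarrow> nat"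
  assumes "bij_betw idx UNIV {..<m}" and "0 < k" and "2 * k < m"
  shows "(\<Sum>i\<in>UNIV. (eigvec m idx k $ i)\<^sup>2) = 0"
proof -
  define z where "z = (cnj (omega m ^ k))\<^sup>2"
  have "(eigvec m idx k $ i)\<^sup>2 = z ^ idx i / (of_nat m)\<^sup>2" for i
    unfolding eigvec_nth z_def by (simp add: power_divide power_mult[symmetric] mult_ac)
  then have "(\<Sum>i\<in>UNIV. (eigvec m idx k $ i)\<^sup>2) = (\<Sum>j<m. z ^ j) / (of_nat m)\<^sup>2"
    by (simp add: sum_divide_distrib[symmetric] sum_over_index[OF assms(1)])
  moreover have "z ^ m = 1"
  proof -
    have "z = cnj (omega m ^ (2 * k))" by (simp add: z_def power_mult[symmetric] mult.commute)
    then have "z ^ m = cnj ((omega m ^ m) ^ (2 * k))"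
      by (simp add: power_mult[symmetric] mult.commute)
    then show ?thesis by (simp add: omega_power_m)
  qed
  moreover have "z \<noteq> 1"
  proof
    assume "z = 1"
    then have "cnj z = 1" by simp
    then have "omega m ^ (2 * k) = omega m ^ 0"
      by (simp add: z_def power_mult[symmetric] mult.commute)
    then have "(2 * k) mod m = 0 mod m" by (simp only: omega_power_eq_iff)
    then show False using assms by simp
  qed
  ultimately show ?thesis by (simp add: sum_powers_root_of_unity)
qed

end

text \<open>Conjugate eigenvalues occupy the indices \<open>k\<close> and \<open>2 p - k\<close>; only the indices \<open>0\<close> and \<open>p\<close> are their own
mirror images.\<close>

lemma sum_symmetric_about_middle:
  fixes g :: "nat \<Rightarrow> real"
  assumes p: "0 < p" and sym: "\<And>k. 0 < k \<Longrightarrow> k < p \<Longrightarrow> g (2 * p - k) = g k"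
  shows "(\<Sum>k<2 * p. g k) = g 0 + 2 * (\<Sum>k\<in>{1..<p}. g k) + g p"
proof -
  have split: "{..<2 * p} = insert 0 (insert p ({1..<p} \<union> {p<..<2 * p}))" using p by auto
  have "(\<Sum>k\<in>{p<..<2 * p}. g k) = (\<Sum>k\<in>{1..<p}. g (2 * p - k))"
    by (rule sum.reindex_bij_witness[where i = "\<lambda>k. 2 * p - k" and j = "\<lambda>k. 2 * p - k"]) auto
  also have "\<dots> = (\<Sum>k\<in>{1..<p}. g k)" by (intro sum.cong) (auto simp: sym)
  finally have "(\<Sum>k\<in>{p<..<2 * p}. g k) = (\<Sum>k\<in>{1..<p}. g k)" .
  moreover have "(\<Sum>k<2 * p. g k) = g 0 + (g p + ((\<Sum>k\<in>{1..<p}. g k) + (\<Sum>k\<in>{p<..<2 * p}. g k)))"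
    unfolding split using p by (simp add: sum.union_disjoint Int_def)
  ultimately show ?thesis by simp
qed

section \<open>Averages over unit complex numbers\<close>

text \<open>The mixed terms average to zero because \<open>\<zeta> - \<mu>\<close> has mean zero, and the variance of unit complex
numbers with mean \<open>\<mu>\<close> is \<open>1 - |\<mu>|^2\<close>.\<close>

lemma average_norm_square:
  fixes \<zeta> :: "'i \<Rightarrow> complex"
  assumes A: "finite A" "A \<noteq> {}" and unit: "\<And>b. b \<in> A \<Longrightarrow> norm (\<zeta> b) = 1"
    and \<mu>: "\<mu> = (\<Sum>b\<in>A. \<zeta> b) / of_nat (card A)"
  shows "(\<Sum>b\<in>A. (norm (y + c * (\<zeta> b - \<mu>)))\<^sup>2) / real (card A)
    = (norm y)\<^sup>2 + (norm c)\<^sup>2 * (1 - (norm \<mu>)\<^sup>2)"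
proof -
  define N :: complex where "N = of_nat (card A)"
  have N: "N \<noteq> 0" using A by (simp add: N_def)
  define S where "S = (\<Sum>b\<in>A. \<zeta> b)"
  have S: "S = N * \<mu>" using \<mu> N by (simp add: S_def N_def)
  define w where "w = y - c * \<mu>"
  have 1: "complex_of_real ((norm (y + c * (\<zeta> b - \<mu>)))\<^sup>2)
      = w * cnj w + c * cnj c + w * cnj c * cnj (\<zeta> b) + c * cnj w * \<zeta> b" if "b \<in> A" for b
  proof -
    have "\<zeta> b * cnj (\<zeta> b) = 1" using unit[OF that] by (simp add: complex_norm_square[symmetric])
    then have "c * cnj c = (c * \<zeta> b) * cnj (c * \<zeta> b)" by (simp add: algebra_simps)
    moreover have "y + c * (\<zeta> b - \<mu>) = w + c * \<zeta> b" by (simp add: w_def algebra_simps)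
    ultimately show ?thesis unfolding complex_norm_square by (simp add: algebra_simps)
  qed
  have "complex_of_real (\<Sum>b\<in>A. (norm (y + c * (\<zeta> b - \<mu>)))\<^sup>2)
      = (\<Sum>b\<in>A. w * cnj w + c * cnj c + w * cnj c * cnj (\<zeta> b) + c * cnj w * \<zeta> b)"
    unfolding of_real_sum by (intro sum.cong refl 1)
  also have "\<dots> = N * (w * cnj w + c * cnj c) + w * cnj c * cnj S + c * cnj w * S"
    by (simp add: sum.distrib sum_distrib_left N_def S_def cnj_sum algebra_simps)
  also have "\<dots> = N * (y * cnj y + c * cnj c * (1 - \<mu> * cnj \<mu>))"
  proof -
    have "cnj S = N * cnj \<mu>" unfolding S by (simp add: N_def)
    moreover have "cnj N = N" by (simp add: N_def)
    ultimately show ?thesis unfolding S w_def by (simp add: algebra_simps)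
  qed
  also have "\<dots> = complex_of_real (real (card A) * ((norm y)\<^sup>2 + (norm c)\<^sup>2 * (1 - (norm \<mu>)\<^sup>2)))"
    by (simp only: N_def complex_norm_square of_real_mult of_real_add of_real_diff of_real_1 of_real_of_nat_eq)
  finally have "(\<Sum>b\<in>A. (norm (y + c * (\<zeta> b - \<mu>)))\<^sup>2)
      = real (card A) * ((norm y)\<^sup>2 + (norm c)\<^sup>2 * (1 - (norm \<mu>)\<^sup>2))"
    by (simp only: of_real_eq_iff)
  then show ?thesis using A by simp
qed

text \<open>Second-order Taylor expansion of the characteristic function of \<open>Re (c (\<zeta> - \<mu>))\<close>. If the unit numbers
\<open>\<zeta>\<close> were equidistributed, this real part would have mean zero and variance \<open>|c|^2 / 2\<close>. The deviation of
the variance from this value is controlled by the mean \<open>\<mu>\<close> and by the mean \<open>\<kappa>\<close> of the squares,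
since \<open>(Re z)^2 = (|z|^2 + Re (z^2)) / 2\<close>.\<close>

lemma average_iexp:
  fixes \<zeta> :: "'i \<Rightarrow> complex"
  assumes A: "finite A" "A \<noteq> {}" and unit: "\<And>b. b \<in> A \<Longrightarrow> norm (\<zeta> b) = 1"
    and \<mu>: "\<mu> = (\<Sum>b\<in>A. \<zeta> b) / of_nat (card A)"
    and \<kappa>: "\<kappa> = (\<Sum>b\<in>A. (\<zeta> b)\<^sup>2) / of_nat (card A)"
  shows "norm ((\<Sum>b\<in>A. iexp (Re (c * (\<zeta> b - \<mu>)))) / of_nat (card A) - of_real (1 - (norm c)\<^sup>2 / 4))
    \<le> (norm c)\<^sup>2 * (norm \<kappa> / 4 + (norm \<mu>)\<^sup>2 / 2) + 2 * norm c ^ 3"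
proof -
  define N :: real where "N = real (card A)"
  have N: "N > 0" using A by (simp add: N_def card_gt_0_iff)
  define X where "X b = Re (c * (\<zeta> b - \<mu>))" for b
  have sum_\<zeta>: "(\<Sum>b\<in>A. \<zeta> b) = of_real N * \<mu>" using \<mu> N by (simp add: N_def)
  have sum_\<zeta>2: "(\<Sum>b\<in>A. (\<zeta> b)\<^sup>2) = of_real N * \<kappa>" using \<kappa> N by (simp add: N_def)
  have \<mu>1: "norm \<mu> \<le> 1"
  proof -
    have "norm (\<Sum>b\<in>A. \<zeta> b) \<le> N" using unit by (intro order_trans[OF norm_sum]) (simp add: N_def)
    then show ?thesis unfolding sum_\<zeta> using N by (simp add: norm_mult)
  qed
  have X_le: "\<bar>X b\<bar> \<le> 2 * norm c" if "b \<in> A" for b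
  proof -
    have "\<bar>X b\<bar> \<le> norm c * norm (\<zeta> b - \<mu>)" unfolding X_def norm_mult[symmetric] by (rule abs_Re_le_cmod)
    also have "\<dots> \<le> norm c * 2"
      using norm_triangle_ineq4[of "\<zeta> b" \<mu>] unit[OF that] \<mu>1 by (intro mult_left_mono) auto
    finally show ?thesis by simp
  qed
  have sumX: "(\<Sum>b\<in>A. X b) = 0"
  proof -
    have "(\<Sum>b\<in>A. X b) = Re (c * ((\<Sum>b\<in>A. \<zeta> b) - of_real N * \<mu>))"
      unfolding X_def by (simp add: Re_sum[symmetric] sum_distrib_left[symmetric] sum_subtractf N_def del: Re_sum)
    then show ?thesis unfolding sum_\<zeta> by simp
  qed
  have Re_sq: "(Re z)\<^sup>2 = ((norm z)\<^sup>2 + Re (z\<^sup>2)) / 2" for z :: complex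
    unfolding cmod_power2 by (simp add: power2_eq_square)
  define V where "V = (norm c)\<^sup>2 / 2 + Re (c\<^sup>2 * \<kappa>) / 2 - (Re (c * \<mu>))\<^sup>2"
  have sumX2: "(\<Sum>b\<in>A. (X b)\<^sup>2) = N * V"
  proof -
    have "(X b)\<^sup>2 = (norm c)\<^sup>2 / 2 + Re (c\<^sup>2 * (\<zeta> b)\<^sup>2) / 2 - 2 * Re (c * \<mu>) * Re (c * \<zeta> b) + (Re (c * \<mu>))\<^sup>2"
      if "b \<in> A" for b
    proof -
      have "(X b)\<^sup>2 = (Re (c * \<zeta> b))\<^sup>2 - 2 * Re (c * \<mu>) * Re (c * \<zeta> b) + (Re (c * \<mu>))\<^sup>2"
        unfolding X_def by (simp add: power2_eq_square algebra_simps)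
      also have "(Re (c * \<zeta> b))\<^sup>2 = (norm c)\<^sup>2 / 2 + Re (c\<^sup>2 * (\<zeta> b)\<^sup>2) / 2"
        unfolding Re_sq[of "c * \<zeta> b"] using unit[OF that] by (simp add: norm_mult power_mult_distrib add_divide_distrib)
      finally show ?thesis .
    qed
    then have "(\<Sum>b\<in>A. (X b)\<^sup>2) = (\<Sum>b\<in>A. (norm c)\<^sup>2 / 2 + Re (c\<^sup>2 * (\<zeta> b)\<^sup>2) / 2
        - 2 * Re (c * \<mu>) * Re (c * \<zeta> b) + (Re (c * \<mu>))\<^sup>2)"
      by (intro sum.cong refl)
    also have "\<dots> = N * ((norm c)\<^sup>2 / 2) + Re (c\<^sup>2 * (\<Sum>b\<in>A. (\<zeta> b)\<^sup>2)) / 2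
        - 2 * Re (c * \<mu>) * Re (c * (\<Sum>b\<in>A. \<zeta> b)) + N * (Re (c * \<mu>))\<^sup>2"
      by (simp only: sum.distrib sum_subtractf sum_distrib_left Re_sum sum_divide_distrib)
        (simp add: N_def del: times_complex.sel)
    also have "\<dots> = N * V"
    proof -
      have "Re (c\<^sup>2 * (of_real N * \<kappa>)) = N * Re (c\<^sup>2 * \<kappa>)" "Re (c * (of_real N * \<mu>)) = N * Re (c * \<mu>)"
        by (simp_all add: algebra_simps)
      then show ?thesis unfolding sum_\<zeta> sum_\<zeta>2 V_def by (simp add: algebra_simps power2_eq_square)
    qed
    finally show ?thesis .
  qed
  define E where "E b = iexp (X b) - (1 + \<i> * X b - (X b)\<^sup>2 / 2)" for b
  have E_le: "norm (E b) \<le> 2 * norm c ^ 3" if "b \<in> A" for b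
  proof -
    have "norm (E b) \<le> \<bar>X b\<bar> ^ 3 / 6"
      using iexp_approx1[of "X b" 2] by (simp add: E_def numeral_eq_Suc fact_numeral algebra_simps power_mult_distrib)
    also have "\<dots> \<le> (2 * norm c) ^ 3 / 6"
      using X_le[OF that] by (intro divide_right_mono power_mono) auto
    also have "\<dots> \<le> 2 * norm c ^ 3" by (simp add: power_mult_distrib)
    finally show ?thesis .
  qed
  have "(\<Sum>b\<in>A. iexp (X b)) = (\<Sum>b\<in>A. 1 + \<i> * X b - (X b)\<^sup>2 / 2) + (\<Sum>b\<in>A. E b)"
    by (simp add: E_def sum.distrib[symmetric])
  also have "(\<Sum>b\<in>A. 1 + \<i> * X b - (X b)\<^sup>2 / 2) = of_real N + \<i> * of_real (\<Sum>b\<in>A. X b) - of_real (\<Sum>b\<in>A. (X b)\<^sup>2) / 2"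
    by (simp add: sum.distrib sum_subtractf sum_distrib_left sum_divide_distrib N_def)
  also have "\<dots> = of_real (N * (1 - V / 2))" unfolding sumX sumX2 by (simp add: algebra_simps)
  finally have sum_iexp: "(\<Sum>b\<in>A. iexp (X b)) = of_real N * of_real (1 - V / 2) + (\<Sum>b\<in>A. E b)"
    by simp
  have "(\<Sum>b\<in>A. iexp (X b)) / of_nat (card A) - of_real (1 - (norm c)\<^sup>2 / 4)
      = (\<Sum>b\<in>A. iexp (X b)) / of_real N - of_real (1 - (norm c)\<^sup>2 / 4)"
    by (simp add: N_def)
  also have "\<dots> = of_real ((norm c)\<^sup>2 / 4 - V / 2) + (\<Sum>b\<in>A. E b) / of_real N"
    using N unfolding sum_iexp add_divide_distrib by simp
  also have "norm \<dots> \<le> \<bar>(norm c)\<^sup>2 / 4 - V / 2\<bar> + norm (\<Sum>b\<in>A. E b) / N"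
    using N by (intro order_trans[OF norm_triangle_ineq]) (simp add: norm_divide del: of_real_diff of_real_divide)
  also have "\<bar>(norm c)\<^sup>2 / 4 - V / 2\<bar> \<le> (norm c)\<^sup>2 * (norm \<kappa> / 4 + (norm \<mu>)\<^sup>2 / 2)"
  proof -
    have "\<bar>Re (c\<^sup>2 * \<kappa>)\<bar> \<le> (norm c)\<^sup>2 * norm \<kappa>"
      using abs_Re_le_cmod[of "c\<^sup>2 * \<kappa>"] by (simp add: norm_mult norm_power)
    moreover have "(Re (c * \<mu>))\<^sup>2 \<le> (norm c)\<^sup>2 * (norm \<mu>)\<^sup>2"
      using abs_Re_le_cmod[of "c * \<mu>"] power_mono[of "\<bar>Re (c * \<mu>)\<bar>" "norm (c * \<mu>)" 2]
      by (simp add: norm_mult power_mult_distrib)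
    moreover have "0 \<le> (Re (c * \<mu>))\<^sup>2" by simp
    moreover have "(norm c)\<^sup>2 / 4 - V / 2 = (Re (c * \<mu>))\<^sup>2 / 2 - Re (c\<^sup>2 * \<kappa>) / 4"
      by (simp add: V_def field_simps)
    ultimately show ?thesis unfolding distrib_left by linarith
  qed
  also have "norm (\<Sum>b\<in>A. E b) / N \<le> 2 * norm c ^ 3"
  proof -
    have "norm (\<Sum>b\<in>A. E b) \<le> (\<Sum>b\<in>A. 2 * norm c ^ 3)"
      using E_le by (intro order_trans[OF norm_sum] sum_mono)
    then show ?thesis using N by (simp add: N_def divide_le_eq mult.commute)
  qed
  finally show ?thesis by (simp add: X_def)
qed

section \<open>One step of the urn\<close>

lemma power_mod_root_of_unity:
  fixes \<xi> :: complex
  assumes "\<xi> ^ d = 1"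
  shows "\<xi> ^ (k mod d) = \<xi> ^ k"
proof -
  have "\<xi> ^ k = \<xi> ^ (d * (k div d) + k mod d)" by (simp only: mult_div_mod_eq)
  also have "\<dots> = (\<xi> ^ d) ^ (k div d) * \<xi> ^ (k mod d)" unfolding power_add power_mult ..
  finally show ?thesis by (simp only: assms power_one mult_1_left)
qed

context cyclic_urn
begin

text \<open>The variable is determined by the first \<open>n\<close> draws. These take finitely many values, so an
adapted variable is automatically measurable and bounded, whatever its target; this is why the notion
is phrased pointwise and not through a sigma algebra.\<close>

definition adapted :: "nat \<Rightarrow> ('a \<Rightarrow> 'b) \<Rightarrow> bool" where
  "adapted n Y \<longleftrightarrow>
     (\<forall>x\<in>space M. \<forall>y\<in>space M. (\<forall>i<n. draw i x = draw i y) \<longrightarrow> Y x = Y y)"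

lemma adapted_mono: "adapted k Y \<Longrightarrow> k \<le> n \<Longrightarrow> adapted n Y"
  unfolding adapted_def by (meson order_less_le_trans)

lemma adapted_cong:
  assumes "adapted n Y" and "x \<in> space M" and "y \<in> space M" and "\<forall>i<n. draw i x = draw i y"
  shows "Y x = Y y"
  using assms unfolding adapted_def by blast

lemma adapted_comp: "adapted n Y \<Longrightarrow> adapted n (\<lambda>x. F (Y x))"
  unfolding adapted_def by (intro ballI impI arg_cong[where f = F]) blast

lemma adapted_comp2:
  assumes "adapted n Y" and "adapted n Z"
  shows "adapted n (\<lambda>x. F (Y x) (Z x))"
  unfolding adapted_def
  using adapted_cong[OF assms(1)] adapted_cong[OF assms(2)] by (intro ballI impI arg_cong2[where f = F])

lemma adapted_sum:
  assumes "\<And>b. b \<in> A \<Longrightarrow> adapted n (Y b)"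
  shows "adapted n (\<lambda>x. \<Sum>b\<in>A. Y b x)"
  unfolding adapted_def using adapted_cong[OF assms] by (intro ballI impI sum.cong refl)

lemma draw_measurable: "draw n \<in> measurable M (count_space {..n})"
  using indep unfolding indep_vars_def by auto

lemma draw_le: "x \<in> space M \<Longrightarrow> draw n x \<le> n"
  using measurable_space[OF draw_measurable[of n]] by auto

lemma adapted_draw: "i < n \<Longrightarrow> adapted n (draw i)"
  unfolding adapted_def by auto

text \<open>The type of a ball depends on the draws only through its ancestors, all of which are older.\<close>

lemma adapted_ty: "adapted b (ty b)"
proof (induction b rule: less_induct)
  case (less b)
  show ?case
  proof (cases b)
    case 0
    then show ?thesis by (simp add: adapted_def ty_0)
  next
    case (Suc c)
    show ?thesis
      unfolding adapted_def
    proof (intro ballI impI)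
      fix x y assume x: "x \<in> space M" and y: "y \<in> space M" and eq: "\<forall>i<b. draw i x = draw i y"
      have d: "draw c x = draw c y" and le: "draw c x < b"
        using eq Suc draw_le[OF x, of c] by auto
      have "ty (draw c x) x = ty (draw c x) y"
        using less[OF le] x y eq le unfolding adapted_def by (meson order_less_trans)
      then show "ty b x = ty b y"
        using ty_Suc[OF x, of c] ty_Suc[OF y, of c] Suc d by simp
    qed
  qed
qed

lemma hist_measurable:
  "(\<lambda>x. \<lambda>i\<in>{..<n}. draw i x) \<in> measurable M (PiM {..<n} (\<lambda>i. count_space {..i}))"
  by (intro measurable_restrict draw_measurable)

lemma adapted_factor:
  assumes "adapted n Y"
  obtains G where "\<And>x. x \<in> space M \<Longrightarrow> Y x = G (\<lambda>i\<in>{..<n}. draw i x)"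
proof
  fix x assume x: "x \<in> space M"
  define z where "z = (SOME z. z \<in> space M \<and> (\<lambda>i\<in>{..<n}. draw i z) = (\<lambda>i\<in>{..<n}. draw i x))"
  have z: "z \<in> space M \<and> (\<lambda>i\<in>{..<n}. draw i z) = (\<lambda>i\<in>{..<n}. draw i x)"
    unfolding z_def by (rule someI[of _ x]) (simp add: x)
  then have "\<forall>i<n. draw i z = draw i x" by (metis lessThan_iff restrict_apply')
  then have "Y z = Y x" using assms z x unfolding adapted_def by blast
  then show "Y x = (\<lambda>h. Y (SOME z. z \<in> space M \<and> (\<lambda>i\<in>{..<n}. draw i z) = h)) (\<lambda>i\<in>{..<n}. draw i x)"
    by (simp add: z_def)
qed

lemma PiM_hist: "PiM {..<n} (\<lambda>i. count_space {..i::nat}) = count_space (PiE {..<n} (\<lambda>i. {..i}))"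
  by (rule count_space_PiM_finite) auto

lemma adapted_finite_image:
  assumes "adapted n Y"
  shows "finite (Y ` space M)"
proof -
  obtain G where G: "\<And>x. x \<in> space M \<Longrightarrow> Y x = G (\<lambda>i\<in>{..<n}. draw i x)"
    using adapted_factor[OF assms] by blast
  have "Y ` space M \<subseteq> G ` (PiE {..<n} (\<lambda>i. {..i}))"
    using G draw_le by fastforce
  then show ?thesis by (rule finite_subset) (auto intro: finite_PiE)
qed

lemma adapted_measurable:
  assumes "adapted n Y"
  shows "Y \<in> measurable M borel"
proof -
  obtain G where G: "\<And>x. x \<in> space M \<Longrightarrow> Y x = G (\<lambda>i\<in>{..<n}. draw i x)"
    using adapted_factor[OF assms] by blast
  have "G \<in> measurable (PiM {..<n} (\<lambda>i. count_space {..i})) borel"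
    unfolding PiM_hist by simp
  from measurable_compose[OF hist_measurable this] show ?thesis
    by (subst measurable_cong[OF G])
qed

lemma adapted_integrable:
  fixes Y :: "'a \<Rightarrow> 'b::{banach, second_countable_topology}"
  assumes "adapted n Y"
  shows "integrable M Y"
proof (rule integrable_const_bound)
  show "AE x in M. norm (Y x) \<le> Max (norm ` Y ` space M)"
    using adapted_finite_image[OF assms] by (intro AE_I2 Max_ge) auto
  show "Y \<in> borel_measurable M" by (rule adapted_measurable[OF assms])
qed

text \<open>An adapted variable is a function of the history of draws, so it is independent of the next draw.\<close>

lemma expectation_indicator_draw_mult:
  fixes Y :: "'a \<Rightarrow> 'b::{real_normed_field, banach, second_countable_topology}"
  assumes Y: "adapted n Y" and b: "b \<le> n"
  shows "integrable M (\<lambda>x. of_bool (draw n x = b) * Y x)"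
    and "(\<integral>x. of_bool (draw n x = b) * Y x \<partial>M) = (\<integral>x. Y x \<partial>M) / of_nat (Suc n)"
proof -
  obtain G where G: "\<And>x. x \<in> space M \<Longrightarrow> Y x = G (\<lambda>i\<in>{..<n}. draw i x)"
    using adapted_factor[OF Y] by blast
  define I :: "'a \<Rightarrow> 'b" where "I x = of_bool (draw n x = b)" for x
  have I_adapted: "adapted (Suc n) I"
    unfolding I_def by (rule adapted_comp[OF adapted_draw]) simp
  have "indep_var (PiM {..<n} (\<lambda>i. count_space {..i})) (\<lambda>x. \<lambda>i\<in>{..<n}. draw i x)
      (PiM {n} (\<lambda>i. count_space {..i})) (\<lambda>x. \<lambda>i\<in>{n}. draw i x)"
    by (intro indep_var_restrict[OF indep]) auto
  from indep_var_compose[OF this, of G borel "\<lambda>h. of_bool (h n = b)" borel]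
  have "indep_var borel (G \<circ> (\<lambda>x. \<lambda>i\<in>{..<n}. draw i x))
      borel ((\<lambda>h. of_bool (h n = b) :: 'b) \<circ> (\<lambda>x. \<lambda>i\<in>{n}. draw i x))"
    by (simp add: PiM_hist count_space_PiM_finite)
  moreover have "(\<lambda>h. of_bool (h n = b) :: 'b) \<circ> (\<lambda>x. \<lambda>i\<in>{n}. draw i x) = I"
    by (simp add: fun_eq_iff I_def)
  ultimately have ind: "indep_var borel (\<lambda>x. G (\<lambda>i\<in>{..<n}. draw i x)) borel I"
    by (simp add: o_def)
  have G_int: "integrable M (\<lambda>x. G (\<lambda>i\<in>{..<n}. draw i x))"
    using adapted_integrable[OF Y] by (subst (asm) Bochner_Integration.integrable_cong[OF refl G])
  note I_int = adapted_integrable[OF I_adapted]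
  have "{x \<in> space M. draw n x = b} \<in> sets M"
    using measurable_sets[OF draw_measurable[of n], of "{b}"] b by (simp add: vimage_def Int_def conj_commute)
  have "measure M {x \<in> space M. draw n x = b} = measure (distr M (count_space {..n}) (draw n)) {b}"
    using b by (subst measure_distr[OF draw_measurable])
      (auto intro!: arg_cong[where f = "measure M"])
  also have "\<dots> = 1 / real (Suc n)"
    unfolding uniform using b by (subst measure_uniform_count_measure) auto
  finally have prob: "prob {x \<in> space M. draw n x = b} = 1 / real (Suc n)" .
  have "(\<integral>x. I x \<partial>M) = (\<integral>x. of_real (indicat_real {x \<in> space M. draw n x = b} x) \<partial>M)"
    by (intro Bochner_Integration.integral_cong) (auto simp: I_def indicator_def)
  also have "\<dots> = of_real (prob {x \<in> space M. draw n x = b})"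
    using \<open>{x \<in> space M. draw n x = b} \<in> sets M\<close> by (subst integral_of_real)
      (simp_all add: integrable_real_indicator less_top[symmetric])
  finally have I_mean: "(\<integral>x. I x \<partial>M) = 1 / of_nat (Suc n)" by (simp add: prob del: of_nat_Suc)
  note prod = indep_var_lebesgue_integral[OF ind G_int I_int]
    indep_var_integrable[OF ind G_int I_int]
  show "integrable M (\<lambda>x. of_bool (draw n x = b) * Y x)"
    using prod(2) by (subst Bochner_Integration.integrable_cong[OF refl, of _ _ "\<lambda>x. G (\<lambda>i\<in>{..<n}. draw i x) * I x"])
      (auto simp: G I_def)
  have "(\<integral>x. of_bool (draw n x = b) * Y x \<partial>M) = (\<integral>x. G (\<lambda>i\<in>{..<n}. draw i x) * I x \<partial>M)"
    by (intro Bochner_Integration.integral_cong) (auto simp: G I_def)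
  also have "\<dots> = (\<integral>x. Y x \<partial>M) / of_nat (Suc n)"
    unfolding prod(1) I_mean by (simp add: Bochner_Integration.integral_cong[OF refl G])
  finally show "(\<integral>x. of_bool (draw n x = b) * Y x \<partial>M) = (\<integral>x. Y x \<partial>M) / of_nat (Suc n)" .
qed

text \<open>Conditioning on the past: given the first \<open>n\<close> draws, the next ball is uniform among the \<open>n + 1\<close>
balls present.\<close>

lemma expectation_one_step:
  fixes H :: "nat \<Rightarrow> 'a \<Rightarrow> 'b::{real_normed_field, banach, second_countable_topology}"
  assumes H: "\<And>b. b \<le> n \<Longrightarrow> adapted n (H b)"
  shows "(\<integral>x. H (draw n x) x \<partial>M) = (\<integral>x. (\<Sum>b\<le>n. H b x) / of_nat (Suc n) \<partial>M)"
proof -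
  have "(\<integral>x. H (draw n x) x \<partial>M) = (\<integral>x. (\<Sum>b\<le>n. of_bool (draw n x = b) * H b x) \<partial>M)"
    using draw_le
    by (intro Bochner_Integration.integral_cong) (auto simp: of_bool_def if_distrib[of "\<lambda>u. u * _"] cong: if_cong)
  also have "\<dots> = (\<Sum>b\<le>n. (\<integral>x. H b x \<partial>M) / of_nat (Suc n))"
    using expectation_indicator_draw_mult[OF H]
    by (subst Bochner_Integration.integral_sum) auto
  also have "\<dots> = (\<integral>x. (\<Sum>b\<le>n. H b x) / of_nat (Suc n) \<partial>M)"
    using adapted_integrable[OF H] by (simp add: sum_divide_distrib[symmetric] del: of_nat_Suc)
  finally show ?thesis .
qed

text \<open>The Fourier coefficient of the composition at the root of unity \<open>\<xi>\<close>.\<close>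

definition mode :: "complex \<Rightarrow> nat \<Rightarrow> 'a \<Rightarrow> complex" where
  "mode \<xi> n x = (\<Sum>b\<le>n. \<xi> ^ ty b x)"

text \<open>The martingale increment of the mode if ball \<open>b\<close> is drawn: the added weight \<open>\<xi> \<xi> ^ ty b\<close> minus its
conditional mean.\<close>

definition innov :: "complex \<Rightarrow> nat \<Rightarrow> nat \<Rightarrow> 'a \<Rightarrow> complex" where
  "innov \<xi> n b x = \<xi> * \<xi> ^ ty b x - \<xi> * mode \<xi> n x / of_nat (Suc n)"

lemma adapted_power_ty: "b \<le> n \<Longrightarrow> adapted n (\<lambda>x. \<xi> ^ ty b x)"
  by (rule adapted_comp[OF adapted_mono[OF adapted_ty[of b]], where F = "\<lambda>k. \<xi> ^ k"])

lemma adapted_mode: "adapted n (mode \<xi> n)"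
  unfolding mode_def[abs_def] by (rule adapted_sum, rule adapted_power_ty) simp

lemma adapted_innov: "b \<le> n \<Longrightarrow> adapted n (innov \<xi> n b)"
  unfolding innov_def[abs_def]
  by (rule adapted_comp2[OF adapted_power_ty[of b n \<xi>] adapted_mode[of n \<xi>],
        where F = "\<lambda>u v. \<xi> * u - \<xi> * v / of_nat (Suc n)"])

lemma mode_Suc:
  assumes "\<xi> ^ m = 1" and "x \<in> space M"
  shows "mode \<xi> (Suc n) x = (1 + \<xi> / of_nat (Suc n)) * mode \<xi> n x + innov \<xi> n (draw n x) x"
proof -
  have "\<xi> ^ ty (Suc n) x = \<xi> * \<xi> ^ ty (draw n x) x"
    unfolding ty_Suc[OF assms(2)] power_mod_root_of_unity[OF assms(1)] by simp
  then show ?thesis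
    unfolding mode_def innov_def sum.atMost_Suc by (simp add: distrib_right del: of_nat_Suc)
qed

lemma mode_0: "x \<in> space M \<Longrightarrow> mode \<xi> 0 x = 1"
  by (simp add: mode_def ty_0)

lemma sum_innov: "(\<Sum>b\<le>n. innov \<xi> n b x) = 0"
proof -
  have "(\<Sum>b\<le>n. \<xi> * \<xi> ^ ty b x) = \<xi> * mode \<xi> n x"
    unfolding mode_def sum_distrib_left ..
  moreover have "(\<Sum>b\<le>n. \<xi> * mode \<xi> n x / of_nat (Suc n)) = \<xi> * mode \<xi> n x"
    unfolding sum_constant by (simp del: of_nat_Suc)
  ultimately show ?thesis unfolding innov_def sum_subtractf by simp
qed

lemma expectation_add_innov:
  assumes Y: "adapted n Y"
  shows "(\<integral>x. Y x + c * innov \<xi> n (draw n x) x \<partial>M) = (\<integral>x. Y x \<partial>M)"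
proof -
  have "(\<integral>x. Y x + c * innov \<xi> n (draw n x) x \<partial>M) = (\<integral>x. (\<Sum>b\<le>n. Y x + c * innov \<xi> n b x) / of_nat (Suc n) \<partial>M)"
    by (rule expectation_one_step[where H = "\<lambda>b x. Y x + c * innov \<xi> n b x"])
      (rule adapted_comp2[OF Y adapted_innov, where F = "\<lambda>u v. u + c * v"])
  also have "\<dots> = (\<integral>x. Y x \<partial>M)"
    unfolding sum.distrib sum_distrib_left[symmetric] sum_innov by (simp del: of_nat_Suc)
  finally show ?thesis .
qed

end

context cyclic_urn
begin

lemma innov_average:
  shows "innov \<xi> n b x = \<xi> * \<xi> ^ ty b x - (\<Sum>b\<le>n. \<xi> * \<xi> ^ ty b x) / of_nat (card {..n})"
  unfolding innov_def mode_def sum_distrib_left by simp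

text \<open>Orthogonality of martingale increments, together with the exact conditional variance of the increment.\<close>

lemma expectation_norm_add_innov:
  assumes Y: "adapted n Y" and \<xi>: "norm \<xi> = 1"
  shows "(\<integral>x. (norm (Y x + c * innov \<xi> n (draw n x) x))\<^sup>2 \<partial>M)
    = (\<integral>x. (norm (Y x))\<^sup>2 \<partial>M) + (norm c)\<^sup>2 * (1 - (\<integral>x. (norm (mode \<xi> n x))\<^sup>2 \<partial>M) / (real (Suc n))\<^sup>2)"
proof -
  have avg: "(\<Sum>b\<le>n. (norm (Y x + c * innov \<xi> n b x))\<^sup>2) / real (Suc n)
      = (norm (Y x))\<^sup>2 + (norm c)\<^sup>2 * (1 - (norm (mode \<xi> n x))\<^sup>2 / (real (Suc n))\<^sup>2)" for x
  proof -
    have "norm ((\<Sum>b\<le>n. \<xi> * \<xi> ^ ty b x) / of_nat (card {..n})) = norm (mode \<xi> n x) / real (Suc n)"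
      using \<xi> unfolding sum_distrib_left[symmetric] mode_def[symmetric] by (simp add: norm_divide norm_mult del: of_nat_Suc)
    then show ?thesis
      using average_norm_square[of "{..n}" "\<lambda>b. \<xi> * \<xi> ^ ty b x" _ "Y x" c, OF _ _ _ refl] \<xi>
      unfolding innov_average by (simp add: norm_mult norm_power power_divide del: of_nat_Suc)
  qed
  have "(\<integral>x. (norm (Y x + c * innov \<xi> n (draw n x) x))\<^sup>2 \<partial>M)
      = (\<integral>x. (\<Sum>b\<le>n. (norm (Y x + c * innov \<xi> n b x))\<^sup>2) / real (Suc n) \<partial>M)"
    by (rule expectation_one_step[where H = "\<lambda>b x. (norm (Y x + c * innov \<xi> n b x))\<^sup>2"])
      (rule adapted_comp2[OF Y adapted_innov, where F = "\<lambda>u v. (norm (u + c * v))\<^sup>2"])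
  also have "\<dots> = (\<integral>x. (norm (Y x))\<^sup>2 + (norm c)\<^sup>2 * (1 - (norm (mode \<xi> n x))\<^sup>2 / (real (Suc n))\<^sup>2) \<partial>M)"
    unfolding avg ..
  also have "\<dots> = (\<integral>x. (norm (Y x))\<^sup>2 \<partial>M) + (norm c)\<^sup>2 * (1 - (\<integral>x. (norm (mode \<xi> n x))\<^sup>2 \<partial>M) / (real (Suc n))\<^sup>2)"
    using adapted_integrable[OF adapted_comp[OF Y, where F = "\<lambda>z. (norm z)\<^sup>2"]]
      adapted_integrable[OF adapted_comp[OF adapted_mode[of n \<xi>], where F = "\<lambda>z. (norm z)\<^sup>2"]]
    by (simp add: prob_space del: of_nat_Suc)
  finally show ?thesis .
qed

text \<open>Adding one increment with weight \<open>c\<close> multiplies the characteristic function by \<open>1 - |c|^2 / 4\<close>, up to an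
error governed by the conditional mean of the added weight and by the anisotropy of its conditional
law. The latter is the mode of \<open>\<xi>^2\<close> divided by the number of balls.\<close>

lemma expectation_iexp_add_innov:
  assumes Y: "adapted n Y" and \<xi>: "norm \<xi> = 1"
  shows "norm ((\<integral>x. iexp (Re (Y x + c * innov \<xi> n (draw n x) x)) \<partial>M)
      - of_real (1 - (norm c)\<^sup>2 / 4) * (\<integral>x. iexp (Re (Y x)) \<partial>M))
    \<le> (norm c)\<^sup>2 * ((\<integral>x. norm (mode (\<xi>\<^sup>2) n x) \<partial>M) / (4 * real (Suc n))
        + (\<integral>x. (norm (mode \<xi> n x))\<^sup>2 \<partial>M) / (2 * (real (Suc n))\<^sup>2)) + 2 * norm c ^ 3"
proof -
  define A where "A x = (\<Sum>b\<le>n. iexp (Re (c * innov \<xi> n b x))) / of_nat (Suc n)" for x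
  define q where "q = complex_of_real (1 - (norm c)\<^sup>2 / 4)"
  define e where "e x = (norm c)\<^sup>2 * (norm (mode (\<xi>\<^sup>2) n x) / (4 * real (Suc n))
      + (norm (mode \<xi> n x))\<^sup>2 / (2 * (real (Suc n))\<^sup>2)) + 2 * norm c ^ 3" for x
  have avg: "norm (A x - q) \<le> e x" for x
  proof -
    have 1: "norm ((\<Sum>b\<le>n. \<xi> * \<xi> ^ ty b x) / of_nat (card {..n})) = norm (mode \<xi> n x) / real (Suc n)"
      using \<xi> unfolding sum_distrib_left[symmetric] mode_def[symmetric] by (simp add: norm_divide norm_mult del: of_nat_Suc)
    have 2: "norm ((\<Sum>b\<le>n. (\<xi> * \<xi> ^ ty b x)\<^sup>2) / of_nat (card {..n})) = norm (mode (\<xi>\<^sup>2) n x) / real (Suc n)"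
    proof -
      \<comment> \<open>squaring the weight of a ball turns the mode of \<open>\<xi>\<close> into the mode of \<open>\<xi>^2\<close>\<close>
      have "(\<xi> * \<xi> ^ ty b x)\<^sup>2 = \<xi>\<^sup>2 * (\<xi>\<^sup>2) ^ ty b x" for b
        by (simp add: power_mult_distrib flip: power_mult) (simp add: mult.commute)
      then have "(\<Sum>b\<le>n. (\<xi> * \<xi> ^ ty b x)\<^sup>2) = \<xi>\<^sup>2 * mode (\<xi>\<^sup>2) n x"
        unfolding mode_def sum_distrib_left by simp
      then show ?thesis
        using \<xi> by (simp add: norm_divide norm_mult norm_power del: of_nat_Suc)
    qed
    show ?thesis
      using average_iexp[of "{..n}" "\<lambda>b. \<xi> * \<xi> ^ ty b x" _ _ c, OF _ _ _ refl refl] \<xi>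
      unfolding 1 2 A_def q_def e_def innov_average
      by (simp add: norm_mult norm_power power_divide mult.commute del: of_nat_Suc)
  qed
  have A_adapted: "adapted n A"
    unfolding A_def[abs_def]
    by (intro adapted_comp[OF adapted_sum, where F = "\<lambda>u. u / of_nat (Suc n)"])
      (rule adapted_comp[OF adapted_innov, where F = "\<lambda>u. iexp (Re (c * u))"], simp)
  note iY = adapted_comp[OF Y, where F = "\<lambda>u. iexp (Re u)"]
  have "(\<integral>x. iexp (Re (Y x + c * innov \<xi> n (draw n x) x)) \<partial>M)
      = (\<integral>x. (\<Sum>b\<le>n. iexp (Re (Y x + c * innov \<xi> n b x))) / of_nat (Suc n) \<partial>M)"
    by (rule expectation_one_step[where H = "\<lambda>b x. iexp (Re (Y x + c * innov \<xi> n b x))"])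
      (rule adapted_comp2[OF Y adapted_innov, where F = "\<lambda>u v. iexp (Re (u + c * v))"])
  also have "\<dots> = (\<integral>x. iexp (Re (Y x)) * A x \<partial>M)"
    unfolding A_def by (simp add: exp_add distrib_left sum_distrib_left del: of_nat_Suc times_complex.sel)
  finally have step: "(\<integral>x. iexp (Re (Y x + c * innov \<xi> n (draw n x) x)) \<partial>M) = (\<integral>x. iexp (Re (Y x)) * A x \<partial>M)" .
  have "(\<integral>x. iexp (Re (Y x)) * (A x - q) \<partial>M) = (\<integral>x. iexp (Re (Y x)) * A x - q * iexp (Re (Y x)) \<partial>M)"
    by (simp only: right_diff_distrib mult.commute[of q])
  also have "\<dots> = (\<integral>x. iexp (Re (Y x)) * A x \<partial>M) - q * (\<integral>x. iexp (Re (Y x)) \<partial>M)"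
    using adapted_integrable[OF iY] adapted_integrable[OF adapted_comp2[OF iY A_adapted, where F = "(*)"]]
    by (simp only: Bochner_Integration.integral_diff integrable_mult_right integral_mult_right_zero)
  finally have "(\<integral>x. iexp (Re (Y x + c * innov \<xi> n (draw n x) x)) \<partial>M) - q * (\<integral>x. iexp (Re (Y x)) \<partial>M)
      = (\<integral>x. iexp (Re (Y x)) * (A x - q) \<partial>M)"
    unfolding step by simp
  also have "norm \<dots> \<le> (\<integral>x. e x \<partial>M)"
  proof (rule order_trans[OF integral_norm_bound integral_mono])
    show "integrable M (\<lambda>x. norm (iexp (Re (Y x)) * (A x - q)))"
      by (rule adapted_integrable[OF adapted_comp2[OF iY A_adapted, where F = "\<lambda>u v. norm (u * (v - q))"]])
    show "integrable M e"
      unfolding e_def[abs_def]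
      by (rule adapted_integrable[OF adapted_comp2[OF adapted_mode adapted_mode, where F = "\<lambda>u v. (norm c)\<^sup>2 * (norm u / (4 * real (Suc n))
      + (norm v)\<^sup>2 / (2 * (real (Suc n))\<^sup>2)) + 2 * norm c ^ 3"]])
    show "norm (iexp (Re (Y x)) * (A x - q)) \<le> e x" for x
      using avg[of x] by (simp add: norm_mult)
  qed
  also have "(\<integral>x. e x \<partial>M) = (norm c)\<^sup>2 * ((\<integral>x. norm (mode (\<xi>\<^sup>2) n x) \<partial>M) / (4 * real (Suc n))
        + (\<integral>x. (norm (mode \<xi> n x))\<^sup>2 \<partial>M) / (2 * (real (Suc n))\<^sup>2)) + 2 * norm c ^ 3"
    using adapted_integrable[OF adapted_comp[OF adapted_mode[of n "\<xi>\<^sup>2"], where F = norm]]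
      adapted_integrable[OF adapted_comp[OF adapted_mode[of n \<xi>], where F = "\<lambda>z. (norm z)\<^sup>2"]]
    unfolding e_def by (simp add: prob_space del: of_nat_Suc)
  finally show ?thesis unfolding q_def .
qed

end

section \<open>First and second moments of the modes\<close>

text \<open>The mean of the mode of \<open>\<xi>\<close> at time \<open>n\<close>, for a root of unity \<open>\<xi>\<close>. Away from the poles it equals
\<open>Gamma (n + 1 + \<xi>) / (Gamma (n + 1) Gamma (1 + \<xi>))\<close>; the product form also covers \<open>\<xi> = - 1\<close>.\<close>

definition growth :: "complex \<Rightarrow> nat \<Rightarrow> complex" where
  "growth \<xi> n = (\<Prod>l<n. 1 + \<xi> / of_nat (Suc l))"

lemma growth_Suc: "growth \<xi> (Suc n) = (1 + \<xi> / of_nat (Suc n)) * growth \<xi> n"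
  by (simp add: growth_def mult.commute)

lemma norm_square_one_plus_div:
  assumes "norm \<xi> = 1"
  shows "(norm (1 + \<xi> / of_nat (Suc n)))\<^sup>2 = 1 + 2 * Re \<xi> / real (Suc n) + 1 / (real (Suc n))\<^sup>2"
proof -
  have "(Re \<xi>)\<^sup>2 + (Im \<xi>)\<^sup>2 = 1" using assms cmod_power2[of \<xi>] by simp
  then have "(Re \<xi> / real (Suc n))\<^sup>2 + (Im \<xi> / real (Suc n))\<^sup>2 = 1 / (real (Suc n))\<^sup>2"
    by (simp add: power_divide add_divide_distrib[symmetric] del: of_nat_Suc)
  then show ?thesis
    unfolding cmod_power2 by (simp add: power2_sum Re_divide_of_nat Im_divide_of_nat del: of_nat_Suc)
qed

context cyclic_urn
begin

lemma adapted_norm_mode: "adapted n (\<lambda>x. norm (mode \<xi> n x))"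
  by (rule adapted_comp[OF adapted_mode])

lemma adapted_norm_mode_square: "adapted n (\<lambda>x. (norm (mode \<xi> n x))\<^sup>2)"
  by (rule adapted_comp[OF adapted_mode, where F = "\<lambda>z. (norm z)\<^sup>2"])

lemma expectation_mode:
  assumes "\<xi> ^ m = 1"
  shows "(\<integral>x. mode \<xi> n x \<partial>M) = growth \<xi> n"
proof (induction n)
  case 0
  have "(\<integral>x. mode \<xi> 0 x \<partial>M) = (\<integral>x. 1 \<partial>M)"
    by (intro Bochner_Integration.integral_cong) (simp_all add: mode_0)
  then show ?case by (simp add: prob_space growth_def)
next
  case (Suc n)
  have "(\<integral>x. mode \<xi> (Suc n) x \<partial>M)
      = (\<integral>x. (1 + \<xi> / of_nat (Suc n)) * mode \<xi> n x + 1 * innov \<xi> n (draw n x) x \<partial>M)"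
    by (intro Bochner_Integration.integral_cong refl) (simp add: mode_Suc[OF assms] del: of_nat_Suc)
  also have "\<dots> = (\<integral>x. (1 + \<xi> / of_nat (Suc n)) * mode \<xi> n x \<partial>M)"
    by (rule expectation_add_innov, rule adapted_comp[OF adapted_mode])
  finally show ?case using Suc by (simp add: growth_Suc del: of_nat_Suc)
qed

lemma expectation_norm_mode_Suc:
  assumes \<xi>: "\<xi> ^ m = 1" "norm \<xi> = 1"
  shows "(\<integral>x. (norm (mode \<xi> (Suc n) x))\<^sup>2 \<partial>M)
    = (1 + 2 * Re \<xi> / real (Suc n)) * (\<integral>x. (norm (mode \<xi> n x))\<^sup>2 \<partial>M) + 1"
proof -
  define I where "I = (\<integral>x. (norm (mode \<xi> n x))\<^sup>2 \<partial>M)"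
  have "(\<integral>x. (norm (mode \<xi> (Suc n) x))\<^sup>2 \<partial>M)
      = (\<integral>x. (norm ((1 + \<xi> / of_nat (Suc n)) * mode \<xi> n x + 1 * innov \<xi> n (draw n x) x))\<^sup>2 \<partial>M)"
    by (intro Bochner_Integration.integral_cong refl) (simp add: mode_Suc[OF \<xi>(1)] del: of_nat_Suc)
  also have "\<dots> = (\<integral>x. (norm ((1 + \<xi> / of_nat (Suc n)) * mode \<xi> n x))\<^sup>2 \<partial>M)
      + (norm (1::complex))\<^sup>2 * (1 - I / (real (Suc n))\<^sup>2)"
    unfolding I_def by (rule expectation_norm_add_innov[OF _ \<xi>(2)], rule adapted_comp[OF adapted_mode])
  also have "\<dots> = (norm (1 + \<xi> / of_nat (Suc n)))\<^sup>2 * I + (1 - I / (real (Suc n))\<^sup>2)"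
    by (simp add: norm_mult power_mult_distrib I_def del: of_nat_Suc)
  also have "\<dots> = (1 + 2 * Re \<xi> / real (Suc n)) * I + 1"
    unfolding norm_square_one_plus_div[OF \<xi>(2)] by (simp add: algebra_simps del: of_nat_Suc)
  finally show ?thesis by (simp add: I_def)
qed

lemma expectation_norm_mode_0: "(\<integral>x. (norm (mode \<xi> 0 x))\<^sup>2 \<partial>M) = 1"
proof -
  have "(\<integral>x. (norm (mode \<xi> 0 x))\<^sup>2 \<partial>M) = (\<integral>x. 1 \<partial>M)"
    by (intro Bochner_Integration.integral_cong) (simp_all add: mode_0)
  then show ?thesis by (simp add: prob_space)
qed

text \<open>Linear growth solves the recursion of the second moment as soon as each step can absorb the added
variance \<open>1\<close>, that is, if \<open>1 \<le> C (1 - 2 Re \<xi>)\<close>. In the first step the coefficient of the recursion may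
be negative, so that step is treated separately.\<close>

lemma expectation_norm_mode_subcritical:
  assumes \<xi>: "\<xi> ^ m = 1" "norm \<xi> = 1" and C: "1 \<le> C" "1 \<le> C * (1 - 2 * Re \<xi>)"
  shows "(\<integral>x. (norm (mode \<xi> n x))\<^sup>2 \<partial>M) \<le> C * real (Suc n)"
proof (induction n)
  case 0
  then show ?case using C by (simp add: expectation_norm_mode_0)
next
  case (Suc n)
  have le: "0 \<le> 1 + 2 * Re \<xi> / real (Suc n)" if "n \<noteq> 0"
  proof -
    have "Re \<xi> \<ge> -1" using abs_Re_le_cmod[of \<xi>] \<xi> by simp
    then show ?thesis using that by (simp add: field_simps)
  qed
  show ?case
  proof (cases "n = 0")
    case True
    have "1 + Re \<xi> \<le> C"
    proof (cases "0 \<le> Re \<xi>")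
      case True
      then have "1 * Re \<xi> \<le> C * Re \<xi>" using C by (intro mult_right_mono) auto
      then show ?thesis using C True by (simp add: algebra_simps)
    next
      case False
      then show ?thesis using C by simp
    qed
    then show ?thesis using True unfolding expectation_norm_mode_Suc[OF \<xi>] by (simp add: expectation_norm_mode_0)
  next
    case False
    have "(\<integral>x. (norm (mode \<xi> (Suc n) x))\<^sup>2 \<partial>M)
        \<le> (1 + 2 * Re \<xi> / real (Suc n)) * (C * real (Suc n)) + 1"
      unfolding expectation_norm_mode_Suc[OF \<xi>] by (intro add_right_mono mult_left_mono Suc le False)
    also have "\<dots> = C * real (Suc n) + C * (2 * Re \<xi>) + 1" by (simp add: field_simps)
    also have "\<dots> \<le> C * real (Suc (Suc n))" using C by (simp add: algebra_simps)
    finally show ?thesis .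
  qed
qed

text \<open>At \<open>Re \<xi> = 1 / 2\<close> the second moment divided by \<open>n + 1\<close> increases by exactly \<open>1 / (n + 2)\<close>. This harmonic sum
is the origin of the logarithm in the normalisation.\<close>

lemma expectation_norm_mode_critical:
  assumes \<xi>: "\<xi> ^ m = 1" "norm \<xi> = 1" "Re \<xi> = 1 / 2"
  shows "(\<integral>x. (norm (mode \<xi> n x))\<^sup>2 \<partial>M) = real (Suc n) * harm (Suc n)"
proof (induction n)
  case 0
  then show ?case by (simp add: expectation_norm_mode_0 harm_expand)
next
  case (Suc n)
  show ?case
    unfolding expectation_norm_mode_Suc[OF \<xi>(1,2)] Suc \<xi>(3) harm_Suc[of "Suc n"]
    by (simp add: field_simps)
qed

text \<open>Integrate \<open>2 b |Y| \<le> |Y|^2 + b^2\<close>.\<close>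

lemma expectation_norm_le_of_square:
  fixes Y :: "'a \<Rightarrow> complex"
  assumes "integrable M (\<lambda>x. norm (Y x))" and "integrable M (\<lambda>x. (norm (Y x))\<^sup>2)"
    and "(\<integral>x. (norm (Y x))\<^sup>2 \<partial>M) \<le> b\<^sup>2" and b: "0 < b"
  shows "(\<integral>x. norm (Y x) \<partial>M) \<le> b"
proof -
  have "(\<integral>x. 2 * b * norm (Y x) \<partial>M) \<le> (\<integral>x. (norm (Y x))\<^sup>2 + b\<^sup>2 \<partial>M)"
  proof (intro integral_mono)
    show "2 * b * norm (Y x) \<le> (norm (Y x))\<^sup>2 + b\<^sup>2" for x
      using sum_squares_bound[of "norm (Y x)" b] by (simp only: mult.assoc mult.commute[of b])
  qed (use assms(1,2) in auto)
  also have "\<dots> \<le> 2 * b\<^sup>2" using assms by (simp add: prob_space)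
  finally show ?thesis using b by (simp add: power2_eq_square)
qed

lemma expectation_norm_mode_le:
  assumes "(\<integral>x. (norm (mode \<xi> n x))\<^sup>2 \<partial>M) \<le> b\<^sup>2" and "0 < b"
  shows "(\<integral>x. norm (mode \<xi> n x) \<partial>M) \<le> b"
  by (rule expectation_norm_le_of_square[OF adapted_integrable[OF adapted_norm_mode]
        adapted_integrable[OF adapted_norm_mode_square] assms])

end

section \<open>Central limit theorem for the critical mode\<close>

text \<open>A crude bound on the logarithm: in the error estimates for the critical mode any power below \<open>1\<close> would
do.\<close>

lemma harm_le_sqrt: "harm (Suc n) \<le> 2 * sqrt (real (Suc n))"
proof (induction n)
  case 0
  then show ?case by (simp add: harm_expand)
next
  case (Suc n)
  define a b where "a = sqrt (real (Suc n))" and "b = sqrt (real (Suc (Suc n)))"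
  have ab: "0 < a" "a \<le> b" "1 \<le> b" "b * b = a * a + 1" by (auto simp: a_def b_def)
  have "(b - a) * (b + a) = 1" using ab(4) by (simp add: algebra_simps)
  moreover have "(b - a) * (b + a) \<le> (b - a) * (2 * b)" using ab by (intro mult_left_mono) auto
  ultimately have "1 \<le> (2 * b - 2 * a) * b" by (simp add: algebra_simps)
  then have "1 / b \<le> 2 * b - 2 * a" using ab by (simp add: divide_le_eq)
  moreover have "1 / (b * b) \<le> 1 / b"
    using ab mult_left_mono[of 1 b b] by (intro frac_le) auto
  moreover have "harm (Suc (Suc n)) = harm (Suc n) + 1 / (b * b)"
    unfolding harm_Suc[of "Suc n"] by (simp add: b_def inverse_eq_divide)
  ultimately show ?case using Suc unfolding a_def[symmetric] b_def[symmetric] by linarith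
qed

lemma exp_minus_approx:
  fixes x :: real
  assumes "0 \<le> x"
  shows "\<bar>exp (- x) - (1 - x)\<bar> \<le> x\<^sup>2"
proof -
  have "exp (- x) \<le> 1 / (1 + x)"
    using exp_ge_add_one_self[of x] assms by (simp add: exp_minus inverse_eq_divide frac_le)
  also have "\<dots> \<le> 1 - x + x\<^sup>2"
  proof -
    have "1 \<le> (1 - x + x\<^sup>2) * (1 + x)" using assms by (simp add: algebra_simps power2_eq_square)
    then show ?thesis using assms by (simp add: divide_le_eq)
  qed
  finally show ?thesis using exp_ge_add_one_self[of "- x"] by (simp add: abs_le_iff)
qed

text \<open>Since the multipliers are at most \<open>1\<close>, errors made at earlier steps are not amplified and simply add
up.\<close>

lemma perturbed_product_recursion:
  fixes \<phi> :: "nat \<Rightarrow> complex" and q e :: "nat \<Rightarrow> real"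
  assumes "\<And>l. l < N \<Longrightarrow> norm (\<phi> (Suc l) - of_real (q l) * \<phi> l) \<le> e l"
    and "\<And>l. l < N \<Longrightarrow> 0 \<le> q l \<and> q l \<le> 1"
  shows "norm (\<phi> N - of_real (\<Prod>l<N. q l) * \<phi> 0) \<le> (\<Sum>l<N. e l)"
  using assms
proof (induction N)
  case (Suc N)
  define P where "P = (\<Prod>l<N. q l)"
  have "norm (\<phi> (Suc N) - of_real (\<Prod>l<Suc N. q l) * \<phi> 0)
      = norm ((\<phi> (Suc N) - of_real (q N) * \<phi> N) + of_real (q N) * (\<phi> N - of_real P * \<phi> 0))"
    by (simp add: P_def algebra_simps)
  also have "\<dots> \<le> e N + q N * norm (\<phi> N - of_real P * \<phi> 0)"
    using Suc.prems(1)[of N] Suc.prems(2)[of N]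
    by (intro order_trans[OF norm_triangle_ineq] add_mono) (simp_all add: norm_mult)
  also have "\<dots> \<le> e N + 1 * (\<Sum>l<N. e l)"
    using Suc.IH Suc.prems Suc.prems(2)[of N] unfolding P_def by (intro add_left_mono mult_mono) auto
  finally show ?case by simp
qed simp

text \<open>The coefficient with which the increment of step \<open>l\<close> enters the mode at time \<open>N\<close>.\<close>

definition weight :: "complex \<Rightarrow> nat \<Rightarrow> nat \<Rightarrow> complex" where
  "weight \<xi> N l = (\<Prod>j\<in>{l..<N}. 1 + \<xi> / of_nat (Suc j))"

lemma weight_step: "l < N \<Longrightarrow> weight \<xi> N l = weight \<xi> N (Suc l) * (1 + \<xi> / of_nat (Suc l))"
  unfolding weight_def by (simp add: prod.atLeast_Suc_lessThan mult.commute)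

text \<open>At \<open>Re \<xi> = 1 / 2\<close> one has \<open>|1 + \<xi> / j|^2 = 1 + 1 / j + 1 / j^2\<close>, while \<open>1 + 1 / j\<close> alone would
telescope to \<open>(N + 1) / (l + 1)\<close>. The surplus factors have a bounded product: the expression \<open>(l + 3) / (l + 1)\<close>
decreases fast enough in \<open>l\<close> to dominate it.\<close>

lemma weight_bounds:
  assumes \<xi>: "norm \<xi> = 1" "Re \<xi> = 1 / 2" and "l \<le> N"
  shows "real (Suc N) / real (Suc l) \<le> (norm (weight \<xi> N l))\<^sup>2"
    and "(norm (weight \<xi> N l))\<^sup>2 \<le> real (Suc N) * (real l + 3) / (real (Suc l))\<^sup>2"
proof -
  have "real (Suc N) / real (Suc l) \<le> (norm (weight \<xi> N l))\<^sup>2 \<and>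
    (norm (weight \<xi> N l))\<^sup>2 \<le> real (Suc N) * (real l + 3) / (real (Suc l))\<^sup>2"
    using \<open>l \<le> N\<close>
  proof (induction l rule: inc_induct)
    case base
    have "1 \<le> real (Suc N) * (real N + 3) / (real (Suc N))\<^sup>2"
    proof (rule mult_imp_le_div_pos)
      show "0 < (real (Suc N))\<^sup>2" by (rule zero_less_power) simp
      show "1 * (real (Suc N))\<^sup>2 \<le> real (Suc N) * (real N + 3)"
        by (simp add: power2_eq_square algebra_simps)
    qed
    then show ?case by (simp add: weight_def)
  next
    case (step l)
    define w where "w = (norm (weight \<xi> N (Suc l)))\<^sup>2"
    define x where "x = real l"
    define A where "A = real (Suc N)"
    have x: "0 \<le> x" and A: "0 < A" by (simp_all add: x_def A_def)
    have w: "A / (x + 2) \<le> w" "w \<le> A * (x + 4) / (x + 2)\<^sup>2"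
      using step.IH by (simp_all add: w_def x_def A_def add.commute)
    have eq: "(norm (weight \<xi> N l))\<^sup>2 = w * (1 + 1 / (x + 1) + 1 / (x + 1)\<^sup>2)"
      using step.hyps unfolding w_def
      by (simp add: weight_step norm_mult power_mult_distrib norm_square_one_plus_div \<xi> x_def add.commute del: of_nat_Suc)
        (simp add: add.commute)
    have f: "1 + 1 / (x + 1) + 1 / (x + 1)\<^sup>2 = (x\<^sup>2 + 3 * x + 3) / (x + 1)\<^sup>2"
    proof -
      have "1 + 1 / y + 1 / y\<^sup>2 = (y\<^sup>2 + y + 1) / y\<^sup>2" if "y \<noteq> 0" for y :: real
        using that by (simp add: add_divide_distrib power2_eq_square)
      from this[of "x + 1"] show ?thesis using x by (simp add: power2_eq_square algebra_simps)
    qed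
    have pos: "0 \<le> 1 + 1 / (x + 1) + 1 / (x + 1)\<^sup>2" using x by simp
    have "A / (x + 1) \<le> A / (x + 2) * (1 + 1 / (x + 1) + 1 / (x + 1)\<^sup>2)"
    proof -
      have "(x + 2) * (x + 1) \<le> x\<^sup>2 + 3 * x + 3" by (simp add: power2_eq_square algebra_simps)
      then have "A * ((x + 2) * (x + 1)) \<le> A * (x\<^sup>2 + 3 * x + 3)" using A by simp
      then have "A * ((x + 2) * (x + 1)) / ((x + 2) * (x + 1)\<^sup>2) \<le> A * (x\<^sup>2 + 3 * x + 3) / ((x + 2) * (x + 1)\<^sup>2)"
        using x by (intro divide_right_mono) auto
      moreover have "A * ((x + 2) * (x + 1)) / ((x + 2) * (x + 1)\<^sup>2) = A / (x + 1)"
        using x by (simp add: power2_eq_square)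
      ultimately show ?thesis unfolding f by simp
    qed
    also have "\<dots> \<le> w * (1 + 1 / (x + 1) + 1 / (x + 1)\<^sup>2)"
      using w pos by (intro mult_right_mono)
    finally have 1: "A / (x + 1) \<le> (norm (weight \<xi> N l))\<^sup>2" unfolding eq .
    have "(norm (weight \<xi> N l))\<^sup>2 \<le> A * (x + 4) / (x + 2)\<^sup>2 * (1 + 1 / (x + 1) + 1 / (x + 1)\<^sup>2)"
      unfolding eq using w pos by (intro mult_right_mono)
    also have "\<dots> = A * ((x + 4) * (x\<^sup>2 + 3 * x + 3)) / ((x + 2)\<^sup>2 * (x + 1)\<^sup>2)"
      unfolding f by simp
    also have "\<dots> \<le> A * ((x + 3) * (x + 2)\<^sup>2) / ((x + 2)\<^sup>2 * (x + 1)\<^sup>2)"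
    proof -
      have "(x + 4) * (x\<^sup>2 + 3 * x + 3) \<le> (x + 3) * (x + 2)\<^sup>2"
        using x by (simp add: power2_eq_square algebra_simps)
      then show ?thesis using A by (intro divide_right_mono mult_left_mono) auto
    qed
    also have "\<dots> = A * (x + 3) / (x + 1)\<^sup>2" using x by simp
    finally show ?case using 1 by (simp add: x_def A_def add.commute)
  qed
  then show "real (Suc N) / real (Suc l) \<le> (norm (weight \<xi> N l))\<^sup>2"
    and "(norm (weight \<xi> N l))\<^sup>2 \<le> real (Suc N) * (real l + 3) / (real (Suc l))\<^sup>2" by auto
qed

lemma sum_inverse_square_le: "(\<Sum>l<N. 1 / (real l + 2)\<^sup>2) \<le> 1"
proof -
  have "(\<Sum>l<N. 1 / (real l + 2)\<^sup>2) \<le> 1 - 1 / (real N + 1)"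
  proof (induction N)
    case (Suc N)
    have "1 / (real N + 2)\<^sup>2 \<le> 1 / ((real N + 1) * (real N + 2))"
      unfolding power2_eq_square by (intro divide_left_mono mult_right_mono) auto
    also have "\<dots> = 1 / (real N + 1) - 1 / (real N + 2)" by (simp add: field_simps)
    finally have "1 / (real N + 2)\<^sup>2 \<le> 1 / (real N + 1) - 1 / (real N + 2)" .
    then show ?case using Suc by (simp add: add.commute)
  qed simp
  also have "\<dots> \<le> 1" by simp
  finally show ?thesis .
qed

lemma summable_inverse_mult_sqrt: "summable (\<lambda>l. 1 / (real (Suc l) * sqrt (real (Suc l))))"
proof -
  have "real (Suc l) powr (- 3 / 2) = 1 / (real (Suc l) * sqrt (real (Suc l)))" for l
  proof -
    have "real (Suc l) powr (3 / 2) = real (Suc l) powr (1 + 1 / 2)" by simp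
    also have "\<dots> = real (Suc l) * sqrt (real (Suc l))"
      unfolding powr_add by (simp add: powr_half_sqrt)
    finally show ?thesis using powr_minus_divide[of "real (Suc l)" "3 / 2"] by simp
  qed
  moreover have "summable (\<lambda>l. real (Suc l) powr (- 3 / 2))"
    using summable_real_powr_iff[of "- 3 / 2"] summable_Suc_iff[of "\<lambda>l. real l powr (- 3 / 2)"] by simp
  ultimately show ?thesis by simp
qed

lemma (in prob_space) norm_expectation_iexp_le: "norm (\<integral>x. iexp (f x) \<partial>M) \<le> 1"
proof (cases "integrable M (\<lambda>x. iexp (f x))")
  case True
  have "norm (\<integral>x. iexp (f x) \<partial>M) \<le> (\<integral>x. norm (iexp (f x)) \<partial>M)" by (rule integral_norm_bound)
  then show ?thesis by (simp add: prob_space)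
qed (simp add: not_integrable_integral_eq)

text \<open>Let \<open>c l\<close> be the weight of step \<open>l\<close>. Then \<open>c (l + 1) U (l + 1) = c l U l + c (l + 1) D\<close>, so the characteristic
functions \<open>\<phi> l\<close> of \<open>Re (c l U l)\<close> obey a perturbed product recursion from \<open>\<phi> 0\<close>, which belongs to a constant,
to \<open>\<phi> N\<close>, which is the one sought. With \<open>|c l|^2 \<le> 2 A / l\<close>, \<open>E |mode \<xi> l|^2 = O(l powr (3 / 2))\<close> and
\<open>E |mode (\<xi>^2) l| = O(sqrt l)\<close>, the error of step \<open>l\<close> is \<open>O(A l powr (- 3 / 2))\<close>, and these errors are summable.\<close>

lemma (in cyclic_urn) char_mode_critical_approx:
  assumes \<xi>: "\<xi> ^ m = 1" "norm \<xi> = 1" "Re \<xi> = 1 / 2"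
    and A: "A = (norm a)\<^sup>2 * real (Suc N)" "A \<le> 1"
    and S: "\<And>N. (\<Sum>l<N. 1 / (real (Suc l) * sqrt (real (Suc l)))) \<le> S"
  defines "W \<equiv> (\<Sum>l<N. (norm (a * weight \<xi> N (Suc l)))\<^sup>2)"
  shows "norm ((\<integral>x. iexp (Re (a * mode \<xi> N x)) \<partial>M) - of_real (exp (- W / 4)) * iexp (Re (a * weight \<xi> N 0))) \<le> 14 * A * S"
    and "A * (harm (Suc N) - 1) \<le> W" and "W \<le> A * (harm (Suc N) + 1)"
proof -
  define c where "c l = a * weight \<xi> N l" for l
  define w where "w l = (norm (c l))\<^sup>2" for l
  have A0: "0 \<le> A" using A by simp
  have c_step: "c l = c (Suc l) * (1 + \<xi> / of_nat (Suc l))" if "l < N" for l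
    using weight_step[OF that] by (simp add: c_def del: of_nat_Suc)
  have w_low: "A / (real l + 2) \<le> w (Suc l)" and w_up: "w (Suc l) \<le> A * (1 / (real l + 2) + 2 / (real l + 2)\<^sup>2)"
    if "l < N" for l
  proof -
    have "w (Suc l) = (norm a)\<^sup>2 * (norm (weight \<xi> N (Suc l)))\<^sup>2"
      by (simp add: w_def c_def norm_mult power_mult_distrib)
    moreover have "(norm a)\<^sup>2 * (real (Suc N) / real (Suc (Suc l))) \<le> (norm a)\<^sup>2 * (norm (weight \<xi> N (Suc l)))\<^sup>2"
      and "(norm a)\<^sup>2 * (norm (weight \<xi> N (Suc l)))\<^sup>2
        \<le> (norm a)\<^sup>2 * (real (Suc N) * (real (Suc l) + 3) / (real (Suc (Suc l)))\<^sup>2)"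
      using weight_bounds[OF \<xi>(2,3), of "Suc l" N] that by (intro mult_left_mono; simp)+
    moreover have "(norm a)\<^sup>2 * (real (Suc N) / real (Suc (Suc l))) = A / (real l + 2)"
      unfolding A by (simp add: add.commute)
    moreover have "(norm a)\<^sup>2 * (real (Suc N) * (real (Suc l) + 3) / (real (Suc (Suc l)))\<^sup>2)
        = A * ((real l + 4) / (real l + 2)\<^sup>2)"
      unfolding A by (simp add: add.commute)
    moreover have "(real l + 4) / (real l + 2)\<^sup>2 = 1 / (real l + 2) + 2 / (real l + 2)\<^sup>2"
      by (simp add: divide_simps power2_eq_square)
    ultimately show "A / (real l + 2) \<le> w (Suc l)" and "w (Suc l) \<le> A * (1 / (real l + 2) + 2 / (real l + 2)\<^sup>2)"
      by simp_all
  qed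
  have w_up': "w (Suc l) \<le> 2 * A / real (Suc l)" if "l < N" for l
  proof -
    have "1 / (real l + 2) + 2 / (real l + 2)\<^sup>2 \<le> 2 / real (Suc l)"
      by (simp add: divide_simps power2_eq_square) (simp add: algebra_simps)
    then have "A * (1 / (real l + 2) + 2 / (real l + 2)\<^sup>2) \<le> A * (2 / real (Suc l))"
      using A0 by (rule mult_left_mono)
    then show ?thesis using w_up[OF that] by (simp add: mult.commute)
  qed
  have W: "W = (\<Sum>l<N. w (Suc l))" by (simp add: W_def w_def c_def)
  have harm: "harm (Suc N) = 1 + (\<Sum>l<N. 1 / (real l + 2))"
  proof -
    have "harm (Suc N) = (\<Sum>l<Suc N. inverse (real (Suc l)))" by (rule harm_altdef)
    also have "\<dots> = 1 + (\<Sum>l<N. inverse (real (Suc (Suc l))))"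
      by (subst sum.lessThan_Suc_shift) simp
    finally show ?thesis by (simp add: inverse_eq_divide add.commute)
  qed
  show "A * (harm (Suc N) - 1) \<le> W"
    unfolding W harm using w_low by (simp add: sum_distrib_left) (intro sum_mono, simp)
  have "W \<le> (\<Sum>l<N. A * (1 / (real l + 2) + 2 / (real l + 2)\<^sup>2))"
    unfolding W using w_up by (intro sum_mono) simp
  also have "\<dots> = A * ((\<Sum>l<N. 1 / (real l + 2)) + 2 * (\<Sum>l<N. 1 / (real l + 2)\<^sup>2))"
    by (simp add: sum_distrib_left sum.distrib distrib_left)
  also have "\<dots> \<le> A * ((\<Sum>l<N. 1 / (real l + 2)) + 2 * 1)"
    using A0 sum_inverse_square_le[of N] by (intro mult_left_mono add_left_mono) auto
  finally show "W \<le> A * (harm (Suc N) + 1)" unfolding harm by (simp add: algebra_simps)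

  define \<phi> where "\<phi> l = (\<integral>x. iexp (Re (c l * mode \<xi> l x)) \<partial>M)" for l
  define e where "e l = 14 * A * (1 / (real (Suc l) * sqrt (real (Suc l))))" for l
  have "norm (\<phi> (Suc l) - of_real (exp (- (w (Suc l) / 4))) * \<phi> l) \<le> e l" if l: "l < N" for l
  proof -
    define s where "s = sqrt (real (Suc l))"
    have s: "1 \<le> s" "s * s = real (Suc l)" by (simp_all add: s_def)
    define v where "v = w (Suc l)"
    define p where "p = norm (c (Suc l))"
    have vp: "v = p\<^sup>2" "0 \<le> p" by (simp_all add: v_def p_def w_def)
    have v: "0 \<le> v" "v \<le> 2 * A / (s * s)" using w_up'[OF l] s by (simp_all add: vp(1)) (simp add: v_def vp(1)[symmetric])
    have A_s: "2 * A / (s * s) \<le> 2"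
      using s A(2) A0 mult_mono[of 1 s 1 s] by (simp add: divide_le_eq)
    define I1 where "I1 = (\<integral>x. norm (mode (\<xi>\<^sup>2) l x) \<partial>M)"
    define I2 where "I2 = (\<integral>x. (norm (mode \<xi> l x))\<^sup>2 \<partial>M)"
    have "Re (\<xi>\<^sup>2) = - (1 / 2)"
    proof -
      have "(Re \<xi>)\<^sup>2 + (Im \<xi>)\<^sup>2 = 1" using \<xi>(2) cmod_power2[of \<xi>] by simp
      then have "Re (\<xi>\<^sup>2) = 2 * (Re \<xi>)\<^sup>2 - 1" by (simp add: power2_eq_square)
      then show ?thesis unfolding \<xi>(3) by (simp add: power2_eq_square)
    qed
    moreover have "(\<xi>\<^sup>2) ^ m = 1" using \<xi>(1) by (metis mult.commute power_mult power_one)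
    ultimately have "(\<integral>x. (norm (mode (\<xi>\<^sup>2) l x))\<^sup>2 \<partial>M) \<le> 1 * real (Suc l)"
      using \<xi>(2) by (intro expectation_norm_mode_subcritical) (auto simp: norm_power)
    then have I1: "I1 \<le> s"
      unfolding I1_def using s by (intro expectation_norm_mode_le) (simp_all add: power2_eq_square)
    have "I2 = s * s * harm (Suc l)"
      unfolding I2_def expectation_norm_mode_critical[OF \<xi>] s(2) ..
    also have "\<dots> \<le> s * s * (2 * s)"
      using harm_le_sqrt[of l] s by (intro mult_left_mono) (auto simp: s_def)
    finally have I2: "I2 \<le> 2 * s * s * s" by simp
    have "\<phi> (Suc l) = (\<integral>x. iexp (Re (c l * mode \<xi> l x + c (Suc l) * innov \<xi> l (draw l x) x)) \<partial>M)"
      unfolding \<phi>_def c_step[OF l]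
      by (intro Bochner_Integration.integral_cong refl) (simp add: mode_Suc[OF \<xi>(1)] algebra_simps del: of_nat_Suc times_complex.sel plus_complex.sel)
    then have "norm (\<phi> (Suc l) - of_real (1 - v / 4) * \<phi> l)
        \<le> v * (I1 / (4 * (s * s)) + I2 / (2 * (s * s)\<^sup>2)) + 2 * p ^ 3"
      unfolding \<phi>_def[of l] I1_def I2_def s(2) vp(1) p_def
      by (simp only:) (rule expectation_iexp_add_innov[OF adapted_comp[OF adapted_mode] \<xi>(2)])
    also have "\<dots> \<le> v * (s / (4 * (s * s)) + (2 * s * s * s) / (2 * (s * s)\<^sup>2)) + 2 * (2 * v / s)"
    proof -
      \<comment> \<open>this is where \<open>A \<le> 1\<close> enters: \<open>|c|^2 \<le> 2 A / l\<close> bounds the third power by a multiple of \<open>|c|^2 / sqrt l\<close>\<close>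
      have "p ^ 3 \<le> 2 * v / s"
      proof -
        have "p\<^sup>2 \<le> 2 / (s * s)" using v A A0 s unfolding vp(1)[symmetric]
          by (intro order_trans[OF v(2)] divide_right_mono) auto
        also have "\<dots> \<le> (2 / s)\<^sup>2" using s by (simp add: power2_eq_square divide_simps)
        finally have "p \<le> 2 / s" using s by (intro power2_le_imp_le[of p]) auto
        then have "p\<^sup>2 * p \<le> p\<^sup>2 * (2 / s)" by (intro mult_left_mono) auto
        then show ?thesis by (simp add: vp(1) power3_eq_cube power2_eq_square mult_ac)
      qed
      then show ?thesis
        using I1 I2 v s by (intro add_mono mult_left_mono divide_right_mono) auto
    qed
    also have "\<dots> = (21 / 4) * v / s"
      using s(1) by (simp add: field_simps power2_eq_square)
    finally have 1: "norm (\<phi> (Suc l) - of_real (1 - v / 4) * \<phi> l) \<le> (21 / 4) * v / s" .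
    have "norm (of_real (exp (- (v / 4)) - (1 - v / 4)) * \<phi> l) \<le> (v / 4)\<^sup>2 * 1"
      unfolding norm_mult \<phi>_def norm_of_real
      using v by (intro mult_mono exp_minus_approx norm_expectation_iexp_le) auto
    also have "\<dots> \<le> v / s"
    proof -
      have "v \<le> 2 / (s * s)" using v(2) A A0 s by (intro order_trans[OF v(2)] divide_right_mono) auto
      also have "\<dots> \<le> 2 / s" using s(1) mult_left_mono[of 1 s s] by (intro divide_left_mono) auto
      finally have "v * v \<le> v * (2 / s)" using v by (intro mult_left_mono) auto
      then have "v * v \<le> 2 * (v / s)" by (simp add: mult.commute)
      moreover have "0 \<le> v / s" using v(1) s(1) by simp
      moreover have "(v / 4)\<^sup>2 * 1 = v * v / 16" by (simp add: power2_eq_square)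
      ultimately show ?thesis by linarith
    qed
    finally have 2: "norm (of_real (exp (- (v / 4)) - (1 - v / 4)) * \<phi> l) \<le> v / s" .
    have "norm (\<phi> (Suc l) - of_real (exp (- (v / 4))) * \<phi> l)
        = norm ((\<phi> (Suc l) - of_real (1 - v / 4) * \<phi> l) - of_real (exp (- (v / 4)) - (1 - v / 4)) * \<phi> l)"
      by (simp add: algebra_simps)
    also have "\<dots> \<le> (21 / 4) * v / s + v / s"
      by (intro order_trans[OF norm_triangle_ineq4] add_mono 1 2)
    also have "\<dots> \<le> 7 * (v / s)" using v s by (simp add: field_simps)
    also have "\<dots> \<le> 7 * ((2 * A / (s * s)) / s)" using v s by (intro mult_left_mono divide_right_mono) auto
    also have "\<dots> = e l" using s(1) by (simp add: e_def s(2)[symmetric] del: of_nat_Suc)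
    finally show ?thesis by (simp add: v_def)
  qed
  from perturbed_product_recursion[of N \<phi> "\<lambda>l. exp (- (w (Suc l) / 4))" e, OF this]
  have "norm (\<phi> N - of_real (\<Prod>l<N. exp (- (w (Suc l) / 4))) * \<phi> 0) \<le> (\<Sum>l<N. e l)"
    by (simp add: w_def)
  also have "(\<Prod>l<N. exp (- (w (Suc l) / 4))) = exp (- W / 4)"
    unfolding W by (simp add: exp_sum[symmetric] sum_negf sum_divide_distrib)
  also have "(\<Sum>l<N. e l) \<le> 14 * A * S"
    unfolding e_def sum_distrib_left[symmetric] using A0 S by (intro mult_left_mono) auto
  also have "\<phi> 0 = iexp (Re (a * weight \<xi> N 0))"
  proof -
    have "\<phi> 0 = (\<integral>x. iexp (Re (c 0)) \<partial>M)"
      unfolding \<phi>_def by (intro Bochner_Integration.integral_cong refl) (simp add: mode_0)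
    then show ?thesis by (simp add: prob_space c_def)
  qed
  also have "\<phi> N = (\<integral>x. iexp (Re (a * mode \<xi> N x)) \<partial>M)"
    unfolding \<phi>_def c_def weight_def by simp
  finally show "norm ((\<integral>x. iexp (Re (a * mode \<xi> N x)) \<partial>M) - of_real (exp (- W / 4)) * iexp (Re (a * weight \<xi> N 0))) \<le> 14 * A * S"
    by simp
qed

lemma harm_ratio_limit:
  "(\<lambda>n. (real n + 1) / (real n * ln (real n)) * harm (Suc n)) \<longlonglongrightarrow> 1"
proof -
  have "(\<lambda>n. (real n + 1) / (real n * ln (real n)) * (harm (Suc n) - ln (real (Suc n)))
      + (real n + 1) / (real n * ln (real n)) * ln (real n + 1)) \<longlonglongrightarrow> 0 * euler_mascheroni + 1"
  proof (intro tendsto_intros)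
    show "(\<lambda>n. (real n + 1) / (real n * ln (real n))) \<longlonglongrightarrow> 0" by real_asymp
    show "(\<lambda>n. harm (Suc n) - ln (real (Suc n))) \<longlonglongrightarrow> euler_mascheroni"
      using LIMSEQ_Suc[OF euler_mascheroni_LIMSEQ] .
    show "(\<lambda>n. (real n + 1) / (real n * ln (real n)) * ln (real n + 1)) \<longlonglongrightarrow> 1" by real_asymp
  qed
  moreover have "(real n + 1) / (real n * ln (real n)) * (harm (Suc n) - ln (real (Suc n)))
      + (real n + 1) / (real n * ln (real n)) * ln (real n + 1)
      = (real n + 1) / (real n * ln (real n)) * harm (Suc n)" for n
    by (simp add: distrib_left[symmetric] add.commute del: times_divide_eq_left)
  ultimately show ?thesis by simp
qed

text \<open>In \<open>char_mode_critical_approx\<close> take \<open>a = z / sqrt (N ln N)\<close>. Then \<open>A\<close> tends to \<open>0\<close>, which kills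
the error and the initial value, whereas \<open>A\<close> times the harmonic number, hence \<open>W\<close>, tends to \<open>|z|^2\<close>.\<close>

lemma (in cyclic_urn) char_mode_critical:
  assumes \<xi>: "\<xi> ^ m = 1" "norm \<xi> = 1" "Re \<xi> = 1 / 2"
  shows "(\<lambda>N. \<integral>x. iexp (Re (z * mode \<xi> N x) / sqrt (real N * ln (real N))) \<partial>M)
    \<longlonglongrightarrow> complex_of_real (exp (- ((norm z)\<^sup>2 / 4)))"
proof -
  define a where "a N = z / of_real (sqrt (real N * ln (real N)))" for N :: nat
  define A where "A N = (norm (a N))\<^sup>2 * real (Suc N)" for N
  define W where "W N = (\<Sum>l<N. (norm (a N * weight \<xi> N (Suc l)))\<^sup>2)" for N
  define S where "S = (\<Sum>l. 1 / (real (Suc l) * sqrt (real (Suc l))))"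
  have S: "(\<Sum>l<N. 1 / (real (Suc l) * sqrt (real (Suc l)))) \<le> S" for N
    unfolding S_def by (intro sum_le_suminf summable_inverse_mult_sqrt) auto
  have A_eq: "A N = (norm z)\<^sup>2 * ((real N + 1) / (real N * ln (real N)))" for N
  proof (cases "N = 0")
    case False
    then have "0 \<le> real N * ln (real N)" by simp
    then show ?thesis
      by (simp add: A_def a_def norm_divide power_divide add.commute del: real_sqrt_mult)
  qed (simp add: A_def a_def)
  have A0: "A \<longlonglongrightarrow> 0"
  proof -
    have "(\<lambda>n. (real n + 1) / (real n * ln (real n))) \<longlonglongrightarrow> 0" by real_asymp
    from tendsto_mult_left[OF this, of "(norm z)\<^sup>2"] show ?thesis by (simp add: A_eq[abs_def])
  qed
  have Ah: "(\<lambda>N. A N * harm (Suc N)) \<longlonglongrightarrow> (norm z)\<^sup>2"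
    using tendsto_mult_left[OF harm_ratio_limit, of "(norm z)\<^sup>2"] by (simp add: A_eq[abs_def] mult.assoc)
  have small: "\<forall>\<^sub>F N in sequentially. A N \<le> 1"
    using order_tendstoD(2)[OF A0, of 1] by (auto elim: eventually_mono)
  note approx = char_mode_critical_approx[OF \<xi> A_def _ S, folded W_def]
  have W_lim: "W \<longlonglongrightarrow> (norm z)\<^sup>2"
  proof (rule tendsto_sandwich)
    show "(\<lambda>N. A N * harm (Suc N) - A N) \<longlonglongrightarrow> (norm z)\<^sup>2" using tendsto_diff[OF Ah A0] by simp
    show "(\<lambda>N. A N * harm (Suc N) + A N) \<longlonglongrightarrow> (norm z)\<^sup>2" using tendsto_add[OF Ah A0] by simp
    show "\<forall>\<^sub>F N in sequentially. A N * harm (Suc N) - A N \<le> W N"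
      using small by eventually_elim (use approx(2) in \<open>simp add: right_diff_distrib\<close>)
    show "\<forall>\<^sub>F N in sequentially. W N \<le> A N * harm (Suc N) + A N"
      using small by eventually_elim (use approx(3) in \<open>simp add: distrib_left\<close>)
  qed
  have a_lim: "(\<lambda>N. a N * weight \<xi> N 0) \<longlonglongrightarrow> 0"
  proof (rule Lim_null_comparison)
    show "\<forall>\<^sub>F N in sequentially. norm (a N * weight \<xi> N 0) \<le> sqrt (3 * A N)"
    proof (intro always_eventually allI)
      fix N
      have "(norm (a N))\<^sup>2 * (norm (weight \<xi> N 0))\<^sup>2 \<le> (norm (a N))\<^sup>2 * (real (Suc N) * 3)"
        using weight_bounds(2)[OF \<xi>(2,3), of 0 N] by (intro mult_left_mono) auto
      then show "norm (a N * weight \<xi> N 0) \<le> sqrt (3 * A N)"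
        by (intro real_le_rsqrt) (simp add: norm_mult power_mult_distrib A_def algebra_simps)
    qed
    show "(\<lambda>N. sqrt (3 * A N)) \<longlonglongrightarrow> 0"
      using tendsto_real_sqrt[OF tendsto_mult_left[OF A0, of 3]] by simp
  qed
  define L where "L N = complex_of_real (exp (- W N / 4)) * iexp (Re (a N * weight \<xi> N 0))" for N
  have "(\<lambda>N. L N) \<longlonglongrightarrow> complex_of_real (exp (- (norm z)\<^sup>2 / 4)) * iexp (Re 0)"
    unfolding L_def by (intro tendsto_intros W_lim a_lim) auto
  moreover have "(\<lambda>N. (\<integral>x. iexp (Re (a N * mode \<xi> N x)) \<partial>M) - L N) \<longlonglongrightarrow> 0"
  proof (rule Lim_null_comparison)
    show "\<forall>\<^sub>F N in sequentially. norm ((\<integral>x. iexp (Re (a N * mode \<xi> N x)) \<partial>M) - L N) \<le> 14 * A N * S"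
      using small unfolding L_def by eventually_elim (rule approx(1))
    show "(\<lambda>N. 14 * A N * S) \<longlonglongrightarrow> 0"
      using tendsto_mult_right[OF tendsto_mult_left[OF A0, of 14], of S] by simp
  qed
  ultimately have "(\<lambda>N. ((\<integral>x. iexp (Re (a N * mode \<xi> N x)) \<partial>M) - L N) + L N)
      \<longlonglongrightarrow> 0 + complex_of_real (exp (- (norm z)\<^sup>2 / 4)) * iexp (Re 0)"
    by (intro tendsto_add)
  then have lim: "(\<lambda>N. \<integral>x. iexp (Re (a N * mode \<xi> N x)) \<partial>M) \<longlonglongrightarrow> complex_of_real (exp (- ((norm z)\<^sup>2 / 4)))"
    by (simp del: times_complex.sel)
  have "Re (a N * mode \<xi> N x) = Re (z * mode \<xi> N x) / sqrt (real N * ln (real N))" for N x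
  proof -
    have "a N * mode \<xi> N x = z * mode \<xi> N x / of_real (sqrt (real N * ln (real N)))"
      by (simp add: a_def)
    then show ?thesis by (simp only: Re_divide_of_real)
  qed
  with lim show ?thesis by (simp only:)
qed

section \<open>Asymptotics of the growth factor\<close>

lemma ln_Suc_approx:
  assumes "n \<ge> 1"
  shows "\<bar>ln (real (Suc n)) - ln (real n) - 1 / real (Suc n)\<bar> \<le> 1 / real n - 1 / real (Suc n)"
proof -
  have "1 + 1 / real n = real (Suc n) / real n" using assms by (simp add: field_simps)
  then have "ln (real (Suc n)) - ln (real n) = ln (1 + 1 / real n)"
    using assms by (simp add: ln_div del: of_nat_Suc)
  also have "\<dots> \<le> 1 / real n" by (rule ln_add_one_self_le_self) simp
  finally have 1: "ln (real (Suc n)) - ln (real n) \<le> 1 / real n" .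
  have "1 + - (1 / real (Suc n)) = real n / real (Suc n)" by (simp add: field_simps)
  then have "ln (real n) - ln (real (Suc n)) = ln (1 + (- (1 / real (Suc n))))"
    using assms by (simp add: ln_div del: of_nat_Suc)
  also have "\<dots> \<le> - (1 / real (Suc n))"
    using assms by (intro ln_add_one_self_le_self2) (simp add: field_simps)
  finally show ?thesis using 1 by linarith
qed

lemma norm_exp_minus_one_le:
  fixes w :: complex
  assumes "norm w \<le> R"
  shows "norm (exp w - 1) \<le> exp R * norm w"
proof -
  have "norm (exp w - exp 0) \<le> exp R * norm (w - 0)"
  proof (rule field_differentiable_bound[of "cball 0 R" exp exp])
    fix z :: complex assume "z \<in> cball 0 R"
    then show "norm (exp z) \<le> exp R" using abs_Re_le_cmod[of z] by simp
  qed (use assms norm_ge_zero[of w] in \<open>auto intro!: derivative_eq_intros simp del: norm_ge_zero\<close>)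
  then show ?thesis by simp
qed

text \<open>The sequence \<open>h n = (\<Sum>l=1..n. Ln (1 + \<xi> / l)) - \<xi> ln n\<close> has increments bounded by
\<open>2 (1 / n - 1 / (n + 1))\<close>, because both \<open>Ln (1 + \<xi> / (n + 1))\<close> and \<open>\<xi> (ln (n + 1) - ln n)\<close> differ from
\<open>\<xi> / (n + 1)\<close> by at most half of that. So \<open>h\<close> converges at rate \<open>O(1 / n)\<close>, and exponentiating gives the claim.\<close>

lemma growth_asymptotics:
  assumes \<xi>: "norm \<xi> = 1" "0 < Re \<xi>"
  obtains \<gamma> K where "\<gamma> \<noteq> 0" and "0 \<le> K"
    and "\<And>n. n \<ge> 1 \<Longrightarrow> norm (growth \<xi> n - \<gamma> * of_nat n powr \<xi>) \<le> K * real n powr (Re \<xi> - 1)"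
proof -
  define L where "L n = (\<Sum>l<n. Ln (1 + \<xi> / of_nat (Suc l)))" for n
  define h where "h n = L n - \<xi> * of_real (ln (real n))" for n
  have factor_nz: "1 + \<xi> / of_nat (Suc l) \<noteq> 0" for l
  proof -
    have "Re (1 + \<xi> / of_nat (Suc l)) > 0" using \<xi>(2) by (simp add: Re_divide_of_nat add_pos_pos del: of_nat_Suc)
    then show ?thesis by (metis less_irrefl zero_complex.sel(1))
  qed
  have growth_exp: "growth \<xi> n = exp (L n)" for n
    unfolding growth_def L_def by (simp add: exp_sum factor_nz del: of_nat_Suc)
  have h_exp: "exp (h n) * of_nat n powr \<xi> = growth \<xi> n" if "n \<ge> 1" for n
  proof -
    have "of_nat n powr \<xi> = exp (\<xi> * of_real (ln (real n)))"
      using that by (simp add: powr_def Ln_of_nat)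
    then show ?thesis by (simp add: growth_exp h_def exp_diff)
  qed
  have h_step: "norm (h (Suc n) - h n) \<le> 2 * (1 / real n - 1 / real (Suc n))" if n: "n \<ge> 1" for n
  proof -
    have nz: "norm (\<xi> / of_nat (Suc n)) = 1 / real (Suc n)" using \<xi>(1) by (simp add: norm_divide del: of_nat_Suc)
    have "norm (Ln (1 + \<xi> / of_nat (Suc n)) - \<xi> / of_nat (Suc n)) \<le> (1 / real (Suc n))\<^sup>2 / (1 - 1 / real (Suc n))"
      using Ln_approx_linear[of "\<xi> / of_nat (Suc n)"] n unfolding nz by simp
    also have "\<dots> = 1 / real n - 1 / real (Suc n)"
    proof -
      have "1 - 1 / real (Suc n) = real n / real (Suc n)"
        and "1 / real n - 1 / real (Suc n) = 1 / (real n * real (Suc n))"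
        using n by (simp_all add: field_simps)
      then show ?thesis by (simp add: power2_eq_square del: of_nat_Suc)
    qed
    finally have 1: "norm (Ln (1 + \<xi> / of_nat (Suc n)) - \<xi> / of_nat (Suc n)) \<le> 1 / real n - 1 / real (Suc n)" .
    have 2: "norm (\<xi> * of_real (ln (real (Suc n)) - ln (real n) - 1 / real (Suc n))) \<le> 1 / real n - 1 / real (Suc n)"
      unfolding norm_mult norm_of_real \<xi>(1) using ln_Suc_approx[OF n] by simp
    have "h (Suc n) - h n = (Ln (1 + \<xi> / of_nat (Suc n)) - \<xi> / of_nat (Suc n))
        - \<xi> * of_real (ln (real (Suc n)) - ln (real n) - 1 / real (Suc n))"
      by (simp add: h_def L_def algebra_simps del: of_nat_Suc)
    also have "norm \<dots> \<le> 2 * (1 / real n - 1 / real (Suc n))"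
      by (rule order_trans[OF norm_triangle_ineq4 add_mono[OF 1 2, folded mult_2]])
    finally show ?thesis .
  qed
  have h_diff: "norm (h N - h n) \<le> 2 * (1 / real n - 1 / real N)" if n: "n \<ge> 1" and N: "n \<le> N" for n N
    using N
  proof (induction N rule: dec_induct)
    case (step k)
    have "norm (h (Suc k) - h n) \<le> norm (h (Suc k) - h k) + norm (h k - h n)"
      by (metis diff_add_cancel add_diff_eq norm_triangle_ineq)
    then show ?case using h_step[of k] step n by simp
  qed simp
  have "Cauchy (\<lambda>n. h (Suc n))"
  proof (rule CauchyI)
    fix e :: real assume e: "0 < e"
    obtain k :: nat where k: "k \<ge> 1" "4 / real k < e"
    proof -
      obtain k :: nat where "4 / e < real k" using reals_Archimedean2 by blast
      moreover from this e have "0 < real k" by (meson divide_pos_pos less_trans zero_less_numeral)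
      ultimately show ?thesis using that[of k] e by (simp add: field_simps)
    qed
    have "norm (h (Suc i) - h (Suc j)) < e" if "i \<ge> k" "j \<ge> k" for i j
    proof -
      have "norm (h (Suc i) - h k) \<le> 2 / real k" "norm (h (Suc j) - h k) \<le> 2 / real k"
        using h_diff[OF k(1), of "Suc i"] h_diff[OF k(1), of "Suc j"] that
        by (auto simp: right_diff_distrib intro: order_trans simp del: of_nat_Suc)
      then have "norm ((h (Suc i) - h k) - (h (Suc j) - h k)) \<le> 4 / real k"
        by (intro order_trans[OF norm_triangle_ineq4]) (simp add: field_simps)
      then show ?thesis using k(2) by simp
    qed
    then show "\<exists>M. \<forall>i\<ge>M. \<forall>j\<ge>M. norm (h (Suc i) - h (Suc j)) < e" by blast
  qed
  then obtain H where "(\<lambda>n. h (Suc n)) \<longlonglongrightarrow> H" using Cauchy_convergent convergent_def by blast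
  then have H: "h \<longlonglongrightarrow> H" by (rule LIMSEQ_imp_Suc)
  have H_diff: "norm (h n - H) \<le> 2 / real n" if n: "n \<ge> 1" for n
  proof (rule tendsto_le[of sequentially "\<lambda>_. 2 / real n" _ "\<lambda>N. norm (h n - h N)"])
    show "(\<lambda>N. norm (h n - h N)) \<longlonglongrightarrow> norm (h n - H)" by (intro tendsto_intros H)
    show "\<forall>\<^sub>F N in sequentially. norm (h n - h N) \<le> 2 / real n"
    proof (rule eventually_sequentiallyI[of n])
      fix N assume "n \<le> N"
      then have "norm (h N - h n) \<le> 2 / real n - 2 / real N"
        using h_diff[OF n] by (simp add: right_diff_distrib)
      moreover have "0 \<le> 2 / real N" by simp
      ultimately show "norm (h n - h N) \<le> 2 / real n" unfolding norm_minus_commute[of "h n"] by linarith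
    qed
  qed auto
  show ?thesis
  proof (rule that)
    show "exp H \<noteq> 0" by simp
    show "0 \<le> norm (exp H) * (exp 2 * 2)" by simp
    fix n :: nat assume n: "n \<ge> 1"
    have "2 / real n \<le> 2" using n by (simp add: field_simps)
    then have "norm (exp (h n - H) - 1) \<le> exp 2 * norm (h n - H)"
      using H_diff[OF n] by (intro norm_exp_minus_one_le) linarith
    also have "\<dots> \<le> exp 2 * (2 / real n)" using H_diff[OF n] by (intro mult_left_mono) auto
    finally have 1: "norm (exp (h n - H) - 1) \<le> exp 2 * (2 / real n)" .
    have norm_powr: "norm (of_nat n powr \<xi> :: complex) = real n powr Re \<xi>"
      using n norm_powr_real_powr[of "of_nat n" \<xi>] by simp
    have "growth \<xi> n - exp H * of_nat n powr \<xi> = exp H * of_nat n powr \<xi> * (exp (h n - H) - 1)"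
      unfolding h_exp[OF n, symmetric] by (simp add: exp_diff right_diff_distrib)
    also have "norm \<dots> \<le> norm (exp H) * real n powr Re \<xi> * (exp 2 * (2 / real n))"
      unfolding norm_mult norm_powr using 1 by (intro mult_left_mono) auto
    also have "\<dots> = norm (exp H) * (exp 2 * 2) * real n powr (Re \<xi> - 1)"
      using n by (simp add: powr_diff)
    finally show "norm (growth \<xi> n - exp H * of_nat n powr \<xi>) \<le> norm (exp H) * (exp 2 * 2) * real n powr (Re \<xi> - 1)" .
  qed
qed

section \<open>Almost sure limits of the supercritical modes\<close>

lemma growth_nonzero:
  assumes "0 < Re \<xi>"
  shows "growth \<xi> n \<noteq> 0"
proof -
  have "1 + \<xi> / of_nat (Suc l) \<noteq> 0" for l
  proof -
    have "Re (1 + \<xi> / of_nat (Suc l)) > 0" using assms by (simp add: Re_divide_of_nat add_pos_pos del: of_nat_Suc)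
    then show ?thesis by (metis less_irrefl zero_complex.sel(1))
  qed
  then show ?thesis by (simp add: growth_def del: of_nat_Suc)
qed

lemma tendsto_inverse_growth_square:
  assumes \<xi>: "norm \<xi> = 1" "1 / 2 < Re \<xi>"
  shows "(\<lambda>n. real (Suc n) / (norm (growth \<xi> n))\<^sup>2) \<longlonglongrightarrow> 0"
proof -
  have "0 < Re \<xi>" using \<xi>(2) by simp
  obtain \<gamma> K where \<gamma>: "\<gamma> \<noteq> 0" and K: "0 \<le> K"
    and approx: "\<And>n. n \<ge> 1 \<Longrightarrow> norm (growth \<xi> n - \<gamma> * of_nat n powr \<xi>) \<le> K * real n powr (Re \<xi> - 1)"
    using growth_asymptotics[OF \<xi>(1) \<open>0 < Re \<xi>\<close>] by blast
  define g where "g = norm \<gamma>"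
  have g: "0 < g" using \<gamma> by (simp add: g_def)
  define p where "p = Re \<xi>"
  have low: "g / 2 * real n powr p \<le> norm (growth \<xi> n)" if n: "n \<ge> 1" "2 * K / g \<le> real n" for n
  proof -
    have np: "norm (of_nat n powr \<xi> :: complex) = real n powr p"
      using n norm_powr_real_powr[of "of_nat n" \<xi>] by (simp add: p_def)
    have "K * real n powr (p - 1) \<le> g / 2 * real n * real n powr (p - 1)"
      using n g by (intro mult_right_mono) (simp_all add: field_simps)
    also have "\<dots> = g / 2 * real n powr p" using n by (simp add: powr_diff)
    finally have 1: "K * real n powr (p - 1) \<le> g / 2 * real n powr p" .
    have "g * real n powr p = norm (\<gamma> * of_nat n powr \<xi>)" by (simp add: norm_mult np g_def)
    also have "\<dots> \<le> norm (growth \<xi> n) + norm (growth \<xi> n - \<gamma> * of_nat n powr \<xi>)"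
      by (metis add.commute diff_add_cancel norm_minus_commute norm_triangle_ineq)
    finally show ?thesis using 1 approx[OF n(1)] unfolding p_def by linarith
  qed
  show ?thesis
  proof (rule Lim_null_comparison)
    have "\<forall>\<^sub>F n in sequentially. 2 * K / g \<le> real n"
      using eventually_ge_at_top filterlim_real_sequentially unfolding filterlim_iff by blast
    then show "\<forall>\<^sub>F n in sequentially. norm (real (Suc n) / (norm (growth \<xi> n))\<^sup>2) \<le> 8 / g\<^sup>2 * real n powr (1 - 2 * p)"
      using eventually_ge_at_top[of 1]
    proof eventually_elim
      case (elim n)
      have pos: "0 < g / 2 * real n powr p" using g elim by simp
      have "(g / 2 * real n powr p)\<^sup>2 \<le> (norm (growth \<xi> n))\<^sup>2"
        using low[OF elim(2,1)] pos by (intro power_mono) auto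
      then have "real (Suc n) / (norm (growth \<xi> n))\<^sup>2 \<le> (2 * real n) / (g / 2 * real n powr p)\<^sup>2"
        using pos elim by (intro frac_le) auto
      also have "\<dots> = 8 / g\<^sup>2 * real n powr (1 - 2 * p)"
        using elim by (simp add: powr_diff power_mult_distrib power2_eq_square powr_add[symmetric])
      finally show ?case by simp
    qed
    have "((\<lambda>x. x powr (1 - 2 * p)) \<longlongrightarrow> 0) at_top"
      using \<xi>(2) by (intro tendsto_neg_powr filterlim_ident) (simp add: p_def)
    then have "(\<lambda>n. real n powr (1 - 2 * p)) \<longlonglongrightarrow> 0"
      using filterlim_compose filterlim_real_sequentially by blast
    from tendsto_mult_left[OF this, of "8 / g\<^sup>2"]
    show "(\<lambda>n. 8 / g\<^sup>2 * real n powr (1 - 2 * p)) \<longlonglongrightarrow> 0" by simp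
  qed
qed

context cyclic_urn
begin

text \<open>By orthogonality the left-hand side is at most the sum of \<open>1 / |growth \<xi> l|^2\<close> over \<open>n < l \<le> N\<close>. The sum
telescopes: \<open>B\<close> is chosen so that \<open>B (l - 1) - B l\<close> dominates the summand of
index \<open>l\<close>, which follows from the exact value of \<open>|1 + \<xi> / l|^2\<close>.\<close>

lemma scaled_mode_square_diff:
  assumes \<xi>: "\<xi> ^ m = 1" "norm \<xi> = 1" "1 / 2 < Re \<xi>" and "n \<le> N"
  defines "B \<equiv> \<lambda>n. real (Suc n) / ((2 * Re \<xi> - 1) * (norm (growth \<xi> n))\<^sup>2)"
  shows "(\<integral>x. (norm (mode \<xi> N x / growth \<xi> N - mode \<xi> n x / growth \<xi> n))\<^sup>2 \<partial>M) \<le> B n - B N"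
  using \<open>n \<le> N\<close>
proof (induction N rule: dec_induct)
  case (step N)
  have gz: "growth \<xi> k \<noteq> 0" for k using growth_nonzero \<xi>(3) by simp
  define c where "c = 1 / growth \<xi> (Suc N)"
  define Y where "Y x = mode \<xi> N x / growth \<xi> N - mode \<xi> n x / growth \<xi> n" for x
  define I where "I = (\<integral>x. (norm (mode \<xi> N x))\<^sup>2 \<partial>M)"
  have Y: "adapted N Y"
    unfolding Y_def[abs_def]
    by (rule adapted_comp2[OF adapted_mode[of N \<xi>] adapted_mono[OF adapted_mode[of n \<xi>] step.hyps(1)],
        where F = "\<lambda>u v. u / growth \<xi> N - v / growth \<xi> n"])
  have "mode \<xi> (Suc N) x / growth \<xi> (Suc N) - mode \<xi> n x / growth \<xi> n = Y x + c * innov \<xi> N (draw N x) x"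
    if "x \<in> space M" for x
  proof -
    have "(1 + \<xi> / of_nat (Suc N)) * mode \<xi> N x / growth \<xi> (Suc N) = mode \<xi> N x / growth \<xi> N"
      using gz[of "Suc N"] by (simp add: growth_Suc del: of_nat_Suc)
    then show ?thesis unfolding mode_Suc[OF \<xi>(1) that] Y_def c_def by (simp add: add_divide_distrib)
  qed
  then have "(\<integral>x. (norm (mode \<xi> (Suc N) x / growth \<xi> (Suc N) - mode \<xi> n x / growth \<xi> n))\<^sup>2 \<partial>M)
      = (\<integral>x. (norm (Y x + c * innov \<xi> N (draw N x) x))\<^sup>2 \<partial>M)"
    by (intro Bochner_Integration.integral_cong) auto
  also have "\<dots> = (\<integral>x. (norm (Y x))\<^sup>2 \<partial>M) + (norm c)\<^sup>2 * (1 - I / (real (Suc N))\<^sup>2)"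
    unfolding I_def by (rule expectation_norm_add_innov[OF Y \<xi>(2)])
  also have "\<dots> \<le> (B n - B N) + (norm c)\<^sup>2 * 1"
  proof (intro add_mono mult_left_mono)
    show "(\<integral>x. (norm (Y x))\<^sup>2 \<partial>M) \<le> B n - B N" unfolding Y_def by (rule step.IH)
    have "0 \<le> I" by (simp add: I_def)
    then show "1 - I / (real (Suc N))\<^sup>2 \<le> 1" by simp
  qed simp
  also have "(norm c)\<^sup>2 * 1 \<le> B N - B (Suc N)"
  proof -
    define G where "G = (norm (growth \<xi> (Suc N)))\<^sup>2"
    define y where "y = real (Suc N)"
    define d where "d = 2 * Re \<xi> - 1"
    have d: "0 < d" using \<xi>(3) by (simp add: d_def)
    have y: "0 < y" by (simp add: y_def)
    have G: "0 < G" using gz[of "Suc N"] by (simp add: G_def)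
    have G_eq: "G = (1 + (d + 1) / y + 1 / y\<^sup>2) * (norm (growth \<xi> N))\<^sup>2"
      unfolding G_def growth_Suc norm_mult power_mult_distrib norm_square_one_plus_div[OF \<xi>(2)]
      by (simp add: y_def d_def)
    have "y / (norm (growth \<xi> N))\<^sup>2 = y * (1 + (d + 1) / y + 1 / y\<^sup>2) / G"
    proof -
      have "0 < 1 + (d + 1) / y + 1 / y\<^sup>2" using d y by (intro add_pos_pos) auto
      then have "q / r = q * c / (c * r)" if "c = 1 + (d + 1) / y + 1 / y\<^sup>2" for q c r :: real
        using that by simp
      then show ?thesis unfolding G_eq by blast
    qed
    also have "y * (1 + (d + 1) / y + 1 / y\<^sup>2) = y + d + 1 + 1 / y"
      using y by (simp add: field_simps power2_eq_square)
    finally have ratio: "y / (norm (growth \<xi> N))\<^sup>2 = (y + d + 1 + 1 / y) / G" .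
    have "B N = y / (norm (growth \<xi> N))\<^sup>2 / d"
      by (simp add: B_def y_def d_def mult.commute)
    then have "B N = (y + d + 1 + 1 / y) / (d * G)"
      unfolding ratio by (simp add: mult.commute)
    moreover have "B (Suc N) = (y + 1) / (d * G)"
      by (simp add: B_def y_def d_def G_def)
    ultimately have "B N - B (Suc N) = (d + 1 / y) / (d * G)"
      by (simp add: diff_divide_distrib[symmetric])
    also have "\<dots> \<ge> d / (d * G)"
      using y d G by (intro divide_right_mono) auto
    also have "d / (d * G) = (norm c)\<^sup>2" using d by (simp add: c_def G_def norm_divide power_divide)
    finally show ?thesis by simp
  qed
  finally show ?case by simp
qed simp

text \<open>The martingale \<open>mode \<xi> n / growth \<xi> n\<close> is Cauchy in mean, so a subsequence converges almost surely. Fatou's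
lemma transfers the bound \<open>sqrt (B n)\<close> on the distance between later terms and term \<open>n\<close> to the limit, and
\<open>|growth \<xi> n|^2 B n\<close> is the stated multiple of \<open>n + 1\<close>.\<close>

lemma scaled_mode_limit:
  assumes \<xi>: "\<xi> ^ m = 1" "norm \<xi> = 1" "1 / 2 < Re \<xi>"
  obtains Z where "Z \<in> borel_measurable M" and "integrable M (\<lambda>x. norm (Z x))"
    and "\<And>n. integrable M (\<lambda>x. norm (mode \<xi> n x - growth \<xi> n * Z x))"
    and "\<And>n. (\<integral>x. norm (mode \<xi> n x - growth \<xi> n * Z x) \<partial>M) \<le> sqrt (real (Suc n) / (2 * Re \<xi> - 1))"
proof -
  define X where "X n x = mode \<xi> n x / growth \<xi> n" for n x
  define B where "B n = real (Suc n) / ((2 * Re \<xi> - 1) * (norm (growth \<xi> n))\<^sup>2)" for n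
  have gz: "growth \<xi> k \<noteq> 0" for k using growth_nonzero \<xi>(3) by simp
  have B_pos: "0 < B n" for n using \<xi>(3) gz by (simp add: B_def)
  have X_adapted: "adapted n (X n)" for n
    unfolding X_def[abs_def] by (rule adapted_comp[OF adapted_mode])
  note X_int = adapted_integrable[OF X_adapted]
  note [measurable] = adapted_measurable[OF X_adapted]
  have diff_int: "integrable M (\<lambda>x. norm (X i x - X j x))" for i j
    using X_int by auto
  have X_diff: "(\<integral>x. norm (X N x - X n x) \<partial>M) \<le> sqrt (B n)" if nN: "n \<le> N" for n N
  proof (rule expectation_norm_le_of_square)
    show "integrable M (\<lambda>x. norm (X N x - X n x))" by (rule diff_int)
    show "integrable M (\<lambda>x. (norm (X N x - X n x))\<^sup>2)"
      by (rule adapted_integrable, rule adapted_comp2[OF X_adapted[of N] adapted_mono[OF X_adapted[of n] nN],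
        where F = "\<lambda>u v. (norm (u - v))\<^sup>2"])
    have "(\<integral>x. (norm (X N x - X n x))\<^sup>2 \<partial>M) \<le> B n - B N"
      unfolding X_def B_def by (rule scaled_mode_square_diff[OF \<xi> nN])
    then show "(\<integral>x. (norm (X N x - X n x))\<^sup>2 \<partial>M) \<le> (sqrt (B n))\<^sup>2"
      using B_pos[of N] B_pos[of n] by simp
    show "0 < sqrt (B n)" using B_pos by simp
  qed
  have "(\<lambda>n. 1 / (2 * Re \<xi> - 1) * (real (Suc n) / (norm (growth \<xi> n))\<^sup>2)) \<longlonglongrightarrow> 1 / (2 * Re \<xi> - 1) * 0"
    by (intro tendsto_mult_left tendsto_inverse_growth_square \<xi>)
  then have B_lim: "B \<longlonglongrightarrow> 0" by (simp add: B_def[abs_def])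
  have "\<exists>N. \<forall>i\<ge>N. \<forall>j\<ge>N. (\<integral>x. norm (X i x - X j x) \<partial>M) < e" if e: "0 < e" for e
  proof -
    have "(\<lambda>n. sqrt (B n)) \<longlonglongrightarrow> 0" using tendsto_real_sqrt[OF B_lim] by simp
    then have "\<forall>\<^sub>F n in sequentially. sqrt (B n) < e" using e by (rule order_tendstoD)
    then obtain k where k: "\<And>n. n \<ge> k \<Longrightarrow> sqrt (B n) < e" by (auto simp: eventually_sequentially)
    have "(\<integral>x. norm (X i x - X j x) \<partial>M) < e" if "i \<ge> k" "j \<ge> k" for i j
    proof (cases "i \<le> j")
      case True
      then show ?thesis using X_diff[OF True] k[OF that(1)] by (subst norm_minus_commute) linarith
    next
      case False
      then show ?thesis using X_diff[of j i] k[OF that(2)] by linarith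
    qed
    then show ?thesis by blast
  qed
  from cauchy_L1_AE_cauchy_subseq[OF X_int this]
  obtain s where s: "strict_mono s" and cauchy: "AE x in M. Cauchy (\<lambda>i. X (s i) x)" .
  define Z where "Z x = lim (\<lambda>i. X (s i) x)" for x
  have Z_meas [measurable]: "Z \<in> borel_measurable M"
    unfolding Z_def[abs_def] by (rule borel_measurable_lim_metric) measurable
  have conv: "AE x in M. (\<lambda>i. X (s i) x) \<longlonglongrightarrow> Z x"
    using cauchy by eventually_elim (simp add: Z_def Cauchy_convergent convergent_LIMSEQ_iff[symmetric])
  have fatou: "(\<integral>\<^sup>+x. norm (Z x - X n x) \<partial>M) \<le> ennreal (sqrt (B n))" for n
  proof -
    have "(\<integral>\<^sup>+x. norm (Z x - X n x) \<partial>M) = (\<integral>\<^sup>+x. liminf (\<lambda>i. ennreal (norm (X (s i) x - X n x))) \<partial>M)"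
    proof (rule nn_integral_cong_AE)
      show "AE x in M. ennreal (norm (Z x - X n x)) = liminf (\<lambda>i. ennreal (norm (X (s i) x - X n x)))"
        using conv
      proof eventually_elim
        case (elim x)
        have "(\<lambda>i. ennreal (norm (X (s i) x - X n x))) \<longlonglongrightarrow> ennreal (norm (Z x - X n x))"
          by (intro tendsto_ennrealI tendsto_intros elim)
        then show ?case by (intro lim_imp_Liminf[symmetric]) auto
      qed
    qed
    also have "\<dots> \<le> liminf (\<lambda>i. \<integral>\<^sup>+x. norm (X (s i) x - X n x) \<partial>M)"
      by (rule nn_integral_liminf) measurable
    also have "\<dots> \<le> ennreal (sqrt (B n))"
    proof -
      have "\<forall>\<^sub>F i in sequentially. (\<integral>\<^sup>+x. norm (X (s i) x - X n x) \<partial>M) \<le> ennreal (sqrt (B n))"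
      proof (rule eventually_sequentiallyI[of n])
        fix i assume "n \<le> i"
        then have "n \<le> s i" using seq_suble[OF s, of i] by simp
        then show "(\<integral>\<^sup>+x. norm (X (s i) x - X n x) \<partial>M) \<le> ennreal (sqrt (B n))"
          using diff_int X_diff by (subst nn_integral_eq_integral) (auto intro: ennreal_leI)
      qed
      then show ?thesis by (rule Liminf_le[OF sequentially_bot])
    qed
    finally show ?thesis .
  qed
  have ZX_int: "integrable M (\<lambda>x. norm (Z x - X n x))" for n
  proof (rule integrable_norm, rule integrableI_bounded)
    show "(\<integral>\<^sup>+x. norm (Z x - X n x) \<partial>M) < \<infinity>" using fatou[of n] by (rule order_le_less_trans) simp
  qed measurable
  have ZX: "(\<integral>x. norm (Z x - X n x) \<partial>M) \<le> sqrt (B n)" for n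
    using fatou[of n] B_pos[of n] by (simp add: nn_integral_eq_integral[OF ZX_int] less_imp_le)
  have eq: "norm (mode \<xi> n x - growth \<xi> n * Z x) = norm (growth \<xi> n) * norm (Z x - X n x)" for n x
  proof -
    have "mode \<xi> n x - growth \<xi> n * Z x = growth \<xi> n * (X n x - Z x)"
      using gz[of n] by (simp add: X_def right_diff_distrib)
    then show ?thesis by (simp add: norm_mult norm_minus_commute)
  qed
  show ?thesis
  proof (rule that)
    show "Z \<in> borel_measurable M" by fact
    show "integrable M (\<lambda>x. norm (Z x))"
    proof (rule Bochner_Integration.integrable_bound)
      show "integrable M (\<lambda>x. norm (Z x - X 0 x) + norm (X 0 x))" using ZX_int X_int by auto
      have "norm (Z x) \<le> norm (Z x - X 0 x) + norm (X 0 x)" for x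
        by (metis diff_add_cancel norm_triangle_ineq)
      then show "AE x in M. norm (norm (Z x)) \<le> norm (norm (Z x - X 0 x) + norm (X 0 x))" by simp
    qed measurable
    show "integrable M (\<lambda>x. norm (mode \<xi> n x - growth \<xi> n * Z x))" for n
      unfolding eq using ZX_int by simp
    show "(\<integral>x. norm (mode \<xi> n x - growth \<xi> n * Z x) \<partial>M) \<le> sqrt (real (Suc n) / (2 * Re \<xi> - 1))" for n
    proof -
      have "(\<integral>x. norm (mode \<xi> n x - growth \<xi> n * Z x) \<partial>M) \<le> norm (growth \<xi> n) * sqrt (B n)"
        unfolding eq using ZX by (simp add: mult_left_mono)
      also have "\<dots> = sqrt ((norm (growth \<xi> n))\<^sup>2 * B n)" by (simp add: real_sqrt_mult)
      also have "(norm (growth \<xi> n))\<^sup>2 * B n = real (Suc n) / (2 * Re \<xi> - 1)"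
        using gz[of n] by (simp add: B_def)
      finally show ?thesis .
    qed
  qed
qed

text \<open>Replacing \<open>growth \<xi> n\<close> by \<open>\<gamma> n powr \<xi>\<close> in front of the integrable variable \<open>Z - 1\<close> costs only a
bounded amount, because \<open>Re \<xi> \<le> 1\<close>.\<close>

lemma mode_supercritical:
  assumes \<xi>: "\<xi> ^ m = 1" "norm \<xi> = 1" "1 / 2 < Re \<xi>"
  obtains \<Xi> C where "\<Xi> \<in> borel_measurable M"
    and "\<And>n. integrable M (\<lambda>x. norm (mode \<xi> n x - growth \<xi> n - of_nat n powr \<xi> * \<Xi> x))"
    and "\<And>n. n \<ge> 1 \<Longrightarrow> (\<integral>x. norm (mode \<xi> n x - growth \<xi> n - of_nat n powr \<xi> * \<Xi> x) \<partial>M) \<le> C * sqrt (real (Suc n))"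
proof -
  obtain Z where Z [measurable]: "Z \<in> borel_measurable M" and Z_int: "integrable M (\<lambda>x. norm (Z x))"
    and Zn_int: "\<And>n. integrable M (\<lambda>x. norm (mode \<xi> n x - growth \<xi> n * Z x))"
    and Zn: "\<And>n. (\<integral>x. norm (mode \<xi> n x - growth \<xi> n * Z x) \<partial>M) \<le> sqrt (real (Suc n) / (2 * Re \<xi> - 1))"
    using scaled_mode_limit[OF \<xi>] by blast
  have "0 < Re \<xi>" using \<xi>(3) by simp
  obtain \<gamma> K where "\<gamma> \<noteq> 0" and K: "0 \<le> K"
    and approx: "\<And>n. n \<ge> 1 \<Longrightarrow> norm (growth \<xi> n - \<gamma> * of_nat n powr \<xi>) \<le> K * real n powr (Re \<xi> - 1)"
    using growth_asymptotics[OF \<xi>(2) \<open>0 < Re \<xi>\<close>] by blast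
  define \<Xi> where "\<Xi> x = \<gamma> * (Z x - 1)" for x
  define d where "d = sqrt (2 * Re \<xi> - 1)"
  define J where "J = (\<integral>x. norm (Z x - 1) \<partial>M)"
  have Z1_int: "integrable M (\<lambda>x. norm (Z x - 1))"
    using Z_int integrable_norm_iff[of Z M] by auto
  have J: "0 \<le> J" by (simp add: J_def)
  have le: "norm (mode \<xi> n x - growth \<xi> n - of_nat n powr \<xi> * \<Xi> x)
      \<le> norm (mode \<xi> n x - growth \<xi> n * Z x) + norm (growth \<xi> n - \<gamma> * of_nat n powr \<xi>) * norm (Z x - 1)" for n x
  proof -
    have "mode \<xi> n x - growth \<xi> n - of_nat n powr \<xi> * \<Xi> x
        = (mode \<xi> n x - growth \<xi> n * Z x) + (growth \<xi> n - \<gamma> * of_nat n powr \<xi>) * (Z x - 1)"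
      by (simp add: \<Xi>_def algebra_simps)
    then show ?thesis by (metis norm_mult norm_triangle_ineq)
  qed
  note [measurable] = adapted_measurable[OF adapted_mode]
  have bound_int: "integrable M (\<lambda>x. norm (mode \<xi> n x - growth \<xi> n * Z x) + norm (growth \<xi> n - \<gamma> * of_nat n powr \<xi>) * norm (Z x - 1))" for n
    using Zn_int Z1_int by auto
  have \<Xi> [measurable]: "\<Xi> \<in> borel_measurable M" unfolding \<Xi>_def[abs_def] by measurable
  have int: "integrable M (\<lambda>x. norm (mode \<xi> n x - growth \<xi> n - of_nat n powr \<xi> * \<Xi> x))" for n
    by (rule Bochner_Integration.integrable_bound[OF bound_int[of n]]) (use le[of n] in \<open>auto intro: order_trans[OF le]\<close>)
  show ?thesis
  proof (rule that)
    show "\<Xi> \<in> borel_measurable M" by fact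
    show "integrable M (\<lambda>x. norm (mode \<xi> n x - growth \<xi> n - of_nat n powr \<xi> * \<Xi> x))" for n by (rule int)
    fix n :: nat assume n: "n \<ge> 1"
    have "Re \<xi> \<le> 1" using complex_Re_le_cmod[of \<xi>] \<xi>(2) by simp
    then have "real n powr (Re \<xi> - 1) \<le> 1"
      using n powr_mono[of "Re \<xi> - 1" 0 "real n"] by simp
    then have gr: "norm (growth \<xi> n - \<gamma> * of_nat n powr \<xi>) \<le> K"
      using approx[OF n] mult_left_mono[OF _ K, of "real n powr (Re \<xi> - 1)" 1] by simp
    have "(\<integral>x. norm (mode \<xi> n x - growth \<xi> n - of_nat n powr \<xi> * \<Xi> x) \<partial>M)
        \<le> (\<integral>x. norm (mode \<xi> n x - growth \<xi> n * Z x) + norm (growth \<xi> n - \<gamma> * of_nat n powr \<xi>) * norm (Z x - 1) \<partial>M)"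
      by (intro integral_mono int bound_int le)
    also have "\<dots> = (\<integral>x. norm (mode \<xi> n x - growth \<xi> n * Z x) \<partial>M) + norm (growth \<xi> n - \<gamma> * of_nat n powr \<xi>) * J"
      using Zn_int Z1_int by (simp add: J_def)
    also have "\<dots> \<le> 1 / d * sqrt (real (Suc n)) + K * J * sqrt (real (Suc n))"
    proof (intro add_mono)
      show "(\<integral>x. norm (mode \<xi> n x - growth \<xi> n * Z x) \<partial>M) \<le> 1 / d * sqrt (real (Suc n))"
        using Zn[of n] by (simp add: d_def real_sqrt_divide)
      have "norm (growth \<xi> n - \<gamma> * of_nat n powr \<xi>) * J \<le> K * J * 1" using gr J by (simp add: mult_right_mono)
      also have "\<dots> \<le> K * J * sqrt (real (Suc n))" using K J by (intro mult_left_mono) auto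
      finally show "norm (growth \<xi> n - \<gamma> * of_nat n powr \<xi>) * J \<le> K * J * sqrt (real (Suc n))" .
    qed
    finally show "(\<integral>x. norm (mode \<xi> n x - growth \<xi> n - of_nat n powr \<xi> * \<Xi> x) \<partial>M) \<le> (1 / d + K * J) * sqrt (real (Suc n))"
      by (simp add: distrib_right)
  qed
qed

end

section \<open>Decomposition of the composition vector\<close>

definition Im_vec :: "complex ^ 'm \<Rightarrow> real ^ 'm" where
  "Im_vec v = (\<chi> i. Im (v $ i))"

lemma Re_vec_scale: "Re_vec (z *s v) = Re z *\<^sub>R Re_vec v - Im z *\<^sub>R Im_vec v"
  by (simp add: Re_vec_def Im_vec_def vec_eq_iff)

lemma Re_vec_nth: "Re_vec v $ i = Re (v $ i)"
  by (simp add: Re_vec_def)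

context cyclic_urn
begin

lemma ty_less:
  assumes "0 < m" and "x \<in> space M"
  shows "ty b x < m"
  using assms by (cases b) (simp_all add: ty_0 ty_Suc)

lemma mode_cnj: "mode (cnj \<xi>) n x = cnj (mode \<xi> n x)"
  by (simp add: mode_def cnj_sum)

lemma mode_one: "mode 1 n x = of_nat (Suc n)"
  by (simp add: mode_def)

lemma growth_one: "growth 1 n = of_nat (Suc n)"
proof -
  have "growth 1 n = (\<integral>x. mode 1 n x \<partial>M)" by (rule expectation_mode[symmetric]) simp
  then show ?thesis by (simp add: mode_one prob_space)
qed

lemma growth_cnj: "growth (cnj \<xi>) n = cnj (growth \<xi> n)"
  by (simp add: growth_def)

lemma adapted_composition: "adapted n (composition idx ty n)"
  unfolding adapted_def
proof (intro ballI impI)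
  fix x y assume "x \<in> space M" "y \<in> space M" "\<forall>i<n. draw i x = draw i y"
  then have "ty b x = ty b y" if "b \<le> n" for b
    using adapted_cong[OF adapted_mono[OF adapted_ty that]] by blast
  then have "{b \<in> {..n}. ty b x = idx i} = {b \<in> {..n}. ty b y = idx i}" for i by auto
  then show "composition idx ty n x = composition idx ty n y" by (simp add: composition_def)
qed

lemma composition_eq_sum_modes:
  fixes idx :: "'m::finite \<Rightarrow> nat"
  assumes m: "0 < m" and idx: "bij_betw idx UNIV {..<m}" and x: "x \<in> space M"
  shows "of_real (composition idx ty n x $ i) = (\<Sum>k<m. mode (omega m ^ k) n x * eigvec m idx k $ i)"
proof -
  have i: "idx i < m" using idx by (auto simp: bij_betw_def)
  have "(\<Sum>k<m. mode (omega m ^ k) n x * eigvec m idx k $ i)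
      = (\<Sum>b\<le>n. \<Sum>k<m. (omega m ^ k) ^ ty b x * eigvec m idx k $ i)"
    unfolding mode_def sum_distrib_right by (rule sum.swap)
  also have "\<dots> = (\<Sum>b\<le>n. of_bool (ty b x = idx i))"
    by (intro sum.cong refl sum_eigvec_indicator m ty_less x i)
  also have "\<dots> = of_nat (card {b \<in> {..n}. ty b x = idx i})"
    by (simp add: sum_of_bool_eq Int_def)
  finally show ?thesis by (simp add: composition_def)
qed

lemma expectation_composition:
  fixes idx :: "'m::finite \<Rightarrow> nat"
  assumes m: "0 < m" and idx: "bij_betw idx UNIV {..<m}"
  shows "of_real ((\<integral>x. composition idx ty n x \<partial>M) $ i) = (\<Sum>k<m. growth (omega m ^ k) n * eigvec m idx k $ i)"
proof -
  have "(\<integral>x. composition idx ty n x \<partial>M) $ i = (\<integral>x. composition idx ty n x $ i \<partial>M)"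
    by (rule integral_bounded_linear[OF bounded_linear_vec_nth adapted_integrable[OF adapted_composition], symmetric])
  also have "of_real \<dots> = (\<integral>x. complex_of_real (composition idx ty n x $ i) \<partial>M)" by simp
  also have "\<dots> = (\<integral>x. (\<Sum>k<m. mode (omega m ^ k) n x * eigvec m idx k $ i) \<partial>M)"
    by (intro Bochner_Integration.integral_cong refl composition_eq_sum_modes m idx)
  also have "\<dots> = (\<Sum>k<m. (\<integral>x. mode (omega m ^ k) n x \<partial>M) * eigvec m idx k $ i)"
    using adapted_integrable[OF adapted_mode] by (subst Bochner_Integration.integral_sum) auto
  also have "\<dots> = (\<Sum>k<m. growth (omega m ^ k) n * eigvec m idx k $ i)"
  proof -
    have "(omega m ^ k) ^ m = 1" for k
      by (metis m mult.commute omega_power_m power_mult power_one)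
    then show ?thesis by (simp add: expectation_mode)
  qed
  finally show ?thesis .
qed

lemma norm_growth_critical_le:
  assumes "norm \<xi> = 1" "Re \<xi> = 1 / 2"
  shows "norm (growth \<xi> n) \<le> sqrt 3 * sqrt (real (Suc n))"
proof -
  have "growth \<xi> n = weight \<xi> n 0" by (simp add: growth_def weight_def atLeast0LessThan)
  then have "(norm (growth \<xi> n))\<^sup>2 \<le> real (Suc n) * 3" using weight_bounds(2)[OF assms, of 0 n] by simp
  then show ?thesis by (simp add: real_sqrt_mult[symmetric] real_le_rsqrt mult.commute del: of_nat_Suc)
qed

lemma mode_subcritical:
  assumes \<xi>: "\<xi> ^ m = 1" "norm \<xi> = 1" "Re \<xi> < 1 / 2"
  obtains C where "\<And>n. (\<integral>x. norm (mode \<xi> n x - growth \<xi> n) \<partial>M) \<le> C * sqrt (real (Suc n))"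
proof -
  define C where "C = max 1 (1 / (1 - 2 * Re \<xi>))"
  have C: "1 \<le> C" "1 \<le> C * (1 - 2 * Re \<xi>)"
  proof -
    have "1 / (1 - 2 * Re \<xi>) \<le> C" by (simp add: C_def)
    then show "1 \<le> C * (1 - 2 * Re \<xi>)" using \<xi>(3) by (simp add: divide_le_eq)
  qed (simp add: C_def)
  have "(\<integral>x. norm (mode \<xi> n x - growth \<xi> n) \<partial>M) \<le> (2 * sqrt C) * sqrt (real (Suc n))" for n
  proof -
    have "(\<integral>x. (norm (mode \<xi> n x))\<^sup>2 \<partial>M) \<le> (sqrt (C * real (Suc n)))\<^sup>2"
      using expectation_norm_mode_subcritical[OF \<xi>(1,2) C] C(1) by simp
    then have 1: "(\<integral>x. norm (mode \<xi> n x) \<partial>M) \<le> sqrt (C * real (Suc n))"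
      by (rule expectation_norm_mode_le) (use C(1) in simp)
    have 2: "norm (growth \<xi> n) \<le> (\<integral>x. norm (mode \<xi> n x) \<partial>M)"
      unfolding expectation_mode[OF \<xi>(1), symmetric] by (rule integral_norm_bound)
    have "(\<integral>x. norm (mode \<xi> n x - growth \<xi> n) \<partial>M) \<le> (\<integral>x. norm (mode \<xi> n x) + norm (growth \<xi> n) \<partial>M)"
      using adapted_integrable[OF adapted_norm_mode[of n \<xi>]]
        adapted_integrable[OF adapted_comp[OF adapted_mode[of n \<xi>], where F = "\<lambda>z. norm (z - growth \<xi> n)"]]
      by (intro integral_mono norm_triangle_ineq4) auto
    also have "\<dots> = (\<integral>x. norm (mode \<xi> n x) \<partial>M) + norm (growth \<xi> n)"
      using adapted_integrable[OF adapted_norm_mode[of n \<xi>]] by (simp add: prob_space)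
    also have "\<dots> \<le> 2 * sqrt (C * real (Suc n))" using 1 2 by linarith
    finally show ?thesis by (simp add: real_sqrt_mult)
  qed
  then show ?thesis by (rule that)
qed

text \<open>The part of mode \<open>k\<close> that is negligible at the scale \<open>sqrt (n ln n)\<close>. At the critical index \<open>p = m / 6\<close>
the mode itself belongs to the main term, and only its mean is left.\<close>

definition remainder :: "nat \<Rightarrow> (nat \<Rightarrow> 'a \<Rightarrow> complex) \<Rightarrow> nat \<Rightarrow> nat \<Rightarrow> 'a \<Rightarrow> complex" where
  "remainder p \<Xi> k n x = (if k = p then 0 else mode (omega m ^ k) n x) - growth (omega m ^ k) n
     - (if k < p then of_nat n powr (omega m ^ k) * \<Xi> k x else 0)"

text \<open>The sign of \<open>Re (omega m ^ k) - 1 / 2\<close> is that of \<open>p - k\<close> for \<open>1 \<le> k \<le> 3 p\<close>, since the cosine decreases on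
\<open>[0, pi]\<close> and the angle of index \<open>p\<close> is \<open>pi / 3\<close>.\<close>

lemma remainder_bound:
  assumes m: "m = 6 * p" "0 < p"
  obtains \<Xi> C where "\<And>k. k \<in> {1..<p} \<Longrightarrow> \<Xi> k \<in> borel_measurable M"
    and "\<And>k n. k \<in> {1..3 * p} \<Longrightarrow> integrable M (\<lambda>x. norm (remainder p \<Xi> k n x))"
    and "\<And>k n. k \<in> {1..3 * p} \<Longrightarrow> n \<ge> 1 \<Longrightarrow>
      (\<integral>x. norm (remainder p \<Xi> k n x) \<partial>M) \<le> C k * sqrt (real (Suc n))"
proof -
  have m0: "0 < m" using m by simp
  have root: "(omega m ^ k) ^ m = 1" for k
    by (metis m0 mult.commute omega_power_m power_mult power_one)
  note unit = norm_omega_power[OF m0]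
  have Re: "Re (omega m ^ k) = cos (pi * real k / real (3 * p))" for k
  proof -
    have "2 * pi * real k / real m = pi * real k / real (3 * p)" using m by (simp add: field_simps)
    then show ?thesis by (simp only: Re_omega_power[OF m0])
  qed
  have third: "pi * real p / real (3 * p) = pi / 3" using m by simp
  have "\<exists>\<Xi> C. (k < p \<longrightarrow> \<Xi> \<in> borel_measurable M) \<and>
      (\<forall>n. integrable M (\<lambda>x. norm (remainder p (\<lambda>_. \<Xi>) k n x))) \<and>
      (\<forall>n\<ge>1. (\<integral>x. norm (remainder p (\<lambda>_. \<Xi>) k n x) \<partial>M) \<le> C * sqrt (real (Suc n)))"
    if k: "k \<in> {1..3 * p}" for k
  proof -
    have arg: "0 \<le> pi * real k / real (3 * p)" "pi * real k / real (3 * p) \<le> pi"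
      using k m by (auto simp: divide_le_eq simp flip: of_nat_mult)
    consider "k < p" | "k = p" | "p < k" by linarith
    then show ?thesis
    proof cases
      case 1
      have "1 / 2 < Re (omega m ^ k)"
      proof -
        have lt: "pi * real k / real (3 * p) < pi * real p / real (3 * p)"
          using 1 m by (intro divide_strict_right_mono mult_strict_left_mono) auto
        have "cos (pi * real p / real (3 * p)) < cos (pi * real k / real (3 * p))"
          by (rule cos_monotone_0_pi[OF arg(1) lt]) (unfold third, simp)
        then show ?thesis by (simp only: Re third cos_60)
      qed
      from mode_supercritical[OF root unit this] obtain \<Xi> C where "\<Xi> \<in> borel_measurable M"
        and "\<And>n. integrable M (\<lambda>x. norm (mode (omega m ^ k) n x - growth (omega m ^ k) n - of_nat n powr (omega m ^ k) * \<Xi> x))"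
        and "\<And>n. n \<ge> 1 \<Longrightarrow> (\<integral>x. norm (mode (omega m ^ k) n x - growth (omega m ^ k) n - of_nat n powr (omega m ^ k) * \<Xi> x) \<partial>M) \<le> C * sqrt (real (Suc n))"
        by blast
      then show ?thesis using 1 unfolding remainder_def by (intro exI[of _ \<Xi>] exI[of _ C]) simp
    next
      case 2
      have "Re (omega m ^ k) = 1 / 2" unfolding Re 2 third by (rule cos_60)
      from norm_growth_critical_le[OF unit this] show ?thesis
        using 2 unfolding remainder_def by (intro exI[of _ "\<lambda>_. 0"] exI[of _ "sqrt 3"]) (simp add: prob_space del: of_nat_Suc)
    next
      case 3
      have "Re (omega m ^ k) < 1 / 2"
      proof -
        have lt: "pi * real p / real (3 * p) < pi * real k / real (3 * p)"
          using 3 m by (intro divide_strict_right_mono mult_strict_left_mono) auto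
        have "cos (pi * real k / real (3 * p)) < cos (pi * real p / real (3 * p))"
          by (rule cos_monotone_0_pi[OF _ lt arg(2)]) (unfold third, simp)
        then show ?thesis by (simp only: Re third cos_60)
      qed
      from mode_subcritical[OF root unit this] obtain C where
        "\<And>n. (\<integral>x. norm (mode (omega m ^ k) n x - growth (omega m ^ k) n) \<partial>M) \<le> C * sqrt (real (Suc n))" by blast
      then show ?thesis
        using 3 adapted_integrable[OF adapted_comp[OF adapted_mode, where F = "\<lambda>z. norm (z - _)"]]
        unfolding remainder_def by (intro exI[of _ "\<lambda>_. 0"] exI[of _ C]) simp
    qed
  qed
  then have "\<exists>\<Xi>. \<forall>k\<in>{1..3 * p}. \<exists>C. (k < p \<longrightarrow> \<Xi> k \<in> borel_measurable M) \<and>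
      (\<forall>n. integrable M (\<lambda>x. norm (remainder p (\<lambda>_. \<Xi> k) k n x))) \<and>
      (\<forall>n\<ge>1. (\<integral>x. norm (remainder p (\<lambda>_. \<Xi> k) k n x) \<partial>M) \<le> C * sqrt (real (Suc n)))"
    by (intro bchoice) blast
  then obtain \<Xi> where "\<forall>k\<in>{1..3 * p}. \<exists>C. (k < p \<longrightarrow> \<Xi> k \<in> borel_measurable M) \<and>
      (\<forall>n. integrable M (\<lambda>x. norm (remainder p (\<lambda>_. \<Xi> k) k n x))) \<and>
      (\<forall>n\<ge>1. (\<integral>x. norm (remainder p (\<lambda>_. \<Xi> k) k n x) \<partial>M) \<le> C * sqrt (real (Suc n)))" ..
  from bchoice[OF this] obtain C where C: "\<And>k. k \<in> {1..3 * p} \<Longrightarrow> (k < p \<longrightarrow> \<Xi> k \<in> borel_measurable M) \<and>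
      (\<forall>n. integrable M (\<lambda>x. norm (remainder p (\<lambda>_. \<Xi> k) k n x))) \<and>
      (\<forall>n\<ge>1. (\<integral>x. norm (remainder p (\<lambda>_. \<Xi> k) k n x) \<partial>M) \<le> C k * sqrt (real (Suc n)))" by blast
  have eq: "remainder p (\<lambda>_. \<Xi> k) k n x = remainder p \<Xi> k n x" for k n x by (simp add: remainder_def)
  show ?thesis
    by (rule that[of \<Xi> C]) (use C[unfolded eq] m(2) in auto)
qed

text \<open>The modes \<open>k\<close> and \<open>m - k\<close> are complex conjugates of each other and so are their eigenvectors, hence the indices
above \<open>3 p = m / 2\<close> only double the real parts. The index \<open>0\<close> drops out because the total number of
balls is deterministic.\<close>

lemma centered_composition_nth:
  fixes idx :: "'m::finite \<Rightarrow> nat"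
  assumes m: "m = 6 * p" "0 < p" and idx: "bij_betw idx UNIV {..<m}" and x: "x \<in> space M"
  defines "v \<equiv> eigvec m idx"
  shows "(composition idx ty n x - (\<integral>y. composition idx ty n y \<partial>M)
      - (\<Sum>k\<in>{1..<p}. 2 *\<^sub>R Re_vec ((of_nat n powr (omega m ^ k) * \<Xi> k x) *s v k))
      - 2 *\<^sub>R Re_vec (mode (omega m ^ p) n x *s v p)) $ i
    = 2 * (\<Sum>k\<in>{1..<3 * p}. Re (remainder p \<Xi> k n x * v k $ i)) + Re (remainder p \<Xi> (3 * p) n x * v (3 * p) $ i)"
proof -
  have m0: "0 < m" using m by simp
  define g where "g k = Re ((mode (omega m ^ k) n x - growth (omega m ^ k) n) * v k $ i)" for k
  define c where "c k = Re (of_nat n powr (omega m ^ k) * \<Xi> k x * v k $ i)" for k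
  define q where "q = Re (mode (omega m ^ p) n x * v p $ i)"
  have "complex_of_real ((composition idx ty n x - (\<integral>y. composition idx ty n y \<partial>M)) $ i)
      = (\<Sum>k<m. (mode (omega m ^ k) n x - growth (omega m ^ k) n) * v k $ i)"
    unfolding vector_minus_component of_real_diff composition_eq_sum_modes[OF m0 idx x]
      expectation_composition[OF m0 idx] v_def
    by (simp add: sum_subtractf left_diff_distrib)
  from arg_cong[OF this, of Re]
  have "(composition idx ty n x - (\<integral>y. composition idx ty n y \<partial>M)) $ i = (\<Sum>k<2 * (3 * p). g k)"
    by (simp add: g_def m Re_sum del: times_complex.sel)
  also have "\<dots> = g 0 + 2 * (\<Sum>k\<in>{1..<3 * p}. g k) + g (3 * p)"
  proof (rule sum_symmetric_about_middle)
    fix k assume "0 < k" "k < 3 * p"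
    then have k: "k \<le> m" and e: "2 * (3 * p) - k = m - k" using m by auto
    show "g (2 * (3 * p) - k) = g k"
      unfolding g_def e v_def omega_power_complement[OF m0 k] eigvec_complement[OF m0 k] mode_cnj growth_cnj
      by (simp flip: complex_cnj_diff complex_cnj_mult)
  qed (use m in simp)
  also have "g 0 = 0" by (simp add: g_def mode_one growth_one)
  finally have 1: "(composition idx ty n x - (\<integral>y. composition idx ty n y \<partial>M)) $ i
      = 2 * (\<Sum>k\<in>{1..<3 * p}. g k) + g (3 * p)" by simp
  have rem: "Re (remainder p \<Xi> k n x * v k $ i) = g k - (if k < p then c k else 0) - (if k = p then q else 0)" for k
    by (auto simp: remainder_def g_def c_def q_def left_diff_distrib simp del: times_complex.sel)
  have "(\<Sum>k\<in>{1..<3 * p}. if k < p then c k else 0) = (\<Sum>k\<in>{1..<p}. c k)"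
    by (rule sum.mono_neutral_cong_right) auto
  moreover have "(\<Sum>k\<in>{1..<3 * p}. if k = p then q else 0) = q" using m by (simp add: sum.delta)
  ultimately have 2: "(\<Sum>k\<in>{1..<3 * p}. Re (remainder p \<Xi> k n x * v k $ i))
      = (\<Sum>k\<in>{1..<3 * p}. g k) - (\<Sum>k\<in>{1..<p}. c k) - q"
    unfolding rem sum_subtractf by simp
  have 3: "Re (remainder p \<Xi> (3 * p) n x * v (3 * p) $ i) = g (3 * p)" unfolding rem using m by simp
  have 4: "(\<Sum>k\<in>{1..<p}. 2 *\<^sub>R Re_vec ((of_nat n powr (omega m ^ k) * \<Xi> k x) *s v k)) $ i = 2 * (\<Sum>k\<in>{1..<p}. c k)"
    by (simp add: sum_component Re_vec_nth c_def sum_distrib_left del: times_complex.sel)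
  have 5: "(2 *\<^sub>R Re_vec (mode (omega m ^ p) n x *s v p)) $ i = 2 * q"
    by (simp add: Re_vec_nth q_def del: times_complex.sel)
  show ?thesis
    unfolding vector_minus_component[of "_ - _ - _"] vector_minus_component[of "_ - _" "sum _ _"] 1 2 3 4 5
    by simp
qed

end

section \<open>The limit theorem\<close>

text \<open>This bound provides the first moments needed for \<open>conv_in_distribution_of_char_perturbed\<close>.\<close>

lemma (in cyclic_urn) critical_mode_mean_bounded:
  assumes \<xi>: "\<xi> ^ m = 1" "norm \<xi> = 1" "Re \<xi> = 1 / 2"
  shows "\<forall>\<^sub>F n in sequentially. (\<integral>x. norm (mode \<xi> n x) \<partial>M) \<le> 2 * sqrt (real n * ln (real n))"
  using order_tendstoD(2)[OF harm_ratio_limit, of 4, simplified] eventually_ge_at_top[of 2]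
proof eventually_elim
  case (elim n)
  have pos: "0 < real n * ln (real n)" using elim by simp
  have "(real n + 1) * harm (Suc n) \<le> 4 * (real n * ln (real n))"
    using elim(1) pos by (simp add: divide_less_eq)
  then have "(\<integral>x. (norm (mode \<xi> n x))\<^sup>2 \<partial>M) \<le> (2 * sqrt (real n * ln (real n)))\<^sup>2"
    using pos unfolding expectation_norm_mode_critical[OF \<xi>] by (simp add: power_mult_distrib add.commute del: real_sqrt_mult)
  then show ?case using pos by (intro expectation_norm_mode_le) (simp_all del: real_sqrt_mult)
qed

text \<open>With \<open>a\<close> and \<open>b\<close> as defined here, \<open>a a\<^sup>T + b b\<^sup>T = 2 Re (v v\<^sup>*) = v v\<^sup>* + w w\<^sup>*\<close> for the conjugate \<open>w\<close> of \<open>v\<close>.\<close>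

lemma covariance_matrix:
  fixes v w :: "complex ^ 'm"
  assumes w: "\<And>i. w $ i = cnj (v $ i)" and v: "(\<Sum>i\<in>UNIV. (v $ i)\<^sup>2) = 0" and nz: "v \<noteq> 0"
  defines "a \<equiv> sqrt 2 *\<^sub>R Re_vec v" and "b \<equiv> sqrt 2 *\<^sub>R Im_vec v"
  defines "S \<equiv> \<chi> i j. a $ i * a $ j + b $ i * b $ j"
  shows "complex_mat S = outer_adj v v + outer_adj w w" and "rank S = 2" and "centered_normal S (plane_normal a b)"
proof -
  show "complex_mat S = outer_adj v v + outer_adj w w"
    by (simp add: complex_mat_def outer_adj_def S_def a_def b_def vec_eq_iff w Re_vec_def Im_vec_def complex_eq_iff algebra_simps)
  have S_mult: "S *v x = (a \<bullet> x) *\<^sub>R a + (b \<bullet> x) *\<^sub>R b" for x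
    by (simp add: vec_eq_iff S_def matrix_vector_mult_def inner_vec_def sum.distrib sum_distrib_left algebra_simps)
  have "Re (\<Sum>i\<in>UNIV. (v $ i)\<^sup>2) = Re_vec v \<bullet> Re_vec v - Im_vec v \<bullet> Im_vec v"
    and "Im (\<Sum>i\<in>UNIV. (v $ i)\<^sup>2) = 2 * (Re_vec v \<bullet> Im_vec v)"
    by (simp_all add: Re_sum Im_sum Re_vec_def Im_vec_def inner_vec_def power2_eq_square sum_subtractf sum_distrib_left algebra_simps)
  then have eq: "Re_vec v \<bullet> Re_vec v = Im_vec v \<bullet> Im_vec v" and orth: "Re_vec v \<bullet> Im_vec v = 0"
    unfolding v by simp_all
  have "Re_vec v \<noteq> 0 \<and> Im_vec v \<noteq> 0"
  proof -
    have "Re_vec v = 0 \<longleftrightarrow> Im_vec v = 0" using eq inner_eq_zero_iff by metis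
    moreover have "Re_vec v \<noteq> 0 \<or> Im_vec v \<noteq> 0"
      using nz by (auto simp: vec_eq_iff Re_vec_def Im_vec_def complex_eq_iff)
    ultimately show ?thesis by blast
  qed
  then show "rank S = 2"
    by (intro rank_two_of_orthogonal[OF S_mult]) (simp_all add: a_def b_def orth)
  show "centered_normal S (plane_normal a b)"
  proof (rule centered_normal_plane_normal)
    show "transpose S = S" by (simp add: transpose_def S_def vec_eq_iff mult.commute)
    show "t \<bullet> (S *v t) = (t \<bullet> a)\<^sup>2 + (t \<bullet> b)\<^sup>2" for t
      unfolding S_mult by (simp add: inner_add_right power2_eq_square inner_commute)
  qed
qed

text \<open>The normalised vector splits into the contribution \<open>U\<close> of the critical mode and the rest \<open>W\<close>. Any linear
functional of \<open>U\<close> has the form \<open>Re (z mode) / sqrt (n ln n)\<close>, to which \<open>char_mode_critical\<close> applies, and \<open>W\<close> is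
of order \<open>1 / sqrt (ln n)\<close> in mean.\<close>

lemma (in cyclic_urn) cyclic_urn_limit:
  fixes idx :: "'m::finite \<Rightarrow> nat"
  assumes m: "m = 6 * p" "0 < p" and idx: "bij_betw idx UNIV {..<m}"
  defines "v \<equiv> eigvec m idx"
  obtains \<Xi> where "\<And>k. k \<in> {1..<p} \<Longrightarrow> \<Xi> k \<in> borel_measurable M"
    and "conv_in_distribution M
      (\<lambda>n x. (1 / sqrt (real n * ln (real n))) *\<^sub>R
         (composition idx ty n x - (\<integral>y. composition idx ty n y \<partial>M) -
          (\<Sum>k\<in>{1..<p}. 2 *\<^sub>R Re_vec ((of_nat n powr (omega m ^ k) * \<Xi> k x) *s v k))))
      (plane_normal (sqrt 2 *\<^sub>R Re_vec (v p)) (sqrt 2 *\<^sub>R Im_vec (v p)))"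
proof -
  have m0: "0 < m" using m by simp
  define \<xi> where "\<xi> = omega m ^ p"
  have \<xi>: "\<xi> ^ m = 1" "norm \<xi> = 1" "Re \<xi> = 1 / 2"
  proof -
    show "\<xi> ^ m = 1" unfolding \<xi>_def by (metis m0 mult.commute omega_power_m power_mult power_one)
    show "norm \<xi> = 1" unfolding \<xi>_def by (rule norm_omega_power[OF m0])
    have "2 * pi * real p / real m = pi / 3" using m by simp
    then show "Re \<xi> = 1 / 2" unfolding \<xi>_def Re_omega_power[OF m0] by (simp only: cos_60)
  qed
  obtain \<Xi> C where \<Xi>: "\<And>k. k \<in> {1..<p} \<Longrightarrow> \<Xi> k \<in> borel_measurable M"
    and rem_int: "\<And>k n. k \<in> {1..3 * p} \<Longrightarrow> integrable M (\<lambda>x. norm (remainder p \<Xi> k n x))"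
    and rem: "\<And>k n. k \<in> {1..3 * p} \<Longrightarrow> n \<ge> 1 \<Longrightarrow>
      (\<integral>x. norm (remainder p \<Xi> k n x) \<partial>M) \<le> C k * sqrt (real (Suc n))"
    using remainder_bound[OF m] by blast
  define a b where "a = Re_vec (v p)" and "b = Im_vec (v p)"
  define s where "s n = sqrt (real n * ln (real n))" for n :: nat
  have s_nonneg: "0 \<le> s n" for n by (cases "n = 0") (simp_all add: s_def)
  define Y where "Y n x = composition idx ty n x - (\<integral>y. composition idx ty n y \<partial>M) -
      (\<Sum>k\<in>{1..<p}. 2 *\<^sub>R Re_vec ((of_nat n powr (omega m ^ k) * \<Xi> k x) *s v k))" for n x
  define main where "main n x = 2 *\<^sub>R Re_vec (mode \<xi> n x *s v p)" for n x
  define U where "U n x = (1 / s n) *\<^sub>R main n x" for n x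
  define W where "W n x = (1 / s n) *\<^sub>R (Y n x - main n x)" for n x
  have main_eq: "main n x = (2 * Re (mode \<xi> n x)) *\<^sub>R a - (2 * Im (mode \<xi> n x)) *\<^sub>R b" for n x
    by (simp add: main_def Re_vec_scale a_def b_def scaleR_diff_right)
  note [measurable] = adapted_measurable[OF adapted_mode] adapted_measurable[OF adapted_composition]
  have main_meas [measurable]: "main n \<in> borel_measurable M" for n
    unfolding main_eq[abs_def] by measurable
  have Y_meas [measurable]: "Y n \<in> borel_measurable M" for n
  proof -
    have "(\<lambda>x. 2 *\<^sub>R Re_vec ((of_nat n powr (omega m ^ k) * \<Xi> k x) *s v k)) \<in> borel_measurable M"
      if "k \<in> {1..<p}" for k
    proof -
      note [measurable] = \<Xi>[OF that]
      show ?thesis unfolding Re_vec_scale by measurable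
    qed
    then have "(\<lambda>x. \<Sum>k\<in>{1..<p}. 2 *\<^sub>R Re_vec ((of_nat n powr (omega m ^ k) * \<Xi> k x) *s v k)) \<in> borel_measurable M"
      by (rule borel_measurable_sum)
    from borel_measurable_diff[OF borel_measurable_diff[OF
          adapted_measurable[OF adapted_composition] borel_measurable_const] this]
    show ?thesis unfolding Y_def[abs_def] .
  qed
  have main_le: "norm (main n x) \<le> 2 * (norm a + norm b) * norm (mode \<xi> n x)" for n x
  proof -
    have "norm (main n x) \<le> 2 * \<bar>Re (mode \<xi> n x)\<bar> * norm a + 2 * \<bar>Im (mode \<xi> n x)\<bar> * norm b"
      unfolding main_eq by (rule order_trans[OF norm_triangle_ineq4]) (simp add: abs_mult)
    also have "\<dots> \<le> 2 * norm (mode \<xi> n x) * norm a + 2 * norm (mode \<xi> n x) * norm b"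
      by (intro add_mono mult_right_mono mult_left_mono abs_Re_le_cmod abs_Im_le_cmod) auto
    finally show ?thesis by (simp add: algebra_simps)
  qed
  have mode_int: "integrable M (\<lambda>x. norm (mode \<xi> n x))" for n
    by (rule adapted_integrable[OF adapted_norm_mode])
  have main_int: "integrable M (\<lambda>x. norm (main n x))" for n
    by (rule Bochner_Integration.integrable_bound[of M "\<lambda>x. 2 * (norm a + norm b) * norm (mode \<xi> n x)"])
      (use mode_int main_le in \<open>auto intro!: order_trans[OF main_le]\<close>)
  define R where "R n x = (\<Sum>k\<in>{1..3 * p}. norm (remainder p \<Xi> k n x))" for n x
  have R_int: "integrable M (R n)" for n
    unfolding R_def[abs_def] using rem_int by (intro Bochner_Integration.integrable_sum) auto
  have diff_le: "norm (Y n x - main n x) \<le> real m * (2 * R n x)" if x: "x \<in> space M" for n x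
  proof -
    have v1: "norm (v k $ i) \<le> 1" for k i
      unfolding v_def norm_eigvec_nth[OF m0] using m0 by simp
    have Re1: "\<bar>Re (z * v k $ i)\<bar> \<le> norm z" for z k i
    proof -
      have "\<bar>Re (z * v k $ i)\<bar> \<le> norm z * norm (v k $ i)"
        unfolding norm_mult[symmetric] by (rule abs_Re_le_cmod)
      also have "\<dots> \<le> norm z * 1" using v1 by (intro mult_left_mono) auto
      finally show ?thesis by simp
    qed
    have comp: "\<bar>(Y n x - main n x) $ i\<bar> \<le> 2 * R n x" for i
    proof -
      have "(Y n x - main n x) $ i = 2 * (\<Sum>k\<in>{1..<3 * p}. Re (remainder p \<Xi> k n x * v k $ i))
          + Re (remainder p \<Xi> (3 * p) n x * v (3 * p) $ i)"
        unfolding Y_def main_def \<xi>_def v_def by (rule centered_composition_nth[OF m idx x])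
      also have "\<bar>\<dots>\<bar> \<le> 2 * (\<Sum>k\<in>{1..<3 * p}. norm (remainder p \<Xi> k n x)) + norm (remainder p \<Xi> (3 * p) n x)"
      proof -
        have "\<bar>\<Sum>k\<in>{1..<3 * p}. Re (remainder p \<Xi> k n x * v k $ i)\<bar> \<le> (\<Sum>k\<in>{1..<3 * p}. norm (remainder p \<Xi> k n x))"
          by (intro order_trans[OF sum_abs] sum_mono Re1)
        then show ?thesis using Re1[of "remainder p \<Xi> (3 * p) n x" "3 * p" i] by linarith
      qed
      also have "\<dots> \<le> 2 * R n x"
      proof -
        have "{1..3 * p} = insert (3 * p) {1..<3 * p}" using m by auto
        then show ?thesis by (simp add: R_def)
      qed
      finally show ?thesis .
    qed
    have "norm (Y n x - main n x) \<le> (\<Sum>i\<in>UNIV. \<bar>(Y n x - main n x) $ i\<bar>)" by (rule norm_le_l1_cart)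
    also have "\<dots> \<le> (\<Sum>i\<in>(UNIV :: 'm set). 2 * R n x)" by (intro sum_mono comp)
    also have "\<dots> = real m * (2 * R n x)"
      using bij_betw_same_card[OF idx] by simp
    finally show ?thesis .
  qed
  have diff_int: "integrable M (\<lambda>x. norm (Y n x - main n x))" for n
  proof (rule Bochner_Integration.integrable_bound)
    show "integrable M (\<lambda>x. real m * (2 * R n x))" using R_int by simp
    show "AE x in M. norm (norm (Y n x - main n x)) \<le> norm (real m * (2 * R n x))"
    proof (rule AE_I2)
      fix x assume "x \<in> space M"
      from diff_le[OF this, of n] show "norm (norm (Y n x - main n x)) \<le> norm (real m * (2 * R n x))" by simp
    qed
  qed measurable
  define K where "K = real m * (2 * (\<Sum>k\<in>{1..3 * p}. C k))"
  have diff_mean: "(\<integral>x. norm (Y n x - main n x) \<partial>M) \<le> K * sqrt (real (Suc n))" if n: "n \<ge> 1" for n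
  proof -
    have "(\<integral>x. norm (Y n x - main n x) \<partial>M) \<le> (\<integral>x. real m * (2 * R n x) \<partial>M)"
      using diff_int R_int diff_le by (intro integral_mono) auto
    also have "\<dots> = real m * (2 * (\<Sum>k\<in>{1..3 * p}. (\<integral>x. norm (remainder p \<Xi> k n x) \<partial>M)))"
      using rem_int by (simp add: R_def)
    also have "\<dots> \<le> real m * (2 * (\<Sum>k\<in>{1..3 * p}. C k * sqrt (real (Suc n))))"
      using rem n by (intro mult_left_mono sum_mono) auto
    also have "\<dots> = K * sqrt (real (Suc n))" by (simp add: K_def sum_distrib_right)
    finally show ?thesis .
  qed
  have conv: "conv_in_distribution M (\<lambda>n x. U n x + W n x) (plane_normal (sqrt 2 *\<^sub>R a) (sqrt 2 *\<^sub>R b))"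
  proof (rule conv_in_distribution_of_char_perturbed)
    show "prob_space M" by unfold_locales
    show "prob_space (plane_normal (sqrt 2 *\<^sub>R a) (sqrt 2 *\<^sub>R b))" by (rule prob_space_plane_normal)
    show "sets (plane_normal (sqrt 2 *\<^sub>R a) (sqrt 2 *\<^sub>R b)) = sets borel" by (rule sets_plane_normal)
    show "integrable (plane_normal (sqrt 2 *\<^sub>R a) (sqrt 2 *\<^sub>R b)) norm" by (rule integrable_norm_plane_normal)
    show "U n \<in> borel_measurable M" "W n \<in> borel_measurable M" for n
      unfolding U_def[abs_def] W_def[abs_def] by measurable
    show "integrable M (\<lambda>x. norm (U n x))" "integrable M (\<lambda>x. norm (W n x))" for n
      unfolding U_def W_def norm_scaleR using main_int diff_int by simp_all
    show "\<forall>\<^sub>F n in sequentially. (\<integral>x. norm (U n x) \<partial>M) \<le> 4 * (norm a + norm b)"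
      using critical_mode_mean_bounded[OF \<xi>, folded s_def] eventually_ge_at_top[of 2]
    proof eventually_elim
      case (elim n)
      have pos: "0 < s n" using elim by (simp add: s_def)
      have "(\<integral>x. norm (main n x) \<partial>M) \<le> (\<integral>x. 2 * (norm a + norm b) * norm (mode \<xi> n x) \<partial>M)"
        using main_int mode_int main_le by (intro integral_mono) auto
      also have "\<dots> = 2 * (norm a + norm b) * (\<integral>x. norm (mode \<xi> n x) \<partial>M)" by simp
      also have "\<dots> \<le> 2 * (norm a + norm b) * (2 * s n)" using elim by (intro mult_left_mono) auto
      finally have "(\<integral>x. norm (main n x) \<partial>M) \<le> 4 * (norm a + norm b) * s n" by (simp add: algebra_simps)
      then show ?case using pos by (simp add: U_def divide_le_eq)
    qed
    show "(\<lambda>n. \<integral>x. norm (W n x) \<partial>M) \<longlonglongrightarrow> 0"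
    proof (rule Lim_null_comparison)
      show "\<forall>\<^sub>F n in sequentially. norm (\<integral>x. norm (W n x) \<partial>M) \<le> K * (sqrt (real (Suc n)) / s n)"
        using eventually_ge_at_top[of 1]
      proof eventually_elim
        case (elim n)
        have "(\<integral>x. norm (W n x) \<partial>M) = (\<integral>x. norm (Y n x - main n x) \<partial>M) / s n"
          using s_nonneg[of n] by (simp add: W_def)
        also have "\<dots> \<le> K * sqrt (real (Suc n)) / s n"
          by (intro divide_right_mono diff_mean elim s_nonneg)
        finally show ?case by simp
      qed
      have "(\<lambda>n. sqrt (real (Suc n)) / s n) \<longlonglongrightarrow> 0" unfolding s_def by real_asymp
      from tendsto_mult_left[OF this, of K] show "(\<lambda>n. K * (sqrt (real (Suc n)) / s n)) \<longlonglongrightarrow> 0" by simp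
    qed
    fix t :: "real ^ 'm"
    define z where "z = 2 * Complex (t \<bullet> a) (t \<bullet> b)"
    have "t \<bullet> U n x = Re (z * mode \<xi> n x) / s n" for n x
    proof -
      have "t \<bullet> U n x = (1 / s n) * (2 * Re (mode \<xi> n x) * (t \<bullet> a) - 2 * Im (mode \<xi> n x) * (t \<bullet> b))"
        by (simp only: U_def main_eq inner_scaleR_right inner_diff_right)
      moreover have "Re (z * mode \<xi> n x) = 2 * Re (mode \<xi> n x) * (t \<bullet> a) - 2 * Im (mode \<xi> n x) * (t \<bullet> b)"
        by (simp add: z_def algebra_simps)
      ultimately show ?thesis by simp
    qed
    moreover have "- ((norm z)\<^sup>2 / 4) = - ((t \<bullet> (sqrt 2 *\<^sub>R a))\<^sup>2 + (t \<bullet> (sqrt 2 *\<^sub>R b))\<^sup>2) / 2"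
      by (simp add: z_def norm_mult power_mult_distrib cmod_power2) (simp add: field_simps)
    ultimately show "(\<lambda>n. \<integral>x. iexp (t \<bullet> U n x) \<partial>M)
        \<longlonglongrightarrow> (\<integral>y. iexp (t \<bullet> y) \<partial>plane_normal (sqrt 2 *\<^sub>R a) (sqrt 2 *\<^sub>R b))"
      using char_mode_critical[OF \<xi>, of z, folded s_def] unfolding char_plane_normal by (simp only:)
  qed
  have "U n x + W n x = (1 / s n) *\<^sub>R Y n x" for n x
    by (simp add: U_def W_def scaleR_diff_right)
  with conv show ?thesis
    by (intro that[of \<Xi>] \<Xi>) (simp_all add: Y_def s_def a_def b_def)
qed

theorem theorem1p2:
  fixes M :: "'a measure"
    and m r :: nat
    and draw ty :: "nat \<Rightarrow> 'a \<Rightarrow> nat"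
    and idx :: "'m::finite \<Rightarrow> nat"
    and R :: "nat \<Rightarrow> 'a \<Rightarrow> real ^ 'm"
    and v :: "nat \<Rightarrow> complex ^ 'm"
  assumes "m \<ge> 2" and "6 dvd m"
    and "r = nat \<lfloor>(real m - 1) / 6\<rfloor>"
    and "bij_betw idx UNIV {..<m}"
    and "cyclic_urn M m draw ty"
    and "R = composition idx ty"
    and "v = eigvec m idx"
  shows "\<exists>\<Sigma> :: real ^ 'm ^ 'm.
    complex_mat \<Sigma> =
      outer_adj (v (m div 6)) (v (m div 6)) + outer_adj (v (5 * m div 6)) (v (5 * m div 6)) \<and>
    rank \<Sigma> = 2 \<and>
    (\<exists>\<Xi> :: nat \<Rightarrow> 'a \<Rightarrow> complex. (\<forall>k\<in>{1..r}. \<Xi> k \<in> borel_measurable M) \<and>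
      (\<exists>\<nu>. centered_normal \<Sigma> \<nu> \<and>
        conv_in_distribution M
          (\<lambda>n x. (1 / sqrt (real n * ln (real n))) *\<^sub>R
             (R n x - (\<integral>y. R n y \<partial>M) -
              (\<Sum>k=1..r. 2 *\<^sub>R Re_vec ((of_nat n powr (omega m ^ k) * \<Xi> k x) *s v k))))
          \<nu>))"
proof -
  interpret cyclic_urn M m draw ty by fact
  \<comment> \<open>the index of the critical mode\<close>
  obtain p where m: "m = 6 * p" using assms(2) by (elim dvdE)
  have p: "0 < p" using m assms(1) by simp
  have m0: "0 < m" using m p by simp
  have "\<lfloor>(real m - 1) / 6\<rfloor> = int p - 1"
    by (rule floor_unique) (simp_all add: m field_simps)
  then have r: "{1..r} = {1..<p}" using assms(3) p by auto
  have div: "m div 6 = p" "5 * m div 6 = m - p" using m by simp_all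
  note idx = assms(4)
  define S :: "real ^ 'm ^ 'm" where "S = (\<chi> i j.
      (sqrt 2 *\<^sub>R Re_vec (v p)) $ i * (sqrt 2 *\<^sub>R Re_vec (v p)) $ j
      + (sqrt 2 *\<^sub>R Im_vec (v p)) $ i * (sqrt 2 *\<^sub>R Im_vec (v p)) $ j)"
  have conj: "v (m - p) $ i = cnj (v p $ i)" for i
    unfolding assms(7) using m by (intro eigvec_complement[OF m0]) simp
  have square: "(\<Sum>i\<in>UNIV. (v p $ i)\<^sup>2) = 0"
    unfolding assms(7) using m p by (intro sum_eigvec_square[OF m0 idx]) simp_all
  have "v p \<noteq> 0"
  proof
    assume "v p = 0"
    then have "norm (v p $ i) = 0" for i by simp
    then show False using m0 by (simp add: assms(7) norm_eigvec_nth[OF m0] del: norm_eq_zero)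
  qed
  note cov = covariance_matrix[OF conj square this, folded S_def]
  from cyclic_urn_limit[OF m p idx] obtain \<Xi> where \<Xi>: "\<And>k. k \<in> {1..<p} \<Longrightarrow> \<Xi> k \<in> borel_measurable M"
    and conv: "conv_in_distribution M
      (\<lambda>n x. (1 / sqrt (real n * ln (real n))) *\<^sub>R
         (composition idx ty n x - (\<integral>y. composition idx ty n y \<partial>M) -
          (\<Sum>k\<in>{1..<p}. 2 *\<^sub>R Re_vec ((of_nat n powr (omega m ^ k) * \<Xi> k x) *s eigvec m idx k))))
      (plane_normal (sqrt 2 *\<^sub>R Re_vec (eigvec m idx p)) (sqrt 2 *\<^sub>R Im_vec (eigvec m idx p)))"
    by blast
  show ?thesis
    unfolding r div assms(6)
    using cov \<Xi> conv unfolding assms(7) by blast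
qed

end
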